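(* Let $N\ge 1$ and $n\ge 3$ be fixed integers and $q=N(N+1)/2$. Let $M_1,M_2,\ldots\in P_N$ and $\Sigma_1,\Sigma_2,\ldots\in P_q$ be such that (i) $\limsup_{p\to\infty} p^{-1}\sum_{i=1}^p (\operatorname{tr}\Sigma_i)^4<\infty$, (ii) $\limsup_{p\to\infty} p^{-1}\sum_{i=1}^p \widetilde{M}_i^T\Sigma_i\widetilde{M}_i<\infty$, (iii) $\limsup_{p\to\infty} p^{-1}\sum_{i=1}^p \|\log M_i\|^{2+\delta}<\infty$ for some $\delta>0$. Let $X_{ij}\sim \mathrm{LN}(M_i,\Sigma_i)$, $i=1,\ldots,p$, $j=1,\ldots,n$, be independent, let $\boldsymbol{M}=(M_1,\ldots,M_p)$, $\boldsymbol{\Sigma}=(\Sigma_1,\ldots,\Sigma_p)$, and let $(\widehat{\boldsymbol{M}}^{\mathrm{SURE}},\widehat{\boldsymbol{\Sigma}}^{\mathrm{SURE}})$ be the estimators obtained by plugging the minimizer of $\mathrm{SURE}(\lambda,\Psi,\nu,\mu)$ into $(\widehat{\boldsymbol{M}}^{\lambda,\mu},\widehat{\boldsymbol{\Sigma}}^{\Psi,\nu})$. Then for all $\lambda>0$, $\mu\in P_N$, $\nu>q+1$ and $\Psi\in P_q$, $$\lim_{p\to\infty}\Big[R\big((\widehat{\boldsymbol{M}}^{\mathrm{SURE}},\widehat{\boldsymbol{\Sigma}}^{\mathrm{SURE}}),(\boldsymbol{M},\boldsymbol{\Sigma})\big)-R\big((\widehat{\boldsymbol{M}}^{\lambda,\mu},\widehat{\boldsymbol{\Sigma}}^{\Psi,\nu}),(\boldsymbol{M},\boldsymbol{\Sigma})\big)\Big]\le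 0.$$
   Context: $P_k$ is the set of $k\times k$ real symmetric positive-definite matrices; $\log$ and $\exp$ are the matrix logarithm and exponential; $\|\cdot\|$ is the Frobenius norm for matrices and the Euclidean norm for vectors. For a symmetric $N\times N$ matrix $Y$, $\operatorname{vec}(Y)=[y_{11},\ldots,y_{NN},\sqrt2\,(y_{ij})_{i<j}]^T\in\mathbb{R}^{q}$, $q=N(N+1)/2$. For $X\in P_N$, $\widetilde X=\operatorname{vec}(\log X)\in\mathbb{R}^q$. The Log-Euclidean distance on $P_N$ is $d_{\mathrm{LE}}(X,Y)=\|\log X-\log Y\|=\|\widetilde X-\widetilde Y\|$. A $P_N$-valued random variable $X$ has the Log-Normal distribution $\mathrm{LN}(M,\Sigma)$, with $M\in P_N$, $\Sigma\in P_q$, if $\widetilde X\sim N_q(\widetilde M,\Sigma)$. The matrices $M_i,\Sigma_i$ are non-random (unknown parameters). Put $$\bar X_i=\exp\Big(n^{-1}\sum_{j=1}^n\log X_{ij}\Big),\qquad S_i=\sum_{j=1}^n(\widetilde X_{ij}-\widetilde{\bar X_i})(\widetilde X_{ij}-\widetilde{\bar X_i})^T .$$ For $\lambda>0$, $\mu\in P_N$, $\nu>q+1$, $\Psi\in P_q$, the estimators $\widehat{\boldsymbol M}^{\lambda,\mu}=(\widehat M_1,\ldots,\widehat M_p)$, $\widehat{\boldsymbol\Sigma}^{\Psi,\nu}=(\widehat\Sigma_1,\ldots,\widehat\Sigma_p)$ are $$\widehat M_i=\exp\Big(\frac{n\log\bar X_i+\lambda\log\mu}{\lambda+n}\Big),\qquad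 \widehat\Sigma_i=\frac{\Psi+S_i}{\nu+n-q-2}.$$ The loss is $L\big((\widehat{\boldsymbol M},\widehat{\boldsymbol\Sigma}),(\boldsymbol M,\boldsymbol\Sigma)\big)=p^{-1}\sum_{i=1}^p d_{\mathrm{LE}}^2(\widehat M_i,M_i)+p^{-1}\sum_{i=1}^p\|\widehat\Sigma_i-\Sigma_i\|^2$ and the risk is $R=E[L]$, the expectation being over the $X_{ij}$. Stein's unbiased risk estimate is $$\begin{aligned}\mathrm{SURE}(\lambda,\Psi,\nu,\mu)=p^{-1}\sum_{i=1}^p\Big\{&(\lambda+n)^{-2}\Big[\tfrac{n-\lambda^2/n}{n-1}\operatorname{tr}S_i+\lambda^2d_{\mathrm{LE}}^2(\bar X_i,\mu)\Big]\\&+(\nu+n-q-2)^{-2}\Big[\tfrac{n-3+(\nu-q-1)^2}{(n+1)(n-2)}\operatorname{tr}(S_i^2)+\tfrac{(n-1)^2-(\nu-q-1)^2}{(n-1)(n+1)(n-2)}(\operatorname{tr}S_i)^2\\&\qquad-2\tfrac{\nu-q-1}{n-1}\operatorname{tr}(\Psi S_i)+\operatorname{tr}(\Psi^2)\Big]\Big\}.\end{aligned}$$ The SURE estimators are $\widehat{\boldsymbol M}^{\mathrm{SURE}}=\widehat{\boldsymbol M}^{\hat\lambda,\hat\mu}$ and $\widehat{\boldsymbol\Sigma}^{\mathrm{SURE}}=\widehat{\boldsymbol\Sigma}^{\hat\Psi,\hat\nu}$, where $(\hat\lambda,\hat\Psi,\hat\nu,\hat\mu)$ is the (data-dependent) vector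 minimizing $\mathrm{SURE}(\lambda,\Psi,\nu,\mu)$ subject to $\lambda>0$, $\nu>q+1$, $\|\Psi\|\le\max_{1\le i\le p}\|S_i\|$, $\|\log\mu\|\le\max_{1\le i\le p}\|\log\bar X_i\|$.
   Formalization: Since a minimizer of SURE need not exist, the parameters are a minimizer when one exists and otherwise a feasible vector within ε_p → 0 of the infimum; since the limit of the risk difference need not exist, "lim ≤ 0" is proved as "limsup ≤ 0". *)

theory Defs
  imports "HOL-Probability.Probability" "HOL-Library.Uprod"
begin

instance uprod :: (finite) finite
proof
  have "(UNIV :: 'a uprod set) = range (\<lambda>(a, b). Upair a b)"
    by (auto simp: image_iff) (metis uprod_exhaust)
  then show "finite (UNIV :: 'a uprod set)"
    by simp
qed

type_synonym 'k sqmat = "((real, 'k) vec, 'k) vec"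

text \<open>
  The norm of \<open>'n sqmat\<close> is the Frobenius norm.  The coordinates of
  \<open>vec(Y)\<close> are indexed by the unordered pairs of matrix indices (diagonal pairs
  included); by \<open>card_UNIV_uprod\<close> there are \<open>q = N (N + 1) / 2\<close> of them, where
  \<open>N = CARD('n)\<close>.
\<close>

definition spd :: "('k::finite) sqmat set" where
  "spd = {A. transpose A = A \<and> (\<forall>v. v \<noteq> 0 \<longrightarrow> v \<bullet> (A *v v) > 0)}"

definition svec :: "('n::{finite,linorder}) sqmat \<Rightarrow> real^('n uprod)" where
  "svec Y = (\<chi> u. let i = Min (set_uprod u); j = Max (set_uprod u)
                   in if i = j then Y $ i $ i else sqrt 2 * Y $ i $ j)"

primrec mat_power :: "('n::finite) sqmat \<Rightarrow> nat \<Rightarrow> 'n sqmat" where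
  "mat_power A 0 = mat 1"
| "mat_power A (Suc k) = A ** mat_power A k"

text \<open>Vectors and matrices carry no \<open>real_normed_algebra_1\<close> structure, so the library
  exponential does not apply to them.\<close>

definition mat_exp :: "('n::finite) sqmat \<Rightarrow> 'n sqmat" where
  "mat_exp A = (\<Sum>k. mat_power A k /\<^sub>R fact k)"

text \<open>The matrix exponential is a bijection from the symmetric matrices onto
  \<^const>\<open>spd\<close>; the logarithm is its inverse and is only meaningful on \<^const>\<open>spd\<close>.\<close>

definition mat_log :: "('n::finite) sqmat \<Rightarrow> 'n sqmat" where
  "mat_log X = (THE L. transpose L = L \<and> mat_exp L = X)"

definition log_vec :: "('n::{finite,linorder}) sqmat \<Rightarrow> real^('n uprod)" where
  "log_vec X = svec (mat_log X)"

definition le_dist :: "('n::finite) sqmat \<Rightarrow> 'n sqmat \<Rightarrow> real" where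
  "le_dist X Y = norm (mat_log X - mat_log Y)"

definition outer_prod :: "real^('k::finite) \<Rightarrow> real^'k \<Rightarrow> 'k sqmat" where
  "outer_prod v w = (\<chi> a b. v $ a * w $ b)"

definition mvn_density :: "real^('k::finite) \<Rightarrow> 'k sqmat \<Rightarrow> real^'k \<Rightarrow> real" where
  "mvn_density m S x =
     exp (- ((x - m) \<bullet> (matrix_inv S *v (x - m))) / 2) / sqrt ((2 * pi) ^ CARD('k) * det S)"

definition log_normal ::
  "'w measure \<Rightarrow> ('w \<Rightarrow> ('n::{finite,linorder}) sqmat)
    \<Rightarrow> 'n sqmat \<Rightarrow> 'n uprod sqmat \<Rightarrow> bool" where
  "log_normal P X M S \<longleftrightarrow>
     X \<in> borel_measurable P \<and> (\<forall>\<omega>\<in>space P. X \<omega> \<in> spd) \<and>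
     distributed P lborel (\<lambda>\<omega>. log_vec (X \<omega>)) (\<lambda>x. ennreal (mvn_density (log_vec M) S x))"

text \<open>A sample \<open>x 1, \<dots>, x n\<close> from one population is a function \<open>x :: nat \<Rightarrow> 'n sqmat\<close>;
  the whole data set of \<open>p\<close> populations is a function \<open>x\<close> with sample \<open>x i\<close>,
  \<open>i = 1, \<dots>, p\<close>.\<close>

definition log_mean :: "nat \<Rightarrow> (nat \<Rightarrow> ('n::finite) sqmat) \<Rightarrow> 'n sqmat" where
  "log_mean n x = mat_exp ((\<Sum>j=1..n. mat_log (x j)) /\<^sub>R real n)"

definition scatter ::
  "nat \<Rightarrow> (nat \<Rightarrow> ('n::{finite,linorder}) sqmat) \<Rightarrow> 'n uprod sqmat" where
  "scatter n x =
     (\<Sum>j=1..n. outer_prod (log_vec (x j) - log_vec (log_mean n x))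
                           (log_vec (x j) - log_vec (log_mean n x)))"

definition M_est :: "nat \<Rightarrow> real \<Rightarrow> ('n::finite) sqmat \<Rightarrow> (nat \<Rightarrow> 'n sqmat) \<Rightarrow> 'n sqmat" where
  "M_est n lam mu x =
     mat_exp ((real n *\<^sub>R mat_log (log_mean n x) + lam *\<^sub>R mat_log mu) /\<^sub>R (lam + real n))"

definition Sigma_est ::
  "nat \<Rightarrow> 'n uprod sqmat \<Rightarrow> real \<Rightarrow> (nat \<Rightarrow> ('n::{finite,linorder}) sqmat)
    \<Rightarrow> 'n uprod sqmat" where
  "Sigma_est n Psi nu x =
     (Psi + scatter n x) /\<^sub>R (nu + real n - real CARD('n uprod) - 2)"

definition loss ::
  "nat \<Rightarrow> (nat \<Rightarrow> ('n::finite) sqmat) \<Rightarrow> (nat \<Rightarrow> 'n uprod sqmat)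
    \<Rightarrow> (nat \<Rightarrow> 'n sqmat) \<Rightarrow> (nat \<Rightarrow> 'n uprod sqmat) \<Rightarrow> real" where
  "loss p Mh Sh M S =
     (\<Sum>i=1..p. (le_dist (Mh i) (M i))\<^sup>2) / real p + (\<Sum>i=1..p. (norm (Sh i - S i))\<^sup>2) / real p"

text \<open>The expectation of the nonnegative loss is taken in \<open>[0, \<infinity>]\<close>, so that no
  convention about non-integrable losses is involved.\<close>

definition risk ::
  "'w measure \<Rightarrow> nat \<Rightarrow> (nat \<Rightarrow> 'w \<Rightarrow> ('n::finite) sqmat) \<Rightarrow> (nat \<Rightarrow> 'w \<Rightarrow> 'n uprod sqmat)
    \<Rightarrow> (nat \<Rightarrow> 'n sqmat) \<Rightarrow> (nat \<Rightarrow> 'n uprod sqmat) \<Rightarrow> ereal" where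
  "risk P p Mh Sh M S =
     enn2ereal (\<integral>\<^sup>+\<omega>. ennreal (loss p (\<lambda>i. Mh i \<omega>) (\<lambda>i. Sh i \<omega>) M S) \<partial>P)"

type_synonym 'n params = "real \<times> 'n uprod sqmat \<times> real \<times> 'n sqmat"

definition SURE ::
  "nat \<Rightarrow> nat \<Rightarrow> (nat \<Rightarrow> nat \<Rightarrow> ('n::{finite,linorder}) sqmat) \<Rightarrow> 'n params \<Rightarrow> real" where
  "SURE n p x = (\<lambda>(lam, Psi, nu, mu).
     let m = real n; q = real CARD('n uprod) in
     (\<Sum>i=1..p.
        let S = scatter n (x i) in
        ((m - lam\<^sup>2 / m) / (m - 1) * trace S + lam\<^sup>2 * (le_dist (log_mean n (x i)) mu)\<^sup>2)
          / (lam + m)\<^sup>2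
        + ((m - 3 + (nu - q - 1)\<^sup>2) / ((m + 1) * (m - 2)) * trace (S ** S)
           + ((m - 1)\<^sup>2 - (nu - q - 1)\<^sup>2) / ((m - 1) * (m + 1) * (m - 2)) * (trace S)\<^sup>2
           - 2 * ((nu - q - 1) / (m - 1)) * trace (Psi ** S)
           + trace (Psi ** Psi))
          / (nu + m - q - 2)\<^sup>2)
     / real p)"

definition feasible ::
  "nat \<Rightarrow> nat \<Rightarrow> (nat \<Rightarrow> nat \<Rightarrow> ('n::{finite,linorder}) sqmat) \<Rightarrow> 'n params \<Rightarrow> bool" where
  "feasible n p x = (\<lambda>(lam, Psi, nu, mu).
     lam > 0 \<and> nu > real CARD('n uprod) + 1 \<and> Psi \<in> spd \<and> mu \<in> spd \<and>
     norm Psi \<le> (MAX i\<in>{1..p}. norm (scatter n (x i))) \<and>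
     norm (mat_log mu) \<le> (MAX i\<in>{1..p}. norm (mat_log (log_mean n (x i)))))"

text \<open>
  The constraint set is neither closed nor bounded, and on an event of positive probability
  the infimum of \<^const>\<open>SURE\<close> is not attained (it may only be approached as \<open>lam\<close> or \<open>nu\<close>
  tends to infinity, or with \<open>Psi\<close> becoming singular).  The selected parameter vector is a
  minimizer whenever one exists; otherwise it is feasible and within \<open>e\<close> of the infimum.
\<close>

definition SURE_choice ::
  "real \<Rightarrow> nat \<Rightarrow> nat \<Rightarrow> (nat \<Rightarrow> nat \<Rightarrow> ('n::{finite,linorder}) sqmat) \<Rightarrow> 'n params \<Rightarrow> bool" where
  "SURE_choice e n p x \<theta> \<longleftrightarrow>
     (if \<exists>\<theta>'. is_arg_min (SURE n p x) (feasible n p x) \<theta>'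
      then is_arg_min (SURE n p x) (feasible n p x) \<theta>
      else feasible n p x \<theta> \<and> (\<forall>\<theta>'. feasible n p x \<theta>' \<longrightarrow> SURE n p x \<theta> \<le> SURE n p x \<theta>' + e))"

end

theory Submission
  imports Defs "HOL-Real_Asymp.Real_Asymp"
begin

text \<open>
  In logarithmic coordinates the observations are Gaussian vectors \<open>m i + Z i j\<close>, and both the loss
  and its unbiased estimate are averages over the populations of quadratic functions of the sample
  mean and of the scatter matrix.  Their difference has a simple form (\<open>pop_loss_minus_sure\<close>): with
  the shrinkage weights \<open>lam / (lam + n)\<close> and \<open>(nu - q - 1) / (nu + n - q - 2)\<close>, which lie between 0
  and 1, it is a combination of six averages of centred statistics whose coefficients are bounded
  uniformly in the parameters, apart from two averages that are paired with \<open>log mu\<close> and \<open>Psi\<close>.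
  That the statistics are centred is the fourth-moment calculus of the Wishart distribution, which
  follows here from Isserlis' formula.

  By independence an average of centred statistics has second moment \<open>O(1/p)\<close>, provided that the
  second moments are bounded on average, and this is what the hypotheses on \<open>trace Sigma\<close> and on the
  quadratic form of the means give.  The constraints allow \<open>mu\<close> and \<open>Psi\<close> to be as large as the
  largest sample statistic.  The bound on the moment of order \<open>2 + delta\<close> and the eighth moments of
  Gaussian variables make that maximum \<open>o(sqrt p)\<close>, so its product with an average of order
  \<open>1 / sqrt p\<close> still tends to zero in mean.  Hence loss and estimate differ by a random variable
  with vanishing expectation, uniformly over the constraint set (\<open>loss_near_sure\<close>,
  \<open>approx_error_tendsto_zero\<close>), and near minimality of the estimate turns into near minimality of the
  loss.

  The fixed competitor \<open>(lam, Psi, nu, mu)\<close> need not satisfy the data-dependent constraints, so it is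
  first projected radially onto them.  For \<open>mu\<close> this does not raise the estimate, because the constraint ball
  contains all sample means.  For \<open>Psi\<close> it raises the estimate by at most a multiple of the mean
  scatter, and only when all scatter matrices are smaller than \<open>norm Psi\<close> (\<open>sure_clip\<close>).  This term
  disappears in the limit by a dichotomy: either \<open>trace (Sigma i)\<close> tends to 0, and then so does the
  mean scatter, or infinitely many populations have variances bounded below, and then the largest
  scatter matrix exceeds any bound with probability tending to one (\<open>escape_term_tendsto_zero\<close>).

  The Gaussian facts are all derived from the moment generating function of linear functionals,
  which comes from the density by completing the square (\<open>gaussian_linear_functional\<close>).
  The matrix logarithm is handled through the spectral theorem; its measurability is what carries
  independence of the matrices over to their coordinate vectors.
\<close>

section \<open>The spectral theorem for symmetric matrices\<close>

lemma symmetric_matrix_inner: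
  fixes A :: "real^'n^'n"
  assumes "transpose A = A"
  shows "x \<bullet> (A *v y) = (A *v x) \<bullet> y"
  using dot_lmul_matrix[of x A y] assms by (metis transpose_matrix_vector)

text \<open>At a maximizer \<open>v\<close> of the quadratic form on the unit sphere of the subspace, with maximum
  \<open>l\<close>, the nonnegative form \<open>l |x|^2 - x \<bullet> A x\<close> vanishes; a zero of a semidefinite form lies in its
  kernel.\<close>
lemma exists_eigenvector_in_invariant_subspace:
  fixes A :: "real^'n^'n"
  assumes sym: "transpose A = A" and S: "subspace S" and inv: "\<And>x. x \<in> S \<Longrightarrow> A *v x \<in> S"
    and ne: "S \<noteq> {0}"
  obtains v l where "v \<in> S" "norm v = 1" "A *v v = l *\<^sub>R v"
proof -
  define K where "K = S \<inter> sphere 0 1"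
  have cK: "compact K" unfolding K_def
    by (simp add: S closed_subspace closed_Int_compact)
  obtain s where s: "s \<in> S" "s \<noteq> 0" using ne S subspace_0 by fastforce
  have "(1 / norm s) *\<^sub>R s \<in> K"
    using s S by (auto simp: K_def subspace_scale)
  then have "K \<noteq> {}" by auto
  have "continuous_on K (\<lambda>x. x \<bullet> (A *v x))"
    by (intro continuous_intros matrix_vector_mult_linear_continuous_on)
  from continuous_attains_sup[OF cK \<open>K \<noteq> {}\<close> this] obtain v where v: "v \<in> K"
    and vmax: "\<And>y. y \<in> K \<Longrightarrow> y \<bullet> (A *v y) \<le> v \<bullet> (A *v v)" by blast
  define l where "l = v \<bullet> (A *v v)"
  define Q where "Q x = l * (x \<bullet> x) - x \<bullet> (A *v x)" for x
  have vS: "v \<in> S" and nv: "norm v = 1" using v by (auto simp: K_def)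
  have Qnn: "Q x \<ge> 0" if "x \<in> S" for x
  proof (cases "x = 0")
    case False
    define y where "y = (1 / norm x) *\<^sub>R x"
    have "y \<in> K" using that False S by (auto simp: K_def y_def subspace_scale)
    then have "y \<bullet> (A *v y) \<le> l" using vmax l_def by auto
    moreover have "y \<bullet> (A *v y) = (x \<bullet> (A *v x)) / (norm x)\<^sup>2"
      by (simp add: y_def matrix_vector_mult_scaleR power2_eq_square)
    ultimately have "x \<bullet> (A *v x) \<le> l * (norm x)\<^sup>2"
      using False by (simp add: divide_le_eq)
    then show ?thesis by (simp add: Q_def power2_norm_eq_inner)
  qed (simp add: Q_def)
  define w where "w = l *\<^sub>R v - A *v v"
  have wS: "w \<in> S" unfolding w_def using S inv vS by (simp add: subspace_diff subspace_scale)
  have Qv: "Q v = 0" using nv by (simp add: Q_def l_def dot_square_norm)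
  have xw: "x \<bullet> w = l * (x \<bullet> v) - x \<bullet> (A *v v)" for x
    by (simp add: w_def inner_diff_right)
  have expand: "Q (v + t *\<^sub>R w) = 2 * t * (w \<bullet> w) + t\<^sup>2 * Q w" for t
  proof -
    have "v \<bullet> (A *v w) = w \<bullet> (A *v v)"
      using symmetric_matrix_inner[OF sym, of v w] by (simp add: inner_commute)
    then have "Q (v + t *\<^sub>R w) = Q v + 2 * t * (l * (w \<bullet> v) - w \<bullet> (A *v v)) + t\<^sup>2 * Q w"
      by (simp add: Q_def matrix_vector_right_distrib matrix_vector_mult_scaleR inner_add_left inner_add_right
          inner_commute[of v w] power2_eq_square) (simp add: algebra_simps)
    also have "l * (w \<bullet> v) - w \<bullet> (A *v v) = w \<bullet> w"
      using xw[of w] by simp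
    finally show ?thesis using Qv by simp
  qed
  have "w \<bullet> w = 0"
  proof (rule ccontr)
    assume "w \<bullet> w \<noteq> 0"
    then have pos: "w \<bullet> w > 0" by simp
    define t where "t = - (w \<bullet> w) / (Q w + 1)"
    have Qw: "Q w \<ge> 0" using Qnn wS by auto
    have "v + t *\<^sub>R w \<in> S" using S vS wS by (simp add: subspace_add subspace_scale)
    then have "0 \<le> 2 * t * (w \<bullet> w) + t\<^sup>2 * Q w" using Qnn expand by metis
    also have "\<dots> \<le> 2 * t * (w \<bullet> w) + t\<^sup>2 * (Q w + 1)"
      by (intro add_left_mono mult_left_mono) auto
    also have "t\<^sup>2 * (Q w + 1) = - t * (w \<bullet> w)"
      using Qw by (simp add: t_def power2_eq_square)
    finally have "0 \<le> t * (w \<bullet> w)" by simp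
    moreover have "t < 0" using pos Qw by (simp add: t_def)
    ultimately show False using pos by (simp add: zero_le_mult_iff)
  qed
  then have "A *v v = l *\<^sub>R v" by (simp add: w_def)
  with that vS nv show thesis by blast
qed

lemma spectral_theorem_invariant_subspace:
  fixes A :: "real^'n^'n"
  assumes sym: "transpose A = A" and "subspace S" and "\<And>x. x \<in> S \<Longrightarrow> A *v x \<in> S"
  shows "\<exists>B. B \<subseteq> S \<and> span B = S \<and> pairwise orthogonal B \<and>
    (\<forall>b\<in>B. norm b = 1 \<and> (\<exists>l. A *v b = l *\<^sub>R b))"
  using assms(2,3)
proof (induction "dim S" arbitrary: S rule: less_induct)
  case less
  show ?case
  proof (cases "S = {0}")
    case True
    then show ?thesis by (intro exI[of _ "{}"]) (auto simp: pairwise_def)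
  next
    case False
    obtain v l where v: "v \<in> S" "norm v = 1" "A *v v = l *\<^sub>R v"
      using exists_eigenvector_in_invariant_subspace[OF sym less.prems False] by blast
    define S' where "S' = {x \<in> S. x \<bullet> v = 0}"
    have S': "subspace S'" using less.prems(1)
      by (auto simp: S'_def subspace_def inner_add_left)
    have inv': "A *v x \<in> S'" if "x \<in> S'" for x
      using that less.prems(2) symmetric_matrix_inner[OF sym, of x v] v by (auto simp: S'_def)
    have vv: "v \<bullet> v = 1" using v by (simp add: dot_square_norm)
    have "v \<notin> S'" using vv by (simp add: S'_def)
    moreover have "S' \<subseteq> S" by (auto simp: S'_def)
    ultimately have "S' \<subset> S" using v(1) by blast
    then have "dim S' < dim S"
      by (metis S' dim_psubset less.prems(1) span_eq_iff)
    from less.hyps[OF this S' inv'] obtain B where B: "B \<subseteq> S'" "span B = S'" "pairwise orthogonal B"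
      "\<forall>b\<in>B. norm b = 1 \<and> (\<exists>l. A *v b = l *\<^sub>R b)" by blast
    have "span (insert v B) = S"
    proof
      show "span (insert v B) \<subseteq> S"
        using B(1) v less.prems(1) by (intro span_minimal) (auto simp: S'_def)
      show "S \<subseteq> span (insert v B)"
      proof
        fix x assume x: "x \<in> S"
        have "x - (x \<bullet> v) *\<^sub>R v \<in> S'"
          using x v vv less.prems(1) by (simp add: S'_def subspace_diff subspace_scale inner_diff_left)
        then have "x - (x \<bullet> v) *\<^sub>R v \<in> span B" using B by simp
        then show "x \<in> span (insert v B)" by (metis span_breakdown_eq)
      qed
    qed
    moreover have "pairwise orthogonal (insert v B)"
      using B by (auto simp: pairwise_insert S'_def orthogonal_def inner_commute)
    ultimately show ?thesis using B v
      by (intro exI[of _ "insert v B"]) (auto simp: S'_def)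
  qed
qed

theorem spectral_theorem:
  fixes A :: "real^'n^'n"
  assumes "transpose A = A"
  obtains B where "finite B" "span B = UNIV" "pairwise orthogonal B" "\<And>b. b \<in> B \<Longrightarrow> norm b = 1"
    "\<And>b. b \<in> B \<Longrightarrow> \<exists>l. A *v b = l *\<^sub>R b"
proof -
  obtain B where B: "span B = UNIV" "pairwise orthogonal B"
    "\<forall>b\<in>B. norm b = 1 \<and> (\<exists>l. A *v b = l *\<^sub>R b)"
    using spectral_theorem_invariant_subspace[OF assms subspace_UNIV] by auto
  then have "0 \<notin> B" by force
  then have "finite B" using B pairwise_orthogonal_independent independent_imp_finite by blast
  with that B show thesis by blast
qed

lemma orthonormal_expansion:
  fixes x :: "'a::euclidean_space"
  assumes "finite B" "span B = UNIV" "pairwise orthogonal B" "\<And>b. b \<in> B \<Longrightarrow> norm b = 1"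
  shows "(\<Sum>b\<in>B. (x \<bullet> b) *\<^sub>R b) = x"
proof -
  define y where "y = x - (\<Sum>b\<in>B. (x \<bullet> b) *\<^sub>R b)"
  have "y \<bullet> c = 0" if c: "c \<in> B" for c
  proof -
    have "(\<Sum>b\<in>B. (x \<bullet> b) * (b \<bullet> c)) = (\<Sum>b\<in>{c}. (x \<bullet> b) * (b \<bullet> c))"
      using assms c by (intro sum.mono_neutral_right) (auto simp: pairwise_def orthogonal_def)
    also have "\<dots> = x \<bullet> c" using assms(4)[OF c] by (simp add: dot_square_norm)
    finally show ?thesis by (simp add: y_def inner_diff_left inner_sum_left)
  qed
  then have "orthogonal y y"
    using assms(2) by (intro orthogonal_to_span[of y B y]) (simp_all add: orthogonal_def)
  then show ?thesis by (simp add: y_def orthogonal_self)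
qed

lemma matrix_eq_on_spanning_set:
  fixes A C :: "real^'n^'m"
  assumes "span B = UNIV" "\<And>b. b \<in> B \<Longrightarrow> A *v b = C *v b"
  shows "A = C"
proof -
  have "A *v x = C *v x" for x
    by (rule linear_eq_on[of "(*v) A" "(*v) C" x B]) (use assms in auto)
  then show ?thesis by (simp add: matrix_eq)
qed

section \<open>The matrix exponential and logarithm\<close>

lemma norm_matrix_power2: "(norm (A::real^'n^'m))\<^sup>2 = (\<Sum>i\<in>UNIV. \<Sum>j\<in>UNIV. (A $ i $ j)\<^sup>2)"
  unfolding power2_norm_eq_inner by (simp add: inner_vec_def power2_eq_square)

lemma norm_matrix_mult_le:
  fixes A :: "real^'n^'m" and C :: "real^'k^'n"
  shows "norm (A ** C) \<le> norm A * norm C"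
proof -
  have e: "(A ** C) $ i $ j = row i A \<bullet> column j C" for i j
    by (simp add: matrix_matrix_mult_def row_def column_def inner_vec_def)
  have "(norm (A ** C))\<^sup>2 = (\<Sum>i\<in>UNIV. \<Sum>j\<in>UNIV. (row i A \<bullet> column j C)\<^sup>2)"
    by (simp only: norm_matrix_power2 e)
  also have "\<dots> \<le> (\<Sum>i\<in>UNIV. \<Sum>j\<in>UNIV. (row i A \<bullet> row i A) * (column j C \<bullet> column j C))"
    by (intro sum_mono) (rule Cauchy_Schwarz_ineq)
  also have "\<dots> = (\<Sum>i\<in>UNIV. row i A \<bullet> row i A) * (\<Sum>j\<in>UNIV. column j C \<bullet> column j C)"
    by (simp add: sum_product)
  also have "(\<Sum>i\<in>UNIV. row i A \<bullet> row i A) = (norm A)\<^sup>2"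
    unfolding norm_matrix_power2 by (simp add: inner_vec_def row_def power2_eq_square)
  also have "(\<Sum>j\<in>UNIV. column j C \<bullet> column j C) = (norm C)\<^sup>2"
    unfolding norm_matrix_power2 inner_vec_def column_def
    by (subst sum.swap) (simp add: power2_eq_square)
  finally have "(norm (A ** C))\<^sup>2 \<le> (norm A * norm C)\<^sup>2" by (simp add: power_mult_distrib)
  then show ?thesis by (rule power2_le_imp_le) simp
qed

lemma norm_mat_power_le:
  fixes A :: "'n::finite sqmat"
  shows "norm (mat_power A k) \<le> norm A ^ k * norm (mat 1 :: 'n sqmat)"
proof (induction k)
  case (Suc k)
  have "norm (mat_power A (Suc k)) \<le> norm A * norm (mat_power A k)" by (simp add: norm_matrix_mult_le)
  also have "\<dots> \<le> norm A * (norm A ^ k * norm (mat 1 :: 'n sqmat))" using Suc by (simp add: mult_left_mono)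
  finally show ?case by simp
qed simp

lemma summable_mat_exp:
  fixes A :: "'n::finite sqmat"
  shows "summable (\<lambda>k. mat_power A k /\<^sub>R fact k)"
proof (rule summable_comparison_test')
  show "summable (\<lambda>k. (norm A ^ k /\<^sub>R fact k) * norm (mat 1 :: 'n sqmat))"
    using summable_exp_generic[of "norm A"] by (intro summable_mult2) simp
  show "norm (mat_power A k /\<^sub>R fact k) \<le> (norm A ^ k /\<^sub>R fact k) * norm (mat 1 :: 'n sqmat)"
    if "0 \<le> k" for k
    using norm_mat_power_le[of A k] by (simp add: field_simps)
qed

lemma mat_exp_sums: "(\<lambda>k. mat_power A k /\<^sub>R fact k) sums mat_exp A"
  unfolding mat_exp_def using summable_mat_exp by (rule summable_sums)

lemma mat_power_eigenvector: "A *v v = l *\<^sub>R v \<Longrightarrow> mat_power A k *v v = l ^ k *\<^sub>R v"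
  by (induction k) (simp_all flip: matrix_vector_mul_assoc add: matrix_vector_mult_scaleR mult.commute)

lemma bounded_linear_matrix_vector_left: "bounded_linear (\<lambda>A. A *v v)" for v :: "real^'n"
  by (intro linear_conv_bounded_linear[THEN iffD1] linearI)
     (simp_all add: matrix_vector_mult_add_rdistrib scaleR_matrix_vector_assoc)

lemma mat_exp_eigenvector:
  assumes "A *v v = l *\<^sub>R v"
  shows "mat_exp A *v v = exp l *\<^sub>R v"
proof -
  have "(mat_power A k /\<^sub>R fact k) *v v = (l ^ k /\<^sub>R fact k) *\<^sub>R v" for k
    using mat_power_eigenvector[OF assms, of k]
    by (simp flip: scaleR_matrix_vector_assoc)
  then have "(\<lambda>k. (l ^ k /\<^sub>R fact k) *\<^sub>R v) sums (mat_exp A *v v)"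
    using bounded_linear.sums[OF bounded_linear_matrix_vector_left mat_exp_sums[of A], of v] by simp
  then show ?thesis
    by (rule sums_unique2) (rule bounded_linear.sums[OF bounded_linear_scaleR_left exp_converges])
qed

lemma mat_power_commute: "mat_power A k ** A = A ** mat_power A k"
  by (induction k) (simp_all flip: matrix_mul_assoc)

lemma transpose_mat_power: "transpose A = A \<Longrightarrow> transpose (mat_power A k) = mat_power A k"
  by (induction k) (simp_all add: matrix_transpose_mul mat_power_commute transpose_mat)

lemma transpose_mat_exp:
  assumes "transpose A = A" shows "transpose (mat_exp A) = mat_exp A"
proof -
  have bl: "bounded_linear (transpose :: 'a::finite sqmat \<Rightarrow> _)"
    by (intro linear_conv_bounded_linear[THEN iffD1] linearI) (simp_all add: transpose_def vec_eq_iff)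
  have "transpose (mat_power A k /\<^sub>R fact k) = mat_power A k /\<^sub>R fact k" for k
    using transpose_mat_power[OF assms, of k] by (simp add: transpose_def vec_eq_iff)
  then have "(\<lambda>k. mat_power A k /\<^sub>R fact k) sums transpose (mat_exp A)"
    using bounded_linear.sums[OF bl mat_exp_sums[of A]] by simp
  then show ?thesis by (rule sums_unique2) (rule mat_exp_sums)
qed

lemma mat_exp_spd:
  fixes A :: "'n::finite sqmat"
  assumes sym: "transpose A = A" shows "mat_exp A \<in> spd"
proof -
  obtain B where B: "finite B" "span B = UNIV" "pairwise orthogonal B" "\<And>b. b \<in> B \<Longrightarrow> norm b = 1"
    "\<And>b. b \<in> B \<Longrightarrow> \<exists>l. A *v b = l *\<^sub>R b" using spectral_theorem[OF sym] by blast
  then obtain l where l: "\<And>b. b \<in> B \<Longrightarrow> A *v b = l b *\<^sub>R b" by metis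
  have "v \<bullet> (mat_exp A *v v) > 0" if v: "v \<noteq> 0" for v
  proof -
    have "v \<bullet> (mat_exp A *v v) = v \<bullet> (mat_exp A *v (\<Sum>b\<in>B. (v \<bullet> b) *\<^sub>R b))"
      using orthonormal_expansion[OF B(1-4), of v] by simp
    also have "\<dots> = (\<Sum>b\<in>B. exp (l b) * (v \<bullet> b)\<^sup>2)"
      using mat_exp_eigenvector[OF l]
      by (simp add: linear_sum[OF matrix_vector_mul_linear] matrix_vector_mult_scaleR inner_sum_right
          power2_eq_square mult_ac)
    also have "\<dots> > 0"
    proof -
      have "\<exists>b\<in>B. v \<bullet> b \<noteq> 0"
      proof (rule ccontr)
        assume "\<not> ?thesis"
        then have "(\<Sum>b\<in>B. (v \<bullet> b) *\<^sub>R b) = 0" by simp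
        then show False using orthonormal_expansion[OF B(1-4), of v] v by simp
      qed
      then obtain b where "b \<in> B" "v \<bullet> b \<noteq> 0" by blast
      then show ?thesis by (intro sum_pos2[OF B(1), of b]) simp_all
    qed
    finally show ?thesis .
  qed
  then show ?thesis using transpose_mat_exp[OF sym] by (simp add: spd_def)
qed

text \<open>An eigenvector of \<open>C\<close> is an eigenvector of the common exponential, and the eigenspaces of
  \<open>mat_exp A\<close> are those of \<open>A\<close> because the scalar exponential is injective.\<close>

lemma mat_exp_inj_on_symmetric:
  fixes A C :: "'n::finite sqmat"
  assumes A: "transpose A = A" and C: "transpose C = C" and eq: "mat_exp A = mat_exp C"
  shows "A = C"
proof -
  obtain B where B: "finite B" "span B = UNIV" "pairwise orthogonal B" "\<And>b. b \<in> B \<Longrightarrow> norm b = 1"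
    "\<And>b. b \<in> B \<Longrightarrow> \<exists>l. A *v b = l *\<^sub>R b" using spectral_theorem[OF A] by blast
  then obtain l where l: "\<And>b. b \<in> B \<Longrightarrow> A *v b = l b *\<^sub>R b" by metis
  obtain D where D: "finite D" "span D = UNIV" "pairwise orthogonal D" "\<And>b. b \<in> D \<Longrightarrow> norm b = 1"
    "\<And>b. b \<in> D \<Longrightarrow> \<exists>l. C *v b = l *\<^sub>R b" using spectral_theorem[OF C] by blast
  have "A *v w = C *v w" if w: "w \<in> D" for w
  proof -
    obtain c where c: "C *v w = c *\<^sub>R w" using D(5)[OF w] by blast
    have key: "(w \<bullet> b) * l b = c * (w \<bullet> b)" if b: "b \<in> B" for b
    proof -
      have "exp c * (w \<bullet> b) = (mat_exp A *v w) \<bullet> b" using mat_exp_eigenvector[OF c] eq by simp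
      also have "\<dots> = w \<bullet> (mat_exp A *v b)"
        using symmetric_matrix_inner[OF transpose_mat_exp[OF A]] by metis
      also have "\<dots> = exp (l b) * (w \<bullet> b)" using mat_exp_eigenvector[OF l[OF b]] by simp
      finally show ?thesis by auto
    qed
    have "A *v w = (\<Sum>b\<in>B. ((w \<bullet> b) * l b) *\<^sub>R b)"
    proof -
      have "A *v w = A *v (\<Sum>b\<in>B. (w \<bullet> b) *\<^sub>R b)" using orthonormal_expansion[OF B(1-4), of w] by simp
      also have "\<dots> = (\<Sum>b\<in>B. ((w \<bullet> b) * l b) *\<^sub>R b)"
        using l by (simp add: linear_sum[OF matrix_vector_mul_linear] matrix_vector_mult_scaleR)
      finally show ?thesis .
    qed
    also have "\<dots> = c *\<^sub>R (\<Sum>b\<in>B. (w \<bullet> b) *\<^sub>R b)"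
      using key by (simp only: scaleR_sum_right scaleR_scaleR cong: sum.cong)
    also have "\<dots> = C *v w" using orthonormal_expansion[OF B(1-4), of w] c by simp
    finally show ?thesis .
  qed
  then show ?thesis by (rule matrix_eq_on_spanning_set[OF D(2)])
qed

lemma mat_exp_surj_on_spd:
  fixes X :: "'n::finite sqmat"
  assumes X: "X \<in> spd"
  shows "\<exists>L. transpose L = L \<and> mat_exp L = X"
proof -
  have sym: "transpose X = X" and pos: "\<And>v. v \<noteq> 0 \<Longrightarrow> v \<bullet> (X *v v) > 0" using X by (auto simp: spd_def)
  obtain B where B: "finite B" "span B = UNIV" "pairwise orthogonal B" "\<And>b. b \<in> B \<Longrightarrow> norm b = 1"
    "\<And>b. b \<in> B \<Longrightarrow> \<exists>l. X *v b = l *\<^sub>R b" using spectral_theorem[OF sym] by blast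
  then obtain x where x: "\<And>b. b \<in> B \<Longrightarrow> X *v b = x b *\<^sub>R b" by metis
  have xpos: "x b > 0" if b: "b \<in> B" for b
  proof -
    have "b \<noteq> 0" "b \<bullet> b = 1" using B(4)[OF b] by (auto simp: dot_square_norm)
    then show ?thesis using pos[of b] x[OF b] by simp
  qed
  define L :: "'n sqmat" where "L = (\<Sum>b\<in>B. ln (x b) *\<^sub>R outer_prod b b)"
  have symL: "transpose L = L"
    by (simp add: L_def transpose_def outer_prod_def vec_eq_iff mult.commute)
  have op: "outer_prod b b *v v = (b \<bullet> v) *\<^sub>R b" for b v :: "real^'n"
    by (simp add: outer_prod_def matrix_vector_mult_def vec_eq_iff inner_vec_def sum_distrib_left sum_distrib_right mult_ac)
  have Lv: "L *v v = (\<Sum>b\<in>B. (ln (x b) * (b \<bullet> v)) *\<^sub>R b)" for v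
    unfolding L_def
    by (subst linear_sum[OF bounded_linear.linear[OF bounded_linear_matrix_vector_left]])
       (simp add: op flip: scaleR_matrix_vector_assoc)
  have Lb: "L *v c = ln (x c) *\<^sub>R c" if c: "c \<in> B" for c
  proof -
    have "L *v c = (\<Sum>b\<in>{c}. (ln (x b) * (b \<bullet> c)) *\<^sub>R b)" unfolding Lv
      using B c by (intro sum.mono_neutral_right) (auto simp: pairwise_def orthogonal_def)
    then show ?thesis using B(4)[OF c] by (simp add: dot_square_norm)
  qed
  have "mat_exp L *v b = X *v b" if b: "b \<in> B" for b
    using mat_exp_eigenvector[OF Lb[OF b]] xpos[OF b] x[OF b] by simp
  then have "mat_exp L = X" by (rule matrix_eq_on_spanning_set[OF B(2)])
  with symL show ?thesis by blast
qed

lemma mat_log_mat_exp: "transpose L = L \<Longrightarrow> mat_log (mat_exp L) = L"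
  unfolding mat_log_def by (rule the_equality) (auto intro: mat_exp_inj_on_symmetric)

lemma transpose_mat_log: "X \<in> spd \<Longrightarrow> transpose (mat_log X) = mat_log X"
  using mat_exp_surj_on_spd[of X] mat_log_mat_exp[of _] by fastforce

lemma continuous_on_mat_exp: "continuous_on S (mat_exp :: 'n::finite sqmat \<Rightarrow> 'n sqmat)"
proof -
  have pow: "continuous_on T (\<lambda>A :: 'n sqmat. mat_power A k)" for T k
    by (induction k) (auto simp: matrix_matrix_mult_def intro!: continuous_intros)
  have ball: "continuous_on (cball 0 r) (mat_exp :: 'n sqmat \<Rightarrow> 'n sqmat)" for r
  proof -
    have "uniform_limit (cball 0 r) (\<lambda>k A :: 'n sqmat. \<Sum>i<k. mat_power A i /\<^sub>R fact i)
      (\<lambda>A. \<Sum>i. mat_power A i /\<^sub>R fact i) sequentially"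
    proof (rule Weierstrass_m_test)
      show "summable (\<lambda>k. (\<bar>r\<bar> ^ k /\<^sub>R fact k) * norm (mat 1 :: 'n sqmat))"
        using summable_exp_generic[of "\<bar>r\<bar>"] by (intro summable_mult2) simp
      fix k :: nat and A :: "'n sqmat" assume "A \<in> cball 0 r"
      then have "norm A \<le> \<bar>r\<bar>" by auto
      then have "norm A ^ k * norm (mat 1 :: 'n sqmat) \<le> \<bar>r\<bar> ^ k * norm (mat 1 :: 'n sqmat)"
        by (intro mult_right_mono power_mono) auto
      with norm_mat_power_le[of A k] have "norm (mat_power A k) \<le> \<bar>r\<bar> ^ k * norm (mat 1 :: 'n sqmat)"
        by linarith
      then show "norm (mat_power A k /\<^sub>R fact k) \<le> (\<bar>r\<bar> ^ k /\<^sub>R fact k) * norm (mat 1 :: 'n sqmat)"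
        by (simp add: field_simps)
    qed
    then show ?thesis unfolding mat_exp_def
      by (rule uniform_limit_theorem[rotated])
         (auto intro!: always_eventually continuous_on_sum continuous_on_scaleR continuous_on_const pow)
  qed
  have "isCont (mat_exp :: 'n sqmat \<Rightarrow> 'n sqmat) A" for A
  proof -
    have "continuous_on (ball 0 (norm A + 1)) (mat_exp :: 'n sqmat \<Rightarrow> 'n sqmat)"
      using ball[of "norm A + 1"] by (rule continuous_on_subset) auto
    then show ?thesis by (simp add: continuous_on_eq_continuous_at)
  qed
  then show ?thesis by (simp add: continuous_at_imp_continuous_on)
qed

text \<open>On each compact ball of symmetric matrices \<^const>\<open>mat_exp\<close> is a homeomorphism onto its image,
  so \<^const>\<open>mat_log\<close> is continuous on countably many compact sets that cover its domain; elsewhere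
  the definite description has no witness and its value is a constant.\<close>

lemma borel_measurable_mat_log [measurable]:
  "(mat_log :: 'n::finite sqmat \<Rightarrow> 'n sqmat) \<in> borel_measurable borel"
proof -
  define S :: "nat \<Rightarrow> 'n sqmat set" where "S k = {L. transpose L = L} \<inter> cball 0 (real k)" for k
  have "closed {L :: 'n sqmat. transpose L = L}"
    unfolding transpose_def by (intro closed_Collect_eq continuous_intros)
  then have cS: "compact (S k)" for k by (simp add: S_def closed_Int_compact)
  define E where "E k = mat_exp ` S k" for k
  have cE: "compact (E k)" for k
    unfolding E_def by (intro compact_continuous_image continuous_on_mat_exp cS)
  then have bE: "E k \<in> sets borel" for k by (simp add: borel_compact)
  define R where "R = - (\<Union>k. E k)"
  have bR: "R \<in> sets borel" unfolding R_def using bE by simp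
  have cont: "continuous_on (E k) mat_log" for k
    unfolding E_def
    by (rule continuous_on_inv[OF continuous_on_mat_exp cS]) (auto simp: S_def mat_log_mat_exp)
  have const: "mat_log X = (THE L. False)" if "X \<in> R" for X
  proof -
    have "\<not> (transpose L = L \<and> mat_exp L = X)" for L
    proof
      assume L: "transpose L = L \<and> mat_exp L = X"
      obtain k where "norm L \<le> real k" using real_arch_simple by blast
      then have "X \<in> E k" using L by (auto simp: E_def S_def)
      with that show False by (auto simp: R_def)
    qed
    then have "(\<lambda>L. transpose L = L \<and> mat_exp L = X) = (\<lambda>L. False)" by auto
    then show ?thesis by (simp add: mat_log_def)
  qed
  show ?thesis
  proof (rule measurable_piecewise_restrict[of "insert R (range E)"])
    show "countable (insert R (range E))" by simp
    show "space borel \<subseteq> \<Union> (insert R (range E))" by (auto simp: R_def)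
    fix W assume W: "W \<in> insert R (range E)"
    then show "W \<inter> space borel \<in> sets borel" using bE bR by auto
    show "mat_log \<in> borel_measurable (restrict_space borel W)"
    proof (cases "W = R")
      case True
      then show ?thesis using const by (subst measurable_cong[of _ _ "\<lambda>_. THE L. False"]) (auto simp: space_restrict_space)
    next
      case False
      then show ?thesis using W cont by (auto intro: borel_measurable_continuous_on_restrict)
    qed
  qed
qed

section \<open>The isometry of symmetric matrices with coordinate vectors\<close>

lemma svec_add: "svec (A + C) = svec A + svec C"
  and svec_scaleR: "svec (c *\<^sub>R A) = c *\<^sub>R svec A"
  by (simp_all add: svec_def vec_eq_iff Let_def algebra_simps)

lemma linear_svec: "linear svec"
  by (intro linearI) (simp_all add: svec_add svec_scaleR)

lemmas svec_diff = linear_diff[OF linear_svec]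
  and svec_sum = linear_sum[OF linear_svec]

text \<open>An off-diagonal entry occurs twice in the Frobenius norm and once, with weight \<open>sqrt 2\<close>, in
  the coordinate vector.\<close>
lemma norm_svec:
  fixes A :: "('n::{finite,linorder}) sqmat"
  assumes "transpose A = A"
  shows "norm (svec A) = norm A"
proof -
  have sym: "A $ i $ j = A $ j $ i" for i j
    using assms by (metis transpose_def vec_lambda_beta)
  have "(norm A)\<^sup>2 = (\<Sum>x\<in>UNIV. (A $ fst x $ snd x)\<^sup>2)"
    unfolding norm_matrix_power2
    by (simp add: sum.cartesian_product split_def flip: UNIV_Times_UNIV)
  also have "\<dots> = (\<Sum>u\<in>UNIV. \<Sum>x\<in>{x \<in> UNIV. Upair (fst x) (snd x) = u}. (A $ fst x $ snd x)\<^sup>2)"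
    by (rule sum.group[symmetric]) auto
  also have "\<dots> = (\<Sum>u\<in>UNIV. (svec A $ u)\<^sup>2)"
  proof (rule sum.cong[OF refl])
    fix u :: "'n uprod"
    obtain i j where u: "u = Upair i j" by (metis uprod_exhaust)
    define a where "a = min i j"
    define b where "b = max i j"
    have u': "u = Upair a b" and ab: "a \<le> b" by (auto simp: a_def b_def u min_def max_def)
    have fib: "{x \<in> UNIV. Upair (fst x) (snd x) = u} = {(a, b), (b, a)}"
      by (auto simp: u')
    have "Min {a, b} = a" "Max {a, b} = b" using ab by (auto simp: min_def max_def)
    then show "(\<Sum>x\<in>{x \<in> UNIV. Upair (fst x) (snd x) = u}. (A $ fst x $ snd x)\<^sup>2) = (svec A $ u)\<^sup>2"
      unfolding fib by (cases "a = b") (auto simp: svec_def u' power_mult_distrib sym[of b a])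
  qed
  also have "\<dots> = (norm (svec A))\<^sup>2"
    unfolding power2_norm_eq_inner by (simp add: inner_vec_def power2_eq_square)
  finally show ?thesis by simp
qed

lemma borel_measurable_svec [measurable]:
  "(svec :: ('n::{finite,linorder}) sqmat \<Rightarrow> _) \<in> borel_measurable borel"
  by (intro borel_measurable_continuous_onI linear_continuous_on linear_conv_bounded_linear[THEN iffD1] linear_svec)

lemma borel_measurable_log_vec [measurable]: "log_vec \<in> borel_measurable borel"
  unfolding log_vec_def[abs_def] by measurable

section \<open>Moments of Gaussian random variables\<close>

lemma entire_power_series_zero_coeff:
  fixes a :: "nat \<Rightarrow> real"
  assumes "\<And>x. (\<lambda>n. a n * x ^ n) sums 0"
  shows "a n = 0"
  using assms
proof (induction n arbitrary: a)
  case 0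
  then show ?case using powser_sums_zero_iff[of a 0] by blast
next
  case (Suc n)
  have sm: "summable (\<lambda>n. a n * x ^ n)" for x using Suc.prems sums_summable by blast
  have "(\<lambda>n. diffs a n * x ^ n) sums 0" for x
  proof -
    have "((\<lambda>x. \<Sum>n. a n * x ^ n) has_field_derivative (\<Sum>n. diffs a n * x ^ n)) (at x)"
      by (rule termdiffs_strong_converges_everywhere[OF sm])
    moreover have "(\<lambda>x. \<Sum>n. a n * x ^ n) = (\<lambda>x. 0)" using Suc.prems sums_unique by (metis (no_types))
    ultimately have "(\<Sum>n. diffs a n * x ^ n) = 0" using DERIV_unique DERIV_const by metis
    moreover have "summable (\<lambda>n. diffs a n * x ^ n)" by (rule termdiff_converges_all[OF sm])
    ultimately show ?thesis by (metis summable_sums)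
  qed
  from Suc.IH[OF this] show ?case by (simp add: diffs_def)
qed

text \<open>A centred normal distribution with variance \<open>v\<close>, expressed by the moment generating function so that
  the degenerate case \<open>v = 0\<close> is included.\<close>

definition (in prob_space) gaussian :: "('a \<Rightarrow> real) \<Rightarrow> real \<Rightarrow> bool" where
  "gaussian U v \<longleftrightarrow> random_variable borel U \<and> v \<ge> 0 \<and>
    (\<forall>t. (\<integral>\<^sup>+\<omega>. ennreal (exp (t * U \<omega>)) \<partial>M) = ennreal (exp (t\<^sup>2 * v / 2)))"

context prob_space
begin

lemma gaussian_measurable: "gaussian U v \<Longrightarrow> random_variable borel U"
  by (simp add: gaussian_def)

lemma gaussian_exp:
  "gaussian U v \<Longrightarrow> has_bochner_integral M (\<lambda>\<omega>. exp (t * U \<omega>)) (exp (t\<^sup>2 * v / 2))"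
  by (intro has_bochner_integral_nn_integral) (auto simp: gaussian_def)

lemma gaussian_cosh:
  assumes "gaussian U v"
  shows "(\<integral>\<^sup>+\<omega>. ennreal (cosh (t * U \<omega>)) \<partial>M) = ennreal (exp (t\<^sup>2 * v / 2))"
proof -
  have "has_bochner_integral M (\<lambda>\<omega>. (exp (t * U \<omega>) + exp ((- t) * U \<omega>)) / 2)
      ((exp (t\<^sup>2 * v / 2) + exp ((- t)\<^sup>2 * v / 2)) / 2)"
    by (intro has_bochner_integral_divide_zero has_bochner_integral_add gaussian_exp assms)
  then have "has_bochner_integral M (\<lambda>\<omega>. cosh (t * U \<omega>)) (exp (t\<^sup>2 * v / 2))"
    by (simp add: cosh_field_def)
  then show ?thesis
    by (subst nn_integral_eq_integral) (auto simp: has_bochner_integral_iff)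
qed

text \<open>Monotone convergence expands the expectation of \<open>cosh (t U)\<close> into an even power series in \<open>t\<close>
  with the moments as coefficients; it represents the entire function \<open>exp (t^2 v / 2)\<close>, whose
  coefficients are known.\<close>
lemma gaussian_nn_moment:
  assumes U: "gaussian U v"
  shows "(\<integral>\<^sup>+\<omega>. ennreal (U \<omega> ^ (2 * k)) \<partial>M) = ennreal (fact (2 * k) / (2 ^ k * fact k) * v ^ k)"
proof -
  have [measurable]: "random_variable borel U" using U by (rule gaussian_measurable)
  have v: "v \<ge> 0" using U by (simp add: gaussian_def)
  define c where "c k = (\<integral>\<^sup>+\<omega>. ennreal (U \<omega> ^ (2 * k)) \<partial>M)" for k
  have cosh_sum: "(\<lambda>k. (x ^ (2 * k)) / fact (2 * k)) sums cosh x" for x :: real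
  proof -
    have "(\<lambda>n. if even n then x ^ n /\<^sub>R fact n else 0) sums cosh x" by (rule cosh_converges)
    then have "(\<lambda>k. (\<lambda>n. if even n then x ^ n /\<^sub>R fact n else 0) (2 * k)) sums cosh x"
      by (subst sums_mono_reindex) (auto simp: strict_mono_def elim!: oddE evenE)
    then show ?thesis by (simp add: field_simps)
  qed
  have main: "(\<Sum>k. ennreal (t ^ (2 * k) / fact (2 * k)) * c k) = ennreal (exp (t\<^sup>2 * v / 2))" for t
  proof -
    have "ennreal (exp (t\<^sup>2 * v / 2)) = (\<integral>\<^sup>+\<omega>. ennreal (cosh (t * U \<omega>)) \<partial>M)"
      by (rule gaussian_cosh[OF U, symmetric])
    also have "\<dots> = (\<integral>\<^sup>+\<omega>. (\<Sum>k. ennreal (t ^ (2 * k) / fact (2 * k)) * ennreal (U \<omega> ^ (2 * k))) \<partial>M)"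
    proof (intro nn_integral_cong)
      fix \<omega>
      have "(\<lambda>k. t ^ (2 * k) / fact (2 * k) * U \<omega> ^ (2 * k)) sums cosh (t * U \<omega>)"
        using cosh_sum[of "t * U \<omega>"] by (simp add: power_mult_distrib mult_ac)
      then have s: "(\<Sum>k. ennreal (t ^ (2 * k) / fact (2 * k) * U \<omega> ^ (2 * k))) = ennreal (cosh (t * U \<omega>))"
        by (intro suminf_ennreal_eq) auto
      have e: "ennreal (t ^ (2 * k) / fact (2 * k) * U \<omega> ^ (2 * k))
          = ennreal (t ^ (2 * k) / fact (2 * k)) * ennreal (U \<omega> ^ (2 * k))" for k
        by (rule ennreal_mult) auto
      show "ennreal (cosh (t * U \<omega>)) = (\<Sum>k. ennreal (t ^ (2 * k) / fact (2 * k)) * ennreal (U \<omega> ^ (2 * k)))"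
        unfolding s[symmetric] e ..
    qed
    also have "\<dots> = (\<Sum>k. ennreal (t ^ (2 * k) / fact (2 * k)) * c k)"
      unfolding c_def by (subst nn_integral_suminf, measurable, subst nn_integral_cmult, measurable)
    finally show ?thesis by simp
  qed
  have cfin: "c k < \<infinity>" for k
  proof -
    have "(\<Sum>i\<in>{k}. ennreal (1 ^ (2 * i) / fact (2 * i)) * c i) \<le> (\<Sum>i. ennreal (1 ^ (2 * i) / fact (2 * i)) * c i)"
      by (intro sum_le_suminf) auto
    also have "\<dots> < \<infinity>" by (subst main) simp
    finally show ?thesis by (auto simp: ennreal_mult_less_top)
  qed
  define r where "r k = enn2real (c k)" for k
  have cr: "c k = ennreal (r k)" and r0: "r k \<ge> 0" for k using cfin[of k] by (auto simp: r_def)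
  define a where "a n = (if even n then r (n div 2) / fact n - (v / 2) ^ (n div 2) / fact (n div 2) else 0)" for n
  have "(\<lambda>n. a n * t ^ n) sums 0" for t
  proof -
    have "(\<lambda>k. t ^ (2 * k) / fact (2 * k) * r k) sums exp (t\<^sup>2 * v / 2)"
    proof -
      have "(\<lambda>k. ennreal (t ^ (2 * k) / fact (2 * k) * r k)) sums ennreal (exp (t\<^sup>2 * v / 2))"
        using main[of t] r0 ennreal_mult[of "t ^ (2 * _) / fact (2 * _)" "r _"]
        by (simp add: sums_iff cr del: times_divide_eq_left)
      then show ?thesis using r0 by (subst (asm) sums_ennreal) auto
    qed
    moreover have "(\<lambda>k. (t\<^sup>2 * v / 2) ^ k / fact k) sums exp (t\<^sup>2 * v / 2)"
      using exp_converges[of "t\<^sup>2 * v / 2"] by (simp add: field_simps)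
    ultimately have "(\<lambda>k. t ^ (2 * k) / fact (2 * k) * r k - (t\<^sup>2 * v / 2) ^ k / fact k) sums 0"
      using sums_diff by fastforce
    moreover have "t ^ (2 * k) / fact (2 * k) * r k - (t\<^sup>2 * v / 2) ^ k / fact k = a (2 * k) * t ^ (2 * k)" for k
    proof -
      have e: "t ^ (2 * k) = (t\<^sup>2) ^ k" by (rule power_mult)
      show ?thesis unfolding e by (simp add: a_def power_mult_distrib power_divide field_simps)
    qed
    ultimately have "(\<lambda>k. a (2 * k) * t ^ (2 * k)) sums 0" by simp
    then show ?thesis
      by (subst (asm) sums_mono_reindex[of "\<lambda>k. 2 * k" "\<lambda>n. a n * t ^ n"])
         (auto simp: strict_mono_def a_def elim!: oddE evenE)
  qed
  then have "a (2 * k) = 0" by (rule entire_power_series_zero_coeff)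
  then have "r k = fact (2 * k) / (2 ^ k * fact k) * v ^ k"
    by (simp add: a_def field_simps power_divide)
  then show ?thesis using cr[of k] by (simp add: c_def)
qed

lemma gaussian_moment:
  assumes U: "gaussian U v"
  shows "has_bochner_integral M (\<lambda>\<omega>. U \<omega> ^ (2 * k)) (fact (2 * k) / (2 ^ k * fact k) * v ^ k)"
  using gaussian_nn_moment[OF U, of k] gaussian_measurable[OF U] U
  by (intro has_bochner_integral_nn_integral) (auto simp: gaussian_def)

lemma gaussian_moments:
  assumes U: "gaussian U v"
  shows "has_bochner_integral M (\<lambda>\<omega>. (U \<omega>)\<^sup>2) v" "has_bochner_integral M (\<lambda>\<omega>. U \<omega> ^ 4) (3 * v\<^sup>2)"
    "has_bochner_integral M (\<lambda>\<omega>. U \<omega> ^ 8) (105 * v ^ 4)"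
proof -
  show "has_bochner_integral M (\<lambda>\<omega>. (U \<omega>)\<^sup>2) v"
    using gaussian_moment[OF U, of 1] by (simp add: fact_2)
  have "(fact 4 :: real) = 24" "(fact 8 :: real) = 40320" by (simp_all add: fact_numeral)
  then show "has_bochner_integral M (\<lambda>\<omega>. U \<omega> ^ 4) (3 * v\<^sup>2)" "has_bochner_integral M (\<lambda>\<omega>. U \<omega> ^ 8) (105 * v ^ 4)"
    using gaussian_moment[OF U, of 2] gaussian_moment[OF U, of 4] by (simp_all add: fact_2)
qed

lemma gaussian_integrable: assumes "gaussian U v" shows "integrable M U"
proof (rule square_integrable_imp_integrable)
  show "random_variable borel U" using assms by (rule gaussian_measurable)
  show "integrable M (\<lambda>\<omega>. (U \<omega>)\<^sup>2)"
    using gaussian_moments(1)[OF assms] by (simp add: has_bochner_integral_iff)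
qed

text \<open>The mean is squeezed by \<open>1 + x \<le> exp x\<close> as the parameter of the generating function tends to 0.\<close>

lemma gaussian_mean_zero:
  assumes U: "gaussian U v" shows "expectation U = 0"
proof -
  have int: "integrable M U" using U by (rule gaussian_integrable)
  have [measurable]: "random_variable borel U" using U by (rule gaussian_measurable)
  have le: "t * expectation U \<le> exp (t\<^sup>2 * v / 2) - 1" for t
  proof -
    note h = gaussian_exp[OF U, of t]
    have "expectation (\<lambda>\<omega>. 1 + t * U \<omega>) \<le> expectation (\<lambda>\<omega>. exp (t * U \<omega>))"
      using int h by (intro integral_mono) (auto simp: has_bochner_integral_iff)
    moreover have "expectation (\<lambda>\<omega>. 1 + t * U \<omega>) = 1 + t * expectation U"
      using int by (simp add: prob_space)
    ultimately show ?thesis using h by (simp add: has_bochner_integral_iff)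
  qed
  have lim: "((\<lambda>t. (exp (t\<^sup>2 * v / 2) - 1) / t) \<longlongrightarrow> 0) (at_right 0)"
    by real_asymp
  have ev: "eventually (\<lambda>t::real. t > 0) (at_right 0)" by (simp add: eventually_at_right_less)
  have "expectation U \<le> 0"
  proof (rule tendsto_lowerbound[OF lim])
    show "\<forall>\<^sub>F t in at_right 0. expectation U \<le> (exp (t\<^sup>2 * v / 2) - 1) / t"
      using ev by eventually_elim (use le in \<open>simp add: field_simps\<close>)
  qed simp
  moreover have "- expectation U \<le> 0"
  proof (rule tendsto_lowerbound[OF lim])
    show "\<forall>\<^sub>F t in at_right 0. - expectation U \<le> (exp (t\<^sup>2 * v / 2) - 1) / t"
      using ev by eventually_elim (use le[of "- _"] in \<open>simp add: field_simps\<close>)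
  qed simp
  ultimately show ?thesis by simp
qed

text \<open>The Paley--Zygmund inequality for \<open>exp (t U)\<close>, whose first two moments are known; the bound
  depends on \<open>t\<close> and \<open>v\<close> only through the product \<open>t^2 v\<close>.\<close>

lemma gaussian_upper_tail:
  assumes U: "gaussian U v"
  shows "exp (- (t\<^sup>2 * v)) / 4 \<le> prob {\<omega> \<in> space M. exp (t * U \<omega>) \<ge> exp (t\<^sup>2 * v / 2) / 2}"
proof -
  have [measurable]: "random_variable borel U" using U by (rule gaussian_measurable)
  note h = gaussian_exp[OF U]
  define E where "E = exp (t\<^sup>2 * v / 2)"
  have E: "E > 0" by (simp add: E_def)
  define A where "A = {\<omega> \<in> space M. exp (t * U \<omega>) \<ge> E / 2}"
  have A[measurable]: "A \<in> events" unfolding A_def by measurable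
  \<comment> \<open>The second moment of \<open>exp (t U)\<close> is \<open>E ^ 4\<close>, so this weight gives the second-moment term the share
    \<open>E / 4\<close>.\<close>
  define c where "c = 1 / (2 * E ^ 3)"
  have c: "c > 0" using E by (simp add: c_def)
  have pt: "exp (t * U \<omega>) \<le> E / 2 + c / 2 * (exp ((2 * t) * U \<omega>)) + indicator A \<omega> / (2 * c)"
    if "\<omega> \<in> space M" for \<omega>
  proof (cases "\<omega> \<in> A")
    case True
    define y where "y = exp (t * U \<omega>)"
    have "0 \<le> (c * y - 1)\<^sup>2" by simp
    then have "2 * c * y \<le> c\<^sup>2 * y\<^sup>2 + 1" by (simp add: power2_eq_square algebra_simps)
    then have "y \<le> c / 2 * y\<^sup>2 + 1 / (2 * c)" using c by (simp add: field_simps power2_eq_square)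
    moreover have "exp ((2 * t) * U \<omega>) = y\<^sup>2" by (simp add: y_def power2_eq_square flip: exp_add)
    ultimately show ?thesis using True E by (simp add: y_def)
  next
    case False
    then have "exp (t * U \<omega>) \<le> E / 2" using that by (simp add: A_def)
    then show ?thesis using c False by (simp add: add_increasing2)
  qed
  have iA: "integrable M (indicat_real A)"
    by (intro integrable_real_indicator A) (simp add: emeasure_eq_measure)
  have ie: "integrable M (\<lambda>\<omega>. exp (s * U \<omega>))" "expectation (\<lambda>\<omega>. exp (s * U \<omega>)) = exp (s\<^sup>2 * v / 2)" for s
    using h[of s] by (simp_all add: has_bochner_integral_iff)
  have "E = expectation (\<lambda>\<omega>. exp (t * U \<omega>))" using h[of t] by (simp add: has_bochner_integral_iff E_def)
  also have "\<dots> \<le> expectation (\<lambda>\<omega>. E / 2 + c / 2 * (exp ((2 * t) * U \<omega>)) + indicator A \<omega> / (2 * c))"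
    by (intro integral_mono Bochner_Integration.integrable_add integrable_mult_right integrable_divide iA ie pt)
       (simp_all add: finite_measure.integrable_const finite_measure_axioms)
  also have "\<dots> = E / 2 + c / 2 * E ^ 4 + prob A / (2 * c)"
  proof -
    have "expectation (\<lambda>\<omega>. E / 2 + c / 2 * (exp ((2 * t) * U \<omega>)) + indicator A \<omega> / (2 * c))
      = E / 2 + c / 2 * exp ((2 * t)\<^sup>2 * v / 2) + prob A / (2 * c)"
      using iA ie[of "2 * t"] by (simp add: prob_space)
    also have "exp ((2 * t)\<^sup>2 * v / 2) = E ^ 4"
      by (simp add: E_def power_mult_distrib flip: exp_of_nat_mult)
    finally show ?thesis .
  qed
  also have "c / 2 * E ^ 4 = E / 4" using E by (simp add: c_def power_numeral_reduce)
  finally have "E / 4 \<le> prob A / (2 * c)" by simp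
  then have "E / 4 * (2 * c) \<le> prob A" using c by (simp add: field_simps)
  also have "E / 4 * (2 * c) = 1 / (4 * E\<^sup>2)" using E by (simp add: c_def power_numeral_reduce)
  also have "1 / (4 * E\<^sup>2) = exp (- (t\<^sup>2 * v)) / 4"
    by (simp add: E_def exp_minus field_simps flip: exp_of_nat_mult)
  finally show ?thesis unfolding A_def E_def .
qed

text \<open>Completing the square turns the exponential of a linear functional times the density into a
  constant times a translate of the density, and the density has total mass one.\<close>

lemma gaussian_linear_functional:
  fixes Y :: "'a \<Rightarrow> real^'k" and S :: "'k sqmat"
  assumes D: "distributed M lborel Y (\<lambda>x. ennreal (mvn_density m S x))" and S: "S \<in> spd"
  shows "gaussian (\<lambda>\<omega>. u \<bullet> (Y \<omega> - m)) (u \<bullet> (S *v u))"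
proof -
  have sym: "transpose S = S" and pos: "\<And>v. v \<noteq> 0 \<Longrightarrow> v \<bullet> (S *v v) > 0" using S by (auto simp: spd_def)
  have [measurable]: "Y \<in> borel_measurable M" using D by (auto simp: distributed_def)
  have dens[measurable]: "(\<lambda>x. ennreal (mvn_density m S x)) \<in> borel_measurable borel"
    using D by (auto simp: distributed_def)
  define T where "T = matrix_inv S"
  have "\<forall>x. S *v x = 0 \<longrightarrow> x = 0" using pos by (metis inner_zero_right less_irrefl)
  then have "invertible S"
    by (simp add: invertible_left_inverse matrix_left_invertible_ker)
  then have ST: "S ** T = mat 1" and TS: "T ** S = mat 1"
    using someI_ex[of "\<lambda>T. S ** T = mat 1 \<and> T ** S = mat 1"]
    unfolding T_def matrix_inv_def invertible_def by blast+
  have STv: "S *v (T *v x) = x" and TSv: "T *v (S *v x) = x" for x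
    using ST TS by (simp_all add: matrix_vector_mul_assoc)
  have symT: "x \<bullet> (T *v y) = (T *v x) \<bullet> y" for x y
    using symmetric_matrix_inner[OF sym, of "T *v x" "T *v y"] by (simp add: STv)
  have shift: "mvn_density m S x * exp (w \<bullet> (x - m)) = exp (w \<bullet> (S *v w) / 2) * mvn_density m S (- (S *v w) + x)" for x w
  proof -
    define z where "z = x - m"
    define s where "s = S *v w"
    have "(z - s) \<bullet> (T *v (z - s)) = z \<bullet> (T *v z) - 2 * (w \<bullet> z) + w \<bullet> s"
      using symT[of s z]
      by (simp add: s_def matrix_vector_mult_diff_distrib inner_diff_left inner_diff_right TSv inner_commute)
    then have e: "exp (- (z \<bullet> (T *v z)) / 2) * exp (w \<bullet> z) = exp (w \<bullet> s / 2) * exp (- ((z - s) \<bullet> (T *v (z - s))) / 2)"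
      by (simp add: algebra_simps add_divide_distrib diff_divide_distrib flip: exp_add)
    have d: "- s + x - m = z - s" by (simp add: z_def)
    show ?thesis unfolding mvn_density_def T_def[symmetric] z_def[symmetric] s_def[symmetric] d
      by (simp only: times_divide_eq_left times_divide_eq_right e)
  qed
  have mass: "(\<integral>\<^sup>+x. ennreal (mvn_density m S x) \<partial>lborel) = 1"
    using distributed_nn_integral[OF D, of "\<lambda>_. 1"] by (simp add: emeasure_space_1)
  have mgf: "(\<integral>\<^sup>+\<omega>. ennreal (exp (w \<bullet> (Y \<omega> - m))) \<partial>M) = ennreal (exp (w \<bullet> (S *v w) / 2))" for w
  proof -
    have "(\<integral>\<^sup>+\<omega>. ennreal (exp (w \<bullet> (Y \<omega> - m))) \<partial>M)
      = (\<integral>\<^sup>+x. ennreal (mvn_density m S x) * ennreal (exp (w \<bullet> (x - m))) \<partial>lborel)"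
      by (rule distributed_nn_integral[OF D, symmetric]) measurable
    also have "\<dots> = (\<integral>\<^sup>+x. ennreal (exp (w \<bullet> (S *v w) / 2)) * ennreal (mvn_density m S (- (S *v w) + x)) \<partial>lborel)"
      using shift by (intro nn_integral_cong) (simp flip: ennreal_mult' ennreal_mult'')
    also have "\<dots> = ennreal (exp (w \<bullet> (S *v w) / 2)) * (\<integral>\<^sup>+x. ennreal (mvn_density m S (- (S *v w) + x)) \<partial>lborel)"
      by (intro nn_integral_cmult) measurable
    also have "(\<integral>\<^sup>+x. ennreal (mvn_density m S (- (S *v w) + x)) \<partial>lborel)
        = (\<integral>\<^sup>+x. ennreal (mvn_density m S x) \<partial>distr lborel borel ((+) (- (S *v w))))"
      by (rule nn_integral_distr[symmetric]) measurable
    also have "\<dots> = 1" by (simp add: lborel_distr_plus mass)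
    finally show ?thesis by simp
  qed
  have "u \<bullet> (S *v u) \<ge> 0" using pos[of u] by (cases "u = 0") auto
  moreover have "(\<integral>\<^sup>+\<omega>. ennreal (exp (t * (u \<bullet> (Y \<omega> - m)))) \<partial>M) = ennreal (exp (t\<^sup>2 * (u \<bullet> (S *v u)) / 2))" for t
    using mgf[of "t *\<^sub>R u"] by (simp add: matrix_vector_mult_scaleR power2_eq_square mult_ac)
  ultimately show ?thesis by (auto simp: gaussian_def)
qed

lemma gaussian_indep_sum:
  assumes ind: "indep_vars (\<lambda>_. borel) U J" and J: "finite J" and U: "\<And>j. j \<in> J \<Longrightarrow> gaussian (U j) (v j)"
  shows "gaussian (\<lambda>\<omega>. \<Sum>j\<in>J. U j \<omega>) (\<Sum>j\<in>J. v j)"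
proof -
  have [measurable]: "j \<in> J \<Longrightarrow> random_variable borel (U j)" for j using U gaussian_measurable by blast
  have "(\<integral>\<^sup>+\<omega>. ennreal (exp (t * (\<Sum>j\<in>J. U j \<omega>))) \<partial>M) = ennreal (exp (t\<^sup>2 * (\<Sum>j\<in>J. v j) / 2))" for t
  proof -
    have ind': "indep_vars (\<lambda>_. borel) (\<lambda>j \<omega>. ennreal (exp (t * U j \<omega>))) J"
      by (rule indep_vars_compose2[OF ind, where Y = "\<lambda>j x. ennreal (exp (t * x))"]) measurable
    have "(\<integral>\<^sup>+\<omega>. ennreal (exp (t * (\<Sum>j\<in>J. U j \<omega>))) \<partial>M) = (\<integral>\<^sup>+\<omega>. (\<Prod>j\<in>J. ennreal (exp (t * U j \<omega>))) \<partial>M)"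
      using J by (simp add: sum_distrib_left exp_sum prod_ennreal)
    also have "\<dots> = (\<Prod>j\<in>J. \<integral>\<^sup>+\<omega>. ennreal (exp (t * U j \<omega>)) \<partial>M)"
      by (rule indep_vars_nn_integral[OF J ind']) simp
    also have "\<dots> = (\<Prod>j\<in>J. ennreal (exp (t\<^sup>2 * v j / 2)))"
      using U by (intro prod.cong) (auto simp: gaussian_def)
    also have "\<dots> = ennreal (exp (t\<^sup>2 * (\<Sum>j\<in>J. v j) / 2))"
      using J by (simp add: prod_ennreal exp_sum[symmetric] sum_distrib_left sum_divide_distrib)
    finally show ?thesis .
  qed
  moreover have "(\<Sum>j\<in>J. v j) \<ge> 0" using U by (intro sum_nonneg) (auto simp: gaussian_def)
  ultimately show ?thesis by (auto simp: gaussian_def)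
qed

end

section \<open>Gaussian spaces\<close>

locale gaussian_space = prob_space +
  fixes G :: "('a \<Rightarrow> real) set"
  assumes gaussian_mem: "U \<in> G \<Longrightarrow> \<exists>v. gaussian U v"
    and lincomb_mem: "U \<in> G \<Longrightarrow> V \<in> G \<Longrightarrow> (\<lambda>\<omega>. a * U \<omega> + b * V \<omega>) \<in> G"
begin

abbreviation cov :: "('a \<Rightarrow> real) \<Rightarrow> ('a \<Rightarrow> real) \<Rightarrow> real" where
  "cov U V \<equiv> expectation (\<lambda>\<omega>. U \<omega> * V \<omega>)"

lemma meas_mem: "U \<in> G \<Longrightarrow> random_variable borel U"
  using gaussian_mem gaussian_measurable by blast

lemma add_mem: "U \<in> G \<Longrightarrow> V \<in> G \<Longrightarrow> (\<lambda>\<omega>. U \<omega> + V \<omega>) \<in> G"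
  using lincomb_mem[of U V 1 1] by simp

lemma diff_mem: "U \<in> G \<Longrightarrow> V \<in> G \<Longrightarrow> (\<lambda>\<omega>. U \<omega> - V \<omega>) \<in> G"
  using lincomb_mem[of U V 1 "-1"] by simp

lemma pow2_mem: "U \<in> G \<Longrightarrow> integrable M (\<lambda>\<omega>. (U \<omega>)\<^sup>2)"
  and pow4_mem: "U \<in> G \<Longrightarrow> integrable M (\<lambda>\<omega>. U \<omega> ^ 4)"
  and pow8_mem: "U \<in> G \<Longrightarrow> integrable M (\<lambda>\<omega>. U \<omega> ^ 8)"
  using gaussian_mem gaussian_moments by (meson has_bochner_integral_iff)+

lemma expectation_pow4: "U \<in> G \<Longrightarrow> expectation (\<lambda>\<omega>. U \<omega> ^ 4) = 3 * (cov U U)\<^sup>2"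
  and expectation_pow8: "U \<in> G \<Longrightarrow> expectation (\<lambda>\<omega>. U \<omega> ^ 8) = 105 * (cov U U) ^ 4"
  using gaussian_mem[of U] gaussian_moments[of U]
  by (auto simp: has_bochner_integral_iff power2_eq_square[of "U _"])

lemma integrable_prod2:
  assumes "U \<in> G" "V \<in> G" shows "integrable M (\<lambda>\<omega>. U \<omega> * V \<omega>)"
proof (rule Bochner_Integration.integrable_bound)
  show "integrable M (\<lambda>\<omega>. (U \<omega>)\<^sup>2 + (V \<omega>)\<^sup>2)" using assms pow2_mem by auto
  show "(\<lambda>\<omega>. U \<omega> * V \<omega>) \<in> borel_measurable M" using assms meas_mem by auto
  have "\<bar>x * y\<bar> \<le> x\<^sup>2 + y\<^sup>2" for x y :: real
  proof -
    have "0 \<le> (\<bar>x\<bar> - \<bar>y\<bar>)\<^sup>2" by simp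
    then have "2 * \<bar>x * y\<bar> \<le> x\<^sup>2 + y\<^sup>2" by (simp add: power2_diff abs_mult)
    then show ?thesis by simp
  qed
  then show "AE \<omega> in M. norm (U \<omega> * V \<omega>) \<le> norm ((U \<omega>)\<^sup>2 + (V \<omega>)\<^sup>2)" by simp
qed

lemma integrable_prod4:
  assumes "U \<in> G" "V \<in> G" "X \<in> G" "Y \<in> G" shows "integrable M (\<lambda>\<omega>. U \<omega> * V \<omega> * (X \<omega> * Y \<omega>))"
proof (rule Bochner_Integration.integrable_bound)
  show "integrable M (\<lambda>\<omega>. U \<omega> ^ 4 + V \<omega> ^ 4 + (X \<omega> ^ 4 + Y \<omega> ^ 4))" using assms pow4_mem by auto
  show "(\<lambda>\<omega>. U \<omega> * V \<omega> * (X \<omega> * Y \<omega>)) \<in> borel_measurable M" using assms meas_mem by auto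
  have am: "\<bar>x * y\<bar> \<le> (x\<^sup>2 + y\<^sup>2) / 2" for x y :: real
  proof -
    have "0 \<le> (\<bar>x\<bar> - \<bar>y\<bar>)\<^sup>2" by simp
    then show ?thesis by (simp add: power2_diff abs_mult)
  qed
  have "\<bar>u * v * (x * y)\<bar> \<le> u ^ 4 + v ^ 4 + (x ^ 4 + y ^ 4)" for u v x y :: real
  proof -
    define N where "N = u ^ 4 + v ^ 4 + (x ^ 4 + y ^ 4)"
    have "(u * v)\<^sup>2 \<le> (u ^ 4 + v ^ 4) / 2" "(x * y)\<^sup>2 \<le> (x ^ 4 + y ^ 4) / 2"
      using am[of "u\<^sup>2" "v\<^sup>2"] am[of "x\<^sup>2" "y\<^sup>2"] by (simp_all add: power_mult_distrib)
    then have "\<bar>u * v * (x * y)\<bar> \<le> N / 4"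
      using am[of "u * v" "x * y"] unfolding N_def by argo
    also have "\<dots> \<le> N" by (simp add: N_def)
    finally show ?thesis by (simp add: N_def)
  qed
  then show "AE \<omega> in M. norm (U \<omega> * V \<omega> * (X \<omega> * Y \<omega>)) \<le> norm (U \<omega> ^ 4 + V \<omega> ^ 4 + (X \<omega> ^ 4 + Y \<omega> ^ 4))"
    by simp
qed

lemma cov_commute: "cov U V = cov V U"
  by (simp add: mult.commute)

lemma cov_add:
  assumes "U \<in> G" "V \<in> G" "X \<in> G"
  shows "cov (\<lambda>\<omega>. U \<omega> + V \<omega>) X = cov U X + cov V X" "cov X (\<lambda>\<omega>. U \<omega> + V \<omega>) = cov X U + cov X V"
    "cov (\<lambda>\<omega>. U \<omega> - V \<omega>) X = cov U X - cov V X" "cov X (\<lambda>\<omega>. U \<omega> - V \<omega>) = cov X U - cov X V"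
  using assms integrable_prod2 by (simp_all add: algebra_simps)

text \<open>In the sum of the fourth powers of \<open>U + V\<close> and \<open>U - V\<close> the odd mixed terms cancel, and the fourth
  moment of each member of the space is three times its squared variance.\<close>
lemma expectation_sq_sq:
  assumes U: "U \<in> G" and V: "V \<in> G"
  shows "expectation (\<lambda>\<omega>. U \<omega> * U \<omega> * (V \<omega> * V \<omega>)) = cov U U * cov V V + 2 * (cov U V)\<^sup>2"
proof -
  have p: "(\<lambda>\<omega>. U \<omega> + V \<omega>) \<in> G" and m: "(\<lambda>\<omega>. U \<omega> - V \<omega>) \<in> G" using U V add_mem diff_mem by auto
  have "12 * expectation (\<lambda>\<omega>. U \<omega> * U \<omega> * (V \<omega> * V \<omega>))
    = expectation (\<lambda>\<omega>. 12 * (U \<omega> * U \<omega> * (V \<omega> * V \<omega>)))" by simp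
  also have "\<dots> = expectation (\<lambda>\<omega>. (U \<omega> + V \<omega>) ^ 4 + (U \<omega> - V \<omega>) ^ 4 - 2 * U \<omega> ^ 4 - 2 * V \<omega> ^ 4)"
    by (intro Bochner_Integration.integral_cong refl) (simp add: power4_eq_xxxx algebra_simps)
  also have "\<dots> = expectation (\<lambda>\<omega>. (U \<omega> + V \<omega>) ^ 4) + expectation (\<lambda>\<omega>. (U \<omega> - V \<omega>) ^ 4)
      - 2 * expectation (\<lambda>\<omega>. U \<omega> ^ 4) - 2 * expectation (\<lambda>\<omega>. V \<omega> ^ 4)"
    using pow4_mem[OF p] pow4_mem[OF m] pow4_mem[OF U] pow4_mem[OF V] by simp
  also have "\<dots> = 3 * (cov U U + 2 * cov U V + cov V V)\<^sup>2 + 3 * (cov U U - 2 * cov U V + cov V V)\<^sup>2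
      - 6 * (cov U U)\<^sup>2 - 6 * (cov V V)\<^sup>2"
  proof -
    have "cov (\<lambda>\<omega>. U \<omega> + V \<omega>) (\<lambda>\<omega>. U \<omega> + V \<omega>) = cov U U + 2 * cov U V + cov V V"
      "cov (\<lambda>\<omega>. U \<omega> - V \<omega>) (\<lambda>\<omega>. U \<omega> - V \<omega>) = cov U U - 2 * cov U V + cov V V"
      by (simp_all only: cov_add U V p m cov_commute[of V U])
    then show ?thesis
      using expectation_pow4[OF p] expectation_pow4[OF m] expectation_pow4[OF U] expectation_pow4[OF V]
      by (simp only:)
  qed
  also have "\<dots> = 12 * (cov U U * cov V V + 2 * (cov U V)\<^sup>2)"
    by (simp add: power2_eq_square algebra_simps)
  finally show ?thesis by simp
qed

text \<open>Polarization of the previous identity in each of its two squares.\<close>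

lemma isserlis:
  assumes G: "U \<in> G" "V \<in> G" "X \<in> G" "Y \<in> G"
  shows "expectation (\<lambda>\<omega>. U \<omega> * V \<omega> * (X \<omega> * Y \<omega>))
    = cov U V * cov X Y + cov U X * cov V Y + cov U Y * cov V X"
proof -
  note mem = add_mem diff_mem G
  define A where "A = (\<lambda>\<omega>. U \<omega> + V \<omega>)"
  define B where "B = (\<lambda>\<omega>. U \<omega> - V \<omega>)"
  define C where "C = (\<lambda>\<omega>. X \<omega> + Y \<omega>)"
  define D where "D = (\<lambda>\<omega>. X \<omega> - Y \<omega>)"
  have ABCD: "A \<in> G" "B \<in> G" "C \<in> G" "D \<in> G" unfolding A_def B_def C_def D_def by (intro mem)+
  define F where "F P Q = expectation (\<lambda>\<omega>. P \<omega> * P \<omega> * (Q \<omega> * Q \<omega>))" for P Q :: "'a \<Rightarrow> real"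
  have "16 * expectation (\<lambda>\<omega>. U \<omega> * V \<omega> * (X \<omega> * Y \<omega>)) = expectation (\<lambda>\<omega>. 16 * (U \<omega> * V \<omega> * (X \<omega> * Y \<omega>)))"
    by simp
  also have "\<dots> = expectation (\<lambda>\<omega>. A \<omega> * A \<omega> * (C \<omega> * C \<omega>) - B \<omega> * B \<omega> * (C \<omega> * C \<omega>)
      - A \<omega> * A \<omega> * (D \<omega> * D \<omega>) + B \<omega> * B \<omega> * (D \<omega> * D \<omega>))"
    by (intro Bochner_Integration.integral_cong refl) (simp add: A_def B_def C_def D_def algebra_simps)
  also have "\<dots> = F A C - F B C - F A D + F B D"
    using integrable_prod4 ABCD by (simp add: F_def)
  also have "\<dots> = (cov A A * cov C C + 2 * (cov A C)\<^sup>2) - (cov B B * cov C C + 2 * (cov B C)\<^sup>2)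
      - (cov A A * cov D D + 2 * (cov A D)\<^sup>2) + (cov B B * cov D D + 2 * (cov B D)\<^sup>2)"
    unfolding F_def by (simp only: expectation_sq_sq ABCD)
  also have "\<dots> = 16 * (cov U V * cov X Y + cov U X * cov V Y + cov U Y * cov V X)"
  proof -
    have AA: "cov A A = cov U U + 2 * cov U V + cov V V" and BB: "cov B B = cov U U - 2 * cov U V + cov V V"
      and CC: "cov C C = cov X X + 2 * cov X Y + cov Y Y" and DD: "cov D D = cov X X - 2 * cov X Y + cov Y Y"
      and AC: "cov A C = cov U X + cov U Y + cov V X + cov V Y"
      and BC: "cov B C = cov U X + cov U Y - cov V X - cov V Y"
      and AD: "cov A D = cov U X - cov U Y + cov V X - cov V Y"
      and BD: "cov B D = cov U X - cov U Y - cov V X + cov V Y"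
      unfolding A_def B_def C_def D_def
      by (simp_all only: cov_add mem cov_commute[of V U] cov_commute[of Y X])
    show ?thesis unfolding AA BB CC DD AC BC AD BD by algebra
  qed
  finally show ?thesis by simp
qed

end

section \<open>Mean and scatter matrix of one Gaussian sample\<close>

definition smean :: "nat \<Rightarrow> (nat \<Rightarrow> 'v::real_vector) \<Rightarrow> 'v" where
  "smean n z = (\<Sum>j=1..n. z j) /\<^sub>R real n"

definition scat :: "nat \<Rightarrow> (nat \<Rightarrow> real^'k) \<Rightarrow> ('k::finite) sqmat" where
  "scat n z = (\<Sum>j=1..n. outer_prod (z j - smean n z) (z j - smean n z))"

definition sumsq :: "nat \<Rightarrow> (nat \<Rightarrow> 'v::real_normed_vector) \<Rightarrow> real" where
  "sumsq n z = (\<Sum>j=1..n. (norm (z j))\<^sup>2)"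

lemma scat_nth: "scat n z $ a $ b = (\<Sum>j=1..n. (z j - smean n z) $ a * (z j - smean n z) $ b)"
  by (simp add: scat_def outer_prod_def)

lemma transpose_scat: "transpose (scat n z) = scat n z"
  by (simp add: transpose_def vec_eq_iff scat_nth mult.commute)

lemma trace_scat: "trace (scat n z) = (\<Sum>j=1..n. (norm (z j - smean n z))\<^sup>2)"
proof -
  have "trace (scat n z) = (\<Sum>a\<in>UNIV. \<Sum>j=1..n. (z j - smean n z) $ a * (z j - smean n z) $ a)"
    by (simp add: trace_def scat_nth)
  also have "\<dots> = (\<Sum>j=1..n. (z j - smean n z) \<bullet> (z j - smean n z))"
    by (subst sum.swap) (simp add: inner_vec_def)
  finally show ?thesis by (simp add: power2_norm_eq_inner)
qed

lemma trace_scat_nonneg: "trace (scat n z) \<ge> 0"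
  by (simp add: trace_scat sum_nonneg)

lemma sumsq_decomposition:
  assumes "n \<ge> 1"
  shows "sumsq n z = trace (scat n z) + real n * (norm (smean n z))\<^sup>2"
proof -
  define c where "c = smean n z"
  have c: "(\<Sum>j=1..n. z j) = real n *\<^sub>R c" using assms by (simp add: c_def smean_def)
  have "trace (scat n z) = (\<Sum>j=1..n. z j \<bullet> z j - 2 * (z j \<bullet> c) + c \<bullet> c)"
    unfolding trace_scat c_def[symmetric] power2_norm_eq_inner
    by (intro sum.cong refl) (simp add: inner_diff_left inner_diff_right inner_commute)
  also have "\<dots> = (\<Sum>j=1..n. z j \<bullet> z j) - 2 * ((\<Sum>j=1..n. z j) \<bullet> c) + real n * (c \<bullet> c)"
    by (simp add: sum.distrib sum_subtractf inner_sum_left sum_distrib_left)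
  also have "\<dots> = (\<Sum>j=1..n. z j \<bullet> z j) - real n * (c \<bullet> c)" unfolding c by simp
  finally show ?thesis unfolding sumsq_def c_def[symmetric] power2_norm_eq_inner by simp
qed

lemma trace_scat_le: "n \<ge> 1 \<Longrightarrow> trace (scat n z) \<le> sumsq n z"
  by (simp add: sumsq_decomposition)

lemma norm_smean_le: "n \<ge> 1 \<Longrightarrow> (norm (smean n z))\<^sup>2 \<le> sumsq n z" for z :: "nat \<Rightarrow> real^'k"
proof -
  assume n: "n \<ge> 1"
  have "(norm (smean n z))\<^sup>2 \<le> real n * (norm (smean n z))\<^sup>2" using n by (simp add: mult_le_cancel_right1)
  then show ?thesis using sumsq_decomposition[OF n, of z] trace_scat_nonneg[of n z] by linarith
qed

lemma sumsq_nonneg: "sumsq n z \<ge> 0"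
  by (simp add: sumsq_def sum_nonneg)

lemma norm_outer_prod: "norm (outer_prod v v) = (norm v)\<^sup>2"
proof -
  have "(norm (outer_prod v v))\<^sup>2 = ((norm v)\<^sup>2)\<^sup>2"
    unfolding norm_matrix_power2 power2_norm_eq_inner[of v]
    by (simp add: outer_prod_def inner_vec_def power2_eq_square sum_product mult_ac)
  then show ?thesis by (rule power2_eq_imp_eq) simp_all
qed

lemma norm_scat_le_trace: "norm (scat n z) \<le> trace (scat n z)"
proof -
  have "norm (scat n z) \<le> (\<Sum>j=1..n. norm (outer_prod (z j - smean n z) (z j - smean n z)))"
    unfolding scat_def by (rule norm_sum)
  then show ?thesis by (simp add: norm_outer_prod trace_scat)
qed

lemma norm_scat_le: "n \<ge> 1 \<Longrightarrow> norm (scat n z) \<le> sumsq n z"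
  using norm_scat_le_trace trace_scat_le order_trans by blast

lemma inner_matrix: "(A :: real^'n^'m) \<bullet> B = (\<Sum>i\<in>UNIV. \<Sum>j\<in>UNIV. A $ i $ j * B $ i $ j)"
  by (simp add: inner_vec_def)

lemma trace_mult_symmetric: "transpose B = B \<Longrightarrow> trace (A ** B) = A \<bullet> B" for A B :: "real^'n^'n"
  unfolding inner_matrix trace_def matrix_matrix_mult_def
  by (simp add: transpose_def vec_eq_iff)

lemma trace_scat_sq: "trace (scat n z ** scat n z) = (norm (scat n z))\<^sup>2"
  by (simp add: trace_mult_symmetric transpose_scat power2_norm_eq_inner)

lemma sum_pow4_le:
  fixes x :: "'i \<Rightarrow> real"
  shows "(\<Sum>i\<in>I. x i) ^ 4 \<le> real (card I) ^ 3 * (\<Sum>i\<in>I. x i ^ 4)"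
proof -
  have cs: "(\<Sum>i\<in>I. y i)\<^sup>2 \<le> real (card I) * (\<Sum>i\<in>I. (y i)\<^sup>2)" for y :: "'i \<Rightarrow> real"
    using Cauchy_Schwarz_ineq_sum[of "\<lambda>_. 1" y I] by simp
  have "(\<Sum>i\<in>I. x i) ^ 4 = ((\<Sum>i\<in>I. x i)\<^sup>2)\<^sup>2" by simp
  also have "\<dots> \<le> (real (card I) * (\<Sum>i\<in>I. (x i)\<^sup>2))\<^sup>2" by (intro power_mono cs) simp
  also have "\<dots> = (real (card I))\<^sup>2 * (\<Sum>i\<in>I. (x i)\<^sup>2)\<^sup>2" by (simp add: power_mult_distrib)
  also have "\<dots> \<le> (real (card I))\<^sup>2 * (real (card I) * (\<Sum>i\<in>I. ((x i)\<^sup>2)\<^sup>2))"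
    by (intro mult_left_mono cs) simp
  finally show ?thesis by (simp add: power3_eq_cube power2_eq_square[of "real (card I)"] mult_ac)
qed

text \<open>Entries of the centring matrix, the orthogonal projection with rank \<open>n - 1\<close> that maps a
  sample to its deviations from the mean.\<close>

definition centring :: "nat \<Rightarrow> nat \<Rightarrow> nat \<Rightarrow> real" where
  "centring n j k = (if j = k then 1 else 0) - 1 / real n"

lemma centring_idempotent:
  assumes "j \<in> {1..n}" "k \<in> {1..n}"
  shows "(\<Sum>l=1..n. centring n j l * centring n k l) = centring n j k"
proof -
  have n: "n \<noteq> 0" using assms by auto
  have "(\<Sum>l=1..n. centring n j l * centring n k l)
    = (\<Sum>l=1..n. (if j = l then (if k = l then 1 else 0) else 0) - (if j = l then 1 / real n else 0)
        - (if k = l then 1 / real n else 0) + 1 / (real n * real n))"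
    by (intro sum.cong refl) (simp add: centring_def algebra_simps)
  also have "\<dots> = centring n j k"
    using assms n by (simp add: sum.distrib sum_subtractf centring_def)
  finally show ?thesis .
qed

lemma centring_traces:
  assumes "n \<ge> 1"
  shows "(\<Sum>j=1..n. centring n j j) = real n - 1"
    and "(\<Sum>j=1..n. \<Sum>k=1..n. (centring n j k)\<^sup>2) = real n - 1"
proof -
  show a: "(\<Sum>j=1..n. centring n j j) = real n - 1"
    using assms by (simp add: centring_def field_simps)
  have "(\<Sum>j=1..n. \<Sum>k=1..n. (centring n j k)\<^sup>2) = (\<Sum>j=1..n. centring n j j)"
    by (intro sum.cong refl) (simp only: power2_eq_square centring_idempotent)
  with a show "(\<Sum>j=1..n. \<Sum>k=1..n. (centring n j k)\<^sup>2) = real n - 1" by simp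
qed

text \<open>One sample of size \<open>n\<close>, centred at the population mean: every linear functional of an
  observation is Gaussian with variance given by \<open>Sg\<close>.\<close>
locale gaussian_sample = prob_space M for M :: "'a measure" +
  fixes n :: nat and Sg :: "'k::finite sqmat" and Z :: "nat \<Rightarrow> 'a \<Rightarrow> real^'k"
  assumes n3: "n \<ge> 3"
    and Sg: "Sg \<in> spd"
    and indep: "indep_vars (\<lambda>_. borel) Z {1..n}"
    and gaussian_Z: "j \<in> {1..n} \<Longrightarrow> gaussian (\<lambda>\<omega>. u \<bullet> Z j \<omega>) (u \<bullet> (Sg *v u))"
begin

definition lin :: "(nat \<Rightarrow> real^'k) \<Rightarrow> 'a \<Rightarrow> real" where
  "lin w = (\<lambda>\<omega>. \<Sum>j=1..n. w j \<bullet> Z j \<omega>)"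

lemma sym: "transpose Sg = Sg" and pos: "v \<noteq> 0 \<Longrightarrow> v \<bullet> (Sg *v v) > 0"
  using Sg by (auto simp: spd_def)

lemma Sg_commute: "Sg $ a $ b = Sg $ b $ a"
  using sym by (metis transpose_def vec_lambda_beta)

lemma gaussian_lin: "gaussian (lin w) (\<Sum>j=1..n. w j \<bullet> (Sg *v w j))"
  unfolding lin_def
proof (rule gaussian_indep_sum)
  show "indep_vars (\<lambda>_. borel) (\<lambda>j \<omega>. w j \<bullet> Z j \<omega>) {1..n}"
    by (rule indep_vars_compose2[OF indep, where Y = "\<lambda>j x. w j \<bullet> x"]) measurable
qed (auto intro: gaussian_Z)

lemma lin_lincomb: "(\<lambda>\<omega>. a * lin w \<omega> + b * lin w' \<omega>) = lin (\<lambda>j. a *\<^sub>R w j + b *\<^sub>R w' j)"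
  by (simp add: lin_def inner_add_left sum.distrib sum_distrib_left)

sublocale gaussian_space M "range lin"
proof
  show "\<exists>v. gaussian U v" if "U \<in> range lin" for U using that gaussian_lin by blast
  show "(\<lambda>\<omega>. a * U \<omega> + b * V \<omega>) \<in> range lin" if "U \<in> range lin" "V \<in> range lin" for U V a b
    using that lin_lincomb by blast
qed

lemma cov_lin: "cov (lin w) (lin w') = (\<Sum>j=1..n. w j \<bullet> (Sg *v w' j))"
proof -
  have q: "cov (lin w) (lin w) = (\<Sum>j=1..n. w j \<bullet> (Sg *v w j))" for w
    using gaussian_moments(1)[OF gaussian_lin[of w]]
    by (simp add: has_bochner_integral_iff power2_eq_square)
  have "cov (lin w) (lin w) + 2 * cov (lin w) (lin w') + cov (lin w') (lin w')
      = cov (\<lambda>\<omega>. lin w \<omega> + lin w' \<omega>) (\<lambda>\<omega>. lin w \<omega> + lin w' \<omega>)"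
    by (simp only: cov_add add_mem rangeI cov_commute[of "lin w'" "lin w"])
  also have "(\<lambda>\<omega>. lin w \<omega> + lin w' \<omega>) = lin (\<lambda>j. w j + w' j)"
    using lin_lincomb[of 1 w 1 w'] by simp
  also have "cov (lin (\<lambda>j. w j + w' j)) (lin (\<lambda>j. w j + w' j))
      = (\<Sum>j=1..n. w j \<bullet> (Sg *v w j)) + 2 * (\<Sum>j=1..n. w j \<bullet> (Sg *v w' j)) + (\<Sum>j=1..n. w' j \<bullet> (Sg *v w' j))"
    unfolding q using symmetric_matrix_inner[OF sym]
    by (simp add: matrix_vector_right_distrib inner_add_left inner_add_right sum.distrib inner_commute
        sum_distrib_left)
  finally show ?thesis by (simp add: q)
qed

lemma measurable_Z [measurable]: "j \<in> {1..n} \<Longrightarrow> random_variable borel (Z j)"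
  using indep by (auto simp: indep_vars_def)

abbreviation "zbar \<omega> \<equiv> smean n (\<lambda>j. Z j \<omega>)"
abbreviation "S \<omega> \<equiv> scat n (\<lambda>j. Z j \<omega>)"
abbreviation "T \<omega> \<equiv> sumsq n (\<lambda>j. Z j \<omega>)"
abbreviation "dof \<equiv> real n - 1"

lemma measurable_stats [measurable]:
  "random_variable borel zbar" "random_variable borel S" "random_variable borel T"
proof -
  show zb [measurable]: "random_variable borel zbar" unfolding smean_def by measurable
  have op: "(\<lambda>x :: real^'k. outer_prod x x) \<in> borel_measurable borel"
    unfolding outer_prod_def by (intro borel_measurable_continuous_onI continuous_intros)
  show "random_variable borel S" unfolding scat_def
    by (intro borel_measurable_sum measurable_compose[OF _ op]) measurable
  show "random_variable borel T" unfolding sumsq_def by measurable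
qed

lemma axis_Sg: "axis a 1 \<bullet> (Sg *v axis b 1) = Sg $ a $ b"
  by (simp add: matrix_vector_mult_basis inner_axis' column_def)

definition dev :: "nat \<Rightarrow> 'k \<Rightarrow> 'a \<Rightarrow> real" where
  "dev j a = lin (\<lambda>l. centring n j l *\<^sub>R axis a 1)"

lemma dev: "j \<in> {1..n} \<Longrightarrow> dev j a \<omega> = (Z j \<omega> - zbar \<omega>) $ a"
proof -
  assume j: "j \<in> {1..n}"
  have "dev j a \<omega> = (\<Sum>l=1..n. (if j = l then Z l \<omega> $ a else 0) - Z l \<omega> $ a / real n)"
    unfolding dev_def lin_def by (intro sum.cong refl) (simp add: centring_def inner_axis' algebra_simps)
  also have "\<dots> = (Z j \<omega> - zbar \<omega>) $ a"
    using j by (simp add: sum_subtractf smean_def divide_inverse mult.commute flip: sum_distrib_left)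
  finally show ?thesis .
qed

lemma dev_mem: "dev j a \<in> range lin"
  by (simp add: dev_def)

lemma cov_dev:
  assumes "j \<in> {1..n}" "k \<in> {1..n}"
  shows "cov (dev j a) (dev k b) = centring n j k * Sg $ a $ b"
proof -
  have "cov (dev j a) (dev k b) = (\<Sum>l=1..n. centring n j l * centring n k l * Sg $ a $ b)"
    unfolding dev_def cov_lin by (intro sum.cong refl) (simp add: matrix_vector_mult_scaleR axis_Sg)
  also have "\<dots> = centring n j k * Sg $ a $ b"
    by (simp only: centring_idempotent[OF assms] sum_distrib_right[symmetric])
  finally show ?thesis .
qed

lemma S_nth: "S \<omega> $ a $ b = (\<Sum>j=1..n. dev j a \<omega> * dev j b \<omega>)"
  by (simp add: scat_nth dev)

lemma expectation_S: "integrable M (\<lambda>\<omega>. S \<omega> $ a $ b)" "expectation (\<lambda>\<omega>. S \<omega> $ a $ b) = dof * Sg $ a $ b"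
proof -
  show "integrable M (\<lambda>\<omega>. S \<omega> $ a $ b)"
    unfolding S_nth by (intro Bochner_Integration.integrable_sum integrable_prod2 dev_mem)
  have "expectation (\<lambda>\<omega>. S \<omega> $ a $ b) = (\<Sum>j=1..n. cov (dev j a) (dev j b))"
    unfolding S_nth by (intro Bochner_Integration.integral_sum integrable_prod2 dev_mem)
  also have "\<dots> = (\<Sum>j=1..n. centring n j j) * Sg $ a $ b"
    by (simp add: cov_dev sum_distrib_right)
  finally show "expectation (\<lambda>\<omega>. S \<omega> $ a $ b) = dof * Sg $ a $ b"
    using centring_traces(1)[of n] n3 by simp
qed

lemma expectation_S_S:
  "integrable M (\<lambda>\<omega>. S \<omega> $ a $ b * S \<omega> $ c $ d)"
  "expectation (\<lambda>\<omega>. S \<omega> $ a $ b * S \<omega> $ c $ d) =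
    dof\<^sup>2 * (Sg $ a $ b * Sg $ c $ d) + dof * (Sg $ a $ c * Sg $ b $ d + Sg $ a $ d * Sg $ b $ c)"
proof -
  have e: "S \<omega> $ a $ b * S \<omega> $ c $ d = (\<Sum>j=1..n. \<Sum>k=1..n. dev j a \<omega> * dev j b \<omega> * (dev k c \<omega> * dev k d \<omega>))" for \<omega>
    by (simp add: S_nth sum_product)
  show "integrable M (\<lambda>\<omega>. S \<omega> $ a $ b * S \<omega> $ c $ d)"
    unfolding e by (intro Bochner_Integration.integrable_sum integrable_prod4 dev_mem)
  have "expectation (\<lambda>\<omega>. S \<omega> $ a $ b * S \<omega> $ c $ d)
    = (\<Sum>j=1..n. \<Sum>k=1..n. expectation (\<lambda>\<omega>. dev j a \<omega> * dev j b \<omega> * (dev k c \<omega> * dev k d \<omega>)))"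
    unfolding e
    by (subst Bochner_Integration.integral_sum, intro Bochner_Integration.integrable_sum integrable_prod4 dev_mem,
        intro sum.cong refl Bochner_Integration.integral_sum integrable_prod4 dev_mem)
  also have "\<dots> = (\<Sum>j=1..n. \<Sum>k=1..n. centring n j j * centring n k k * (Sg $ a $ b * Sg $ c $ d)
      + (centring n j k)\<^sup>2 * (Sg $ a $ c * Sg $ b $ d + Sg $ a $ d * Sg $ b $ c))"
    by (intro sum.cong refl) (simp only: isserlis[OF dev_mem dev_mem dev_mem dev_mem] cov_dev, simp add: power2_eq_square algebra_simps)
  also have "\<dots> = (\<Sum>j=1..n. \<Sum>k=1..n. centring n j j * centring n k k) * (Sg $ a $ b * Sg $ c $ d)
      + (\<Sum>j=1..n. \<Sum>k=1..n. (centring n j k)\<^sup>2) * (Sg $ a $ c * Sg $ b $ d + Sg $ a $ d * Sg $ b $ c)"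
    by (simp add: sum.distrib sum_distrib_right)
  also have "(\<Sum>j=1..n. \<Sum>k=1..n. centring n j j * centring n k k) = dof\<^sup>2"
    using centring_traces(1)[of n] n3 by (simp add: power2_eq_square flip: sum_product)
  also have "(\<Sum>j=1..n. \<Sum>k=1..n. (centring n j k)\<^sup>2) = dof"
    using centring_traces(2)[of n] n3 by simp
  finally show "expectation (\<lambda>\<omega>. S \<omega> $ a $ b * S \<omega> $ c $ d) =
    dof\<^sup>2 * (Sg $ a $ b * Sg $ c $ d) + dof * (Sg $ a $ c * Sg $ b $ d + Sg $ a $ d * Sg $ b $ c)" .
qed

lemma expectation_trace_S: "integrable M (\<lambda>\<omega>. trace (S \<omega>))" "expectation (\<lambda>\<omega>. trace (S \<omega>)) = dof * trace Sg"
  using expectation_S by (simp_all add: trace_def sum_distrib_left)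

lemma expectation_norm_S_sq:
  "integrable M (\<lambda>\<omega>. (norm (S \<omega>))\<^sup>2)"
  "expectation (\<lambda>\<omega>. (norm (S \<omega>))\<^sup>2) = (dof\<^sup>2 + dof) * (norm Sg)\<^sup>2 + dof * (trace Sg)\<^sup>2"
proof -
  have e: "(norm (S \<omega>))\<^sup>2 = (\<Sum>a\<in>UNIV. \<Sum>b\<in>UNIV. S \<omega> $ a $ b * S \<omega> $ a $ b)" for \<omega>
    unfolding norm_matrix_power2 by (simp add: power2_eq_square)
  show "integrable M (\<lambda>\<omega>. (norm (S \<omega>))\<^sup>2)"
    unfolding e by (intro Bochner_Integration.integrable_sum expectation_S_S)
  have "expectation (\<lambda>\<omega>. (norm (S \<omega>))\<^sup>2) = (\<Sum>a\<in>UNIV. \<Sum>b\<in>UNIV. (dof\<^sup>2 + dof) * (Sg $ a $ b)\<^sup>2 + dof * (Sg $ a $ a * Sg $ b $ b))"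
    unfolding e
    by (subst Bochner_Integration.integral_sum, intro Bochner_Integration.integrable_sum expectation_S_S,
        subst Bochner_Integration.integral_sum, intro expectation_S_S,
        simp add: expectation_S_S Sg_commute power2_eq_square algebra_simps)
  also have "\<dots> = (dof\<^sup>2 + dof) * (norm Sg)\<^sup>2 + dof * (trace Sg)\<^sup>2"
    unfolding norm_matrix_power2 trace_def power2_eq_square[of "sum _ _"] sum_product
    by (simp add: sum.distrib sum_distrib_left)
  finally show "expectation (\<lambda>\<omega>. (norm (S \<omega>))\<^sup>2) = (dof\<^sup>2 + dof) * (norm Sg)\<^sup>2 + dof * (trace Sg)\<^sup>2" .
qed

lemma expectation_trace_S_sq:
  "integrable M (\<lambda>\<omega>. (trace (S \<omega>))\<^sup>2)"
  "expectation (\<lambda>\<omega>. (trace (S \<omega>))\<^sup>2) = dof\<^sup>2 * (trace Sg)\<^sup>2 + 2 * dof * (norm Sg)\<^sup>2"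
proof -
  have e: "(trace (S \<omega>))\<^sup>2 = (\<Sum>a\<in>UNIV. \<Sum>b\<in>UNIV. S \<omega> $ a $ a * S \<omega> $ b $ b)" for \<omega>
    by (simp add: trace_def power2_eq_square sum_product)
  show "integrable M (\<lambda>\<omega>. (trace (S \<omega>))\<^sup>2)"
    unfolding e by (intro Bochner_Integration.integrable_sum expectation_S_S)
  have "expectation (\<lambda>\<omega>. (trace (S \<omega>))\<^sup>2) = (\<Sum>a\<in>UNIV. \<Sum>b\<in>UNIV. dof\<^sup>2 * (Sg $ a $ a * Sg $ b $ b) + 2 * dof * (Sg $ a $ b)\<^sup>2)"
    unfolding e
    by (subst Bochner_Integration.integral_sum, intro Bochner_Integration.integrable_sum expectation_S_S,
        subst Bochner_Integration.integral_sum, intro expectation_S_S,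
        simp add: expectation_S_S power2_eq_square algebra_simps)
  also have "\<dots> = dof\<^sup>2 * (trace Sg)\<^sup>2 + 2 * dof * (norm Sg)\<^sup>2"
    unfolding norm_matrix_power2 trace_def power2_eq_square[of "sum _ _"] sum_product
    by (simp add: sum.distrib sum_distrib_left)
  finally show "expectation (\<lambda>\<omega>. (trace (S \<omega>))\<^sup>2) = dof\<^sup>2 * (trace Sg)\<^sup>2 + 2 * dof * (norm Sg)\<^sup>2" .
qed

lemma inner_zbar: "v \<bullet> zbar \<omega> = lin (\<lambda>_. v /\<^sub>R real n) \<omega>"
  by (simp add: smean_def lin_def inner_sum_right sum_distrib_left)

lemma expectation_inner_zbar:
  "integrable M (\<lambda>\<omega>. v \<bullet> zbar \<omega>)" "expectation (\<lambda>\<omega>. v \<bullet> zbar \<omega>) = 0"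
  "integrable M (\<lambda>\<omega>. (v \<bullet> zbar \<omega>)\<^sup>2)" "expectation (\<lambda>\<omega>. (v \<bullet> zbar \<omega>)\<^sup>2) = v \<bullet> (Sg *v v) / real n"
proof -
  note g = gaussian_lin[of "\<lambda>_. v /\<^sub>R real n"]
  show "integrable M (\<lambda>\<omega>. v \<bullet> zbar \<omega>)" "expectation (\<lambda>\<omega>. v \<bullet> zbar \<omega>) = 0"
    unfolding inner_zbar using gaussian_integrable[OF g] gaussian_mean_zero[OF g] by simp_all
  show "integrable M (\<lambda>\<omega>. (v \<bullet> zbar \<omega>)\<^sup>2)"
    unfolding inner_zbar using gaussian_moments(1)[OF g] by (simp add: has_bochner_integral_iff)
  show "expectation (\<lambda>\<omega>. (v \<bullet> zbar \<omega>)\<^sup>2) = v \<bullet> (Sg *v v) / real n"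
    unfolding inner_zbar using gaussian_moments(1)[OF g] n3
    by (simp add: has_bochner_integral_iff matrix_vector_mult_scaleR field_simps)
qed

lemma expectation_norm_zbar_sq:
  "integrable M (\<lambda>\<omega>. (norm (zbar \<omega>))\<^sup>2)" "expectation (\<lambda>\<omega>. (norm (zbar \<omega>))\<^sup>2) = trace Sg / real n"
proof -
  have e: "(norm (zbar \<omega>))\<^sup>2 = (\<Sum>a\<in>UNIV. (axis a 1 \<bullet> zbar \<omega>)\<^sup>2)" for \<omega>
    unfolding power2_norm_eq_inner inner_axis' by (simp add: inner_vec_def power2_eq_square)
  show "integrable M (\<lambda>\<omega>. (norm (zbar \<omega>))\<^sup>2)" "expectation (\<lambda>\<omega>. (norm (zbar \<omega>))\<^sup>2) = trace Sg / real n"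
    unfolding e using expectation_inner_zbar(3,4) by (simp_all add: axis_Sg trace_def sum_divide_distrib)
qed

lemma Sg_diag_pos: "Sg $ a $ a > 0"
  using pos[of "axis a 1"] by (simp add: axis_Sg axis_eq_0_iff)

lemma trace_Sg_pos: "trace Sg > 0"
  unfolding trace_def by (intro sum_pos Sg_diag_pos) auto

text \<open>The inequality \<open>norm S \<le> trace S\<close> holds pointwise and passes to the mean \<open>dof * Sg\<close> of \<open>S\<close>.\<close>
lemma norm_Sg_le: "norm Sg \<le> trace Sg"
proof -
  have "dof * (norm Sg)\<^sup>2 = (\<Sum>a\<in>UNIV. \<Sum>b\<in>UNIV. expectation (\<lambda>\<omega>. S \<omega> $ a $ b) * Sg $ a $ b)"
    unfolding norm_matrix_power2 by (simp add: expectation_S power2_eq_square sum_distrib_left mult_ac)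
  also have "\<dots> = expectation (\<lambda>\<omega>. S \<omega> \<bullet> Sg)"
    unfolding inner_matrix using expectation_S by simp
  also have "\<dots> \<le> expectation (\<lambda>\<omega>. trace (S \<omega>) * norm Sg)"
  proof (rule integral_mono)
    show "integrable M (\<lambda>\<omega>. S \<omega> \<bullet> Sg)" unfolding inner_matrix using expectation_S by simp
    show "integrable M (\<lambda>\<omega>. trace (S \<omega>) * norm Sg)" using expectation_trace_S by simp
    show "S \<omega> \<bullet> Sg \<le> trace (S \<omega>) * norm Sg" for \<omega>
    proof -
      have "S \<omega> \<bullet> Sg \<le> norm (S \<omega>) * norm Sg" by (rule norm_cauchy_schwarz)
      also have "\<dots> \<le> trace (S \<omega>) * norm Sg" by (intro mult_right_mono norm_scat_le_trace) simp
      finally show ?thesis .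
    qed
  qed
  also have "\<dots> = dof * (trace Sg * norm Sg)" using expectation_trace_S by simp
  finally have "norm Sg * norm Sg \<le> trace Sg * norm Sg" using n3 by (simp add: power2_eq_square)
  then show ?thesis using trace_Sg_pos by (cases "norm Sg = 0") auto
qed

text \<open>The power mean inequality reduces the fourth power of the sum of squares to the eighth moments
  of the coordinates.\<close>
lemma expectation_T_pow4:
  "integrable M (\<lambda>\<omega>. T \<omega> ^ 4)"
  "expectation (\<lambda>\<omega>. T \<omega> ^ 4) \<le> 105 * real n * (real n * real CARD('k)) ^ 3 * (trace Sg) ^ 4"
proof -
  define c where "c j a = lin (\<lambda>l. (if l = j then 1 else 0) *\<^sub>R axis a 1)" for j and a :: 'k
  have c: "c j a \<omega> = Z j \<omega> $ a" if "j \<in> {1..n}" for j a \<omega>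
  proof -
    have "c j a \<omega> = (\<Sum>l=1..n. if l = j then Z l \<omega> $ a else 0)"
      unfolding c_def lin_def by (intro sum.cong refl) (simp add: inner_axis')
    then show ?thesis using that by simp
  qed
  have cc: "cov (c j a) (c j a) = Sg $ a $ a" if "j \<in> {1..n}" for j a
  proof -
    have "cov (c j a) (c j a) = (\<Sum>l=1..n. if l = j then Sg $ a $ a else 0)"
      unfolding c_def cov_lin by (intro sum.cong refl) (simp add: axis_Sg)
    then show ?thesis using that by simp
  qed
  define N where "N = (real n * real CARD('k)) ^ 3"
  have T: "T \<omega> = (\<Sum>(j, a)\<in>{1..n} \<times> UNIV. (c j a \<omega>)\<^sup>2)" for \<omega>
    unfolding sumsq_def sum.cartesian_product[symmetric] power2_norm_eq_inner
    by (intro sum.cong refl) (simp add: c inner_vec_def power2_eq_square)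
  have le: "T \<omega> ^ 4 \<le> N * (\<Sum>j=1..n. \<Sum>a\<in>UNIV. c j a \<omega> ^ 8)" for \<omega>
    using sum_pow4_le[of "\<lambda>(j, a). (c j a \<omega>)\<^sup>2" "{1..n} \<times> (UNIV :: 'k set)"]
    unfolding T by (simp add: N_def card_cartesian_product split_def sum.cartesian_product)
  have mem: "c j a \<in> range lin" for j a by (simp add: c_def)
  have int: "integrable M (\<lambda>\<omega>. N * (\<Sum>j=1..n. \<Sum>a\<in>UNIV. c j a \<omega> ^ 8))"
    by (intro integrable_mult_right Bochner_Integration.integrable_sum pow8_mem mem)
  show iT: "integrable M (\<lambda>\<omega>. T \<omega> ^ 4)"
  proof (rule Bochner_Integration.integrable_bound[OF int])
    show "AE \<omega> in M. norm (T \<omega> ^ 4) \<le> norm (N * (\<Sum>j=1..n. \<Sum>a\<in>UNIV. c j a \<omega> ^ 8))"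
      using le by (auto intro!: AE_I2 order_trans[OF _ abs_ge_self] simp: sumsq_nonneg)
  qed measurable
  have "expectation (\<lambda>\<omega>. T \<omega> ^ 4) \<le> expectation (\<lambda>\<omega>. N * (\<Sum>j=1..n. \<Sum>a\<in>UNIV. c j a \<omega> ^ 8))"
    by (intro integral_mono iT int le)
  also have "\<dots> = N * (\<Sum>j=1..n. \<Sum>a\<in>UNIV. expectation (\<lambda>\<omega>. c j a \<omega> ^ 8))"
    using pow8_mem[OF mem] by simp
  also have "(\<Sum>j=1..n. \<Sum>a\<in>UNIV. expectation (\<lambda>\<omega>. c j a \<omega> ^ 8)) = (\<Sum>j=1..n. \<Sum>a\<in>UNIV. 105 * (Sg $ a $ a) ^ 4)"
    by (intro sum.cong refl) (simp only: expectation_pow8[OF mem] cc)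
  also have "\<dots> = real n * (105 * (\<Sum>a\<in>UNIV. (Sg $ a $ a) ^ 4))" by (simp add: sum_distrib_left)
  also have "N * \<dots> \<le> N * (real n * (105 * (trace Sg) ^ 4))"
  proof (intro mult_left_mono)
    have "(Sg $ a $ a) ^ 4 \<le> (Sg $ a $ a) * (trace Sg) ^ 3" for a
    proof -
      have "Sg $ a $ a \<le> trace Sg" unfolding trace_def
        by (intro member_le_sum) (auto intro: less_imp_le[OF Sg_diag_pos])
      then have "(Sg $ a $ a) * (Sg $ a $ a) ^ 3 \<le> (Sg $ a $ a) * (trace Sg) ^ 3"
        by (intro mult_left_mono power_mono) (auto intro: less_imp_le[OF Sg_diag_pos])
      then show ?thesis by (simp add: power_numeral_reduce)
    qed
    then have "(\<Sum>a\<in>UNIV. (Sg $ a $ a) ^ 4) \<le> (\<Sum>a\<in>UNIV. (Sg $ a $ a) * (trace Sg) ^ 3)" by (intro sum_mono)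
    also have "\<dots> = (trace Sg) ^ 4"
      by (simp add: power_numeral_reduce trace_def flip: sum_distrib_right)
    finally show "(\<Sum>a\<in>UNIV. (Sg $ a $ a) ^ 4) \<le> (trace Sg) ^ 4" .
  qed (simp_all add: N_def)
  finally show "expectation (\<lambda>\<omega>. T \<omega> ^ 4) \<le> 105 * real n * (real n * real CARD('k)) ^ 3 * (trace Sg) ^ 4"
    by (simp add: N_def mult_ac)
qed

text \<open>The scatter matrix dominates the squared difference of one coordinate of two observations,
  and a Gaussian variable exceeds any bound with a probability that depends only on its variance.\<close>

lemma prob_norm_S_less:
  assumes e: "e > 0" "e \<le> trace Sg" and R: "R \<ge> 0"
  shows "prob {\<omega> \<in> space M. norm (S \<omega>) < R}
    \<le> 1 - exp (- (2 + 2 * (sqrt (2 * R) / sqrt (e / real CARD('k))))\<^sup>2) / 4"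
proof -
  define q where "q = real CARD('k)"
  have q: "q > 0" by (simp add: q_def)
  obtain a where a: "e / q \<le> Sg $ a $ a"
  proof (rule ccontr)
    assume "\<not> thesis"
    then have "trace Sg < (\<Sum>a\<in>(UNIV :: 'k set). e / q)" unfolding trace_def
      using that by (intro sum_strict_mono) (auto simp: not_le[symmetric])
    then show False using e q by (simp add: q_def)
  qed
  define w where "w l = ((if l = 1 then 1 else 0) - (if l = 2 then 1 else 0)) *\<^sub>R (axis a 1 :: real^'k)" for l :: nat
  have w: "lin w \<omega> = dev 1 a \<omega> - dev 2 a \<omega>" for \<omega>
  proof -
    have "lin w \<omega> = (\<Sum>l=1..n. (if l = 1 then Z l \<omega> $ a else 0) - (if l = 2 then Z l \<omega> $ a else 0))"
      unfolding lin_def by (intro sum.cong refl) (auto simp: w_def inner_axis')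
    also have "\<dots> = Z 1 \<omega> $ a - Z 2 \<omega> $ a" using n3 by (simp add: sum_subtractf)
    finally show ?thesis using n3 by (simp add: dev)
  qed
  define v where "v = (\<Sum>l=1..n. w l \<bullet> (Sg *v w l))"
  have "v = (\<Sum>l=1..n. (if l = 1 then Sg $ a $ a else 0) + (if l = 2 then Sg $ a $ a else 0))"
    unfolding v_def by (intro sum.cong refl) (auto simp: w_def axis_Sg matrix_vector_mult_scaleR)
  also have "\<dots> = 2 * Sg $ a $ a" using n3 by (simp add: sum.distrib)
  finally have v: "v = 2 * Sg $ a $ a" .
  then have v0: "v > 0" and ve: "e / q \<le> v" using Sg_diag_pos[of a] a by auto
  have g: "gaussian (lin w) v" unfolding v_def by (rule gaussian_lin)
  \<comment> \<open>Large enough for the standardized difference of two observations to exceed \<open>sqrt (2 R)\<close> on the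
    event of the tail bound.\<close>
  define s where "s = 2 + 2 * (sqrt (2 * R) / sqrt (e / q))"
  have s: "s \<ge> 2" using R e q by (simp add: s_def)
  define t where "t = s / sqrt v"
  have t: "t > 0" and tv: "t\<^sup>2 * v = s\<^sup>2" using s v0 by (simp_all add: t_def power_divide)
  have big: "R \<le> norm (S \<omega>)" if "exp (t\<^sup>2 * v / 2) / 2 \<le> exp (t * lin w \<omega>)" for \<omega>
  proof -
    have "ln (exp (t\<^sup>2 * v / 2) / 2) \<le> ln (exp (t * lin w \<omega>))"
      using that by (subst ln_le_cancel_iff) auto
    then have "s\<^sup>2 / 2 - ln 2 \<le> t * lin w \<omega>" by (simp add: ln_div tv)
    moreover have "ln 2 \<le> (1 :: real)" using ln_le_minus_one[of "2 :: real"] by simp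
    moreover have "s * (s - 1) / 2 \<le> s\<^sup>2 / 2 - 1" using s by (simp add: power2_eq_square field_simps)
    ultimately have "s * (s - 1) / 2 \<le> t * lin w \<omega>" by linarith
    then have "s * (sqrt v * (s - 1) / 2) \<le> s * lin w \<omega>"
      using v0 by (simp add: t_def field_simps)
    then have "sqrt v * (s - 1) / 2 \<le> lin w \<omega>" using s by simp
    moreover have "sqrt (2 * R) \<le> sqrt v * (s - 1) / 2"
    proof -
      have "sqrt (2 * R) = sqrt (e / q) * (sqrt (2 * R) / sqrt (e / q))" using e q by simp
      also have "\<dots> \<le> sqrt v * ((s - 1) / 2)"
      proof (intro mult_mono)
        show "sqrt (2 * R) / sqrt (e / q) \<le> (s - 1) / 2" unfolding s_def by argo
      qed (use ve R e q v0 in auto)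
      finally show ?thesis by simp
    qed
    ultimately have "sqrt (2 * R) \<le> lin w \<omega>" by linarith
    then have "(sqrt (2 * R))\<^sup>2 \<le> (lin w \<omega>)\<^sup>2" using R by (intro power_mono) auto
    then have "2 * R \<le> (dev 1 a \<omega> - dev 2 a \<omega>)\<^sup>2" using R w by simp
    also have "\<dots> \<le> 2 * ((dev 1 a \<omega>)\<^sup>2 + (dev 2 a \<omega>)\<^sup>2)"
      using zero_le_power2[of "dev 1 a \<omega> + dev 2 a \<omega>"] unfolding power2_sum power2_diff by argo
    finally have "R \<le> (\<Sum>j\<in>{1,2}. dev j a \<omega> * dev j a \<omega>)" by (simp add: power2_eq_square)
    also have "\<dots> \<le> S \<omega> $ a $ a" unfolding S_nth using n3 by (intro sum_mono2) auto
    also have "\<dots> \<le> norm (S \<omega> $ a)" using component_le_norm_cart[of "S \<omega> $ a" a] by linarith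
    also have "\<dots> \<le> norm (S \<omega>)" by (rule Finite_Cartesian_Product.norm_nth_le)
    finally show ?thesis .
  qed
  have "exp (- (s\<^sup>2)) / 4 \<le> prob {\<omega> \<in> space M. exp (t * lin w \<omega>) \<ge> exp (t\<^sup>2 * v / 2) / 2}"
    using gaussian_upper_tail[OF g, of t] by (simp add: tv)
  also have "\<dots> \<le> prob {\<omega> \<in> space M. R \<le> norm (S \<omega>)}"
    using big by (intro finite_measure_mono) auto
  also have "\<dots> = 1 - prob {\<omega> \<in> space M. norm (S \<omega>) < R}"
  proof -
    have "{\<omega> \<in> space M. R \<le> norm (S \<omega>)} = space M - {\<omega> \<in> space M. norm (S \<omega>) < R}" by auto
    then show ?thesis by (simp add: prob_compl)
  qed
  finally show ?thesis by (simp add: s_def q_def)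
qed

end

section \<open>Averages over independent samples\<close>

lemma cesaro_tendsto_zero:
  fixes a :: "nat \<Rightarrow> real"
  assumes "a \<longlonglongrightarrow> 0"
  shows "(\<lambda>p. (\<Sum>i=1..p. a i) / real p) \<longlonglongrightarrow> 0"
proof (rule LIMSEQ_I)
  fix r :: real assume r: "0 < r"
  obtain N where N: "\<And>i. i \<ge> N \<Longrightarrow> \<bar>a i\<bar> < r / 2"
    using LIMSEQ_D[OF assms, of "r / 2"] r by auto
  define B where "B = (\<Sum>i=1..N. \<bar>a i\<bar>)"
  obtain P where P: "real P > 2 * B / r" "P \<ge> 1"
    using reals_Archimedean2[of "2 * B / r"] by (metis le_add1 less_le_trans of_nat_le_iff add.commute add.left_commute)
  have "norm ((\<Sum>i=1..p. a i) / real p - 0) < r" if p: "p \<ge> max N P" for p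
  proof -
    have p1: "p \<ge> 1" "p \<ge> N" using p P by auto
    have "\<bar>\<Sum>i=1..p. a i\<bar> \<le> (\<Sum>i=1..p. \<bar>a i\<bar>)" by (rule sum_abs)
    also have "\<dots> \<le> (\<Sum>i=1..p. (if i \<le> N then \<bar>a i\<bar> else 0) + r / 2)"
      using N r by (intro sum_mono) (auto simp: less_imp_le)
    also have "\<dots> = (\<Sum>i=1..p. (if i \<le> N then \<bar>a i\<bar> else 0)) + real p * r / 2"
      by (simp add: sum.distrib)
    also have "(\<Sum>i=1..p. (if i \<le> N then \<bar>a i\<bar> else 0)) = B"
      unfolding B_def using p1 by (intro sum.mono_neutral_cong_right) auto
    also have "B < real p * r / 2"
    proof -
      have "B < real P * r / 2" using P r by (simp add: field_simps)
      also have "\<dots> \<le> real p * r / 2" using p r by simp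
      finally show ?thesis .
    qed
    finally show ?thesis using p1 by (simp add: field_simps)
  qed
  then show "\<exists>no. \<forall>p\<ge>no. norm ((\<Sum>i=1..p. a i) / real p - 0) < r" by blast
qed

lemma smean_inner: "smean p f \<bullet> v = smean p (\<lambda>i. f i \<bullet> v)"
  by (simp add: smean_def inner_sum_left)

lemma smean_real: "smean p (f :: nat \<Rightarrow> real) = (\<Sum>i=1..p. f i) / real p"
  by (simp add: smean_def divide_inverse mult.commute)

lemma (in prob_space) expectation_norm_smean_sq:
  fixes D :: "nat \<Rightarrow> 'a \<Rightarrow> 'b::euclidean_space"
  assumes ind: "indep_vars (\<lambda>_. borel) D {1..}"
    and int: "\<And>i. i \<ge> 1 \<Longrightarrow> integrable M (\<lambda>\<omega>. (norm (D i \<omega>))\<^sup>2)"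
    and mean: "\<And>i v. i \<ge> 1 \<Longrightarrow> expectation (\<lambda>\<omega>. D i \<omega> \<bullet> v) = 0"
  shows "integrable M (\<lambda>\<omega>. (norm (smean p (\<lambda>i. D i \<omega>)))\<^sup>2)"
    and "expectation (\<lambda>\<omega>. (norm (smean p (\<lambda>i. D i \<omega>)))\<^sup>2) = (\<Sum>i=1..p. expectation (\<lambda>\<omega>. (norm (D i \<omega>))\<^sup>2)) / (real p)\<^sup>2"
proof -
  have meas[measurable]: "i \<ge> 1 \<Longrightarrow> random_variable borel (D i)" for i
    using ind by (auto simp: indep_vars_def)
  have iD: "integrable M (\<lambda>\<omega>. D i \<omega> \<bullet> v)" if "i \<ge> 1" for i v
  proof (rule square_integrable_imp_integrable)
    show "random_variable borel (\<lambda>\<omega>. D i \<omega> \<bullet> v)" using meas[OF that] by measurable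
    show "integrable M (\<lambda>\<omega>. (D i \<omega> \<bullet> v)\<^sup>2)"
    proof (rule Bochner_Integration.integrable_bound)
      show "integrable M (\<lambda>\<omega>. (norm (D i \<omega>))\<^sup>2 * (norm v)\<^sup>2)" using int[OF that] by simp
      have "(D i \<omega> \<bullet> v)\<^sup>2 \<le> (norm (D i \<omega>))\<^sup>2 * (norm v)\<^sup>2" for \<omega>
        using Cauchy_Schwarz_ineq[of "D i \<omega>" v] by (simp add: power2_norm_eq_inner)
      then show "AE \<omega> in M. norm ((D i \<omega> \<bullet> v)\<^sup>2) \<le> norm ((norm (D i \<omega>))\<^sup>2 * (norm v)\<^sup>2)" by simp
    qed (use meas[OF that] in measurable)
  qed
  have cross: "integrable M (\<lambda>\<omega>. D i \<omega> \<bullet> D j \<omega>) \<and> expectation (\<lambda>\<omega>. D i \<omega> \<bullet> D j \<omega>) = 0"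
    if ij: "i \<ge> 1" "j \<ge> 1" "i \<noteq> j" for i j
  proof -
    have e: "D i \<omega> \<bullet> D j \<omega> = (\<Sum>b\<in>Basis. (\<Prod>l\<in>{i, j}. D l \<omega> \<bullet> b))" for \<omega>
      using ij by (subst euclidean_inner) simp
    have *: "integrable M (\<lambda>\<omega>. \<Prod>l\<in>{i, j}. D l \<omega> \<bullet> b)" "expectation (\<lambda>\<omega>. \<Prod>l\<in>{i, j}. D l \<omega> \<bullet> b) = 0" for b
    proof -
      have iv: "indep_vars (\<lambda>_. borel) (\<lambda>l \<omega>. D l \<omega> \<bullet> b) {i, j}"
        using ij by (intro indep_vars_compose2[OF indep_vars_subset[OF ind], where Y = "\<lambda>_ x. x \<bullet> b"]) auto
      show "integrable M (\<lambda>\<omega>. \<Prod>l\<in>{i, j}. D l \<omega> \<bullet> b)"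
        by (rule indep_vars_integrable[OF _ iv]) (use iD ij in auto)
      have "expectation (\<lambda>\<omega>. \<Prod>l\<in>{i, j}. D l \<omega> \<bullet> b) = (\<Prod>l\<in>{i, j}. expectation (\<lambda>\<omega>. D l \<omega> \<bullet> b))"
        by (rule indep_vars_lebesgue_integral[OF _ iv]) (use iD ij in auto)
      then show "expectation (\<lambda>\<omega>. \<Prod>l\<in>{i, j}. D l \<omega> \<bullet> b) = 0"
        using ij mean by simp
    qed
    show ?thesis unfolding e using * by (simp add: Bochner_Integration.integral_sum)
  qed
  have self: "integrable M (\<lambda>\<omega>. D i \<omega> \<bullet> D i \<omega>)" if "i \<ge> 1" for i
    using int[OF that] by (simp add: power2_norm_eq_inner)
  have intij: "integrable M (\<lambda>\<omega>. D i \<omega> \<bullet> D j \<omega>)" if "i \<in> {1..p}" "j \<in> {1..p}" for i j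
    using cross[of i j] self[of i] that by (cases "i = j") auto
  have e: "(norm (smean p (\<lambda>i. D i \<omega>)))\<^sup>2 = (\<Sum>i=1..p. \<Sum>j=1..p. D i \<omega> \<bullet> D j \<omega>) / (real p)\<^sup>2" for \<omega>
  proof -
    have "(\<Sum>i=1..p. D i \<omega>) \<bullet> (\<Sum>j=1..p. D j \<omega>) = (\<Sum>i=1..p. \<Sum>j=1..p. D i \<omega> \<bullet> D j \<omega>)"
      by (subst inner_sum_left) (simp only: inner_sum_right)
    then show ?thesis
      unfolding smean_def power2_norm_eq_inner by (simp add: power2_eq_square divide_inverse mult_ac)
  qed
  show "integrable M (\<lambda>\<omega>. (norm (smean p (\<lambda>i. D i \<omega>)))\<^sup>2)"
    unfolding e by (intro integrable_divide Bochner_Integration.integrable_sum intij)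
  have "expectation (\<lambda>\<omega>. (norm (smean p (\<lambda>i. D i \<omega>)))\<^sup>2)
    = (\<Sum>i=1..p. \<Sum>j=1..p. expectation (\<lambda>\<omega>. D i \<omega> \<bullet> D j \<omega>)) / (real p)\<^sup>2"
  proof -
    have "expectation (\<lambda>\<omega>. \<Sum>i=1..p. \<Sum>j=1..p. D i \<omega> \<bullet> D j \<omega>) = (\<Sum>i=1..p. expectation (\<lambda>\<omega>. \<Sum>j=1..p. D i \<omega> \<bullet> D j \<omega>))"
      by (intro Bochner_Integration.integral_sum Bochner_Integration.integrable_sum intij)
    also have "\<dots> = (\<Sum>i=1..p. \<Sum>j=1..p. expectation (\<lambda>\<omega>. D i \<omega> \<bullet> D j \<omega>))"
      by (intro sum.cong refl Bochner_Integration.integral_sum intij)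
    finally show ?thesis unfolding e by simp
  qed
  also have "(\<Sum>i=1..p. \<Sum>j=1..p. expectation (\<lambda>\<omega>. D i \<omega> \<bullet> D j \<omega>))
    = (\<Sum>i=1..p. \<Sum>j=1..p. if i = j then expectation (\<lambda>\<omega>. (norm (D i \<omega>))\<^sup>2) else 0)"
    using cross by (intro sum.cong refl) (auto simp: power2_norm_eq_inner)
  also have "\<dots> = (\<Sum>i=1..p. expectation (\<lambda>\<omega>. (norm (D i \<omega>))\<^sup>2))" by simp
  finally show "expectation (\<lambda>\<omega>. (norm (smean p (\<lambda>i. D i \<omega>)))\<^sup>2) = (\<Sum>i=1..p. expectation (\<lambda>\<omega>. (norm (D i \<omega>))\<^sup>2)) / (real p)\<^sup>2" .
qed

text \<open>All populations together.  The constant \<open>bnd\<close> expresses the two hypotheses on averages, and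
  \<open>mean_max p\<close> majorizes the norms of the first \<open>p\<close> population means.\<close>
locale gaussian_populations = prob_space M for M :: "'a measure" +
  fixes n :: nat and m :: "nat \<Rightarrow> real^'k" and Sg :: "nat \<Rightarrow> 'k::finite sqmat" and Z :: "nat \<Rightarrow> nat \<Rightarrow> 'a \<Rightarrow> real^'k"
    and bnd :: real and mean_max :: "nat \<Rightarrow> real"
  assumes n3: "n \<ge> 3"
    and Sg: "i \<ge> 1 \<Longrightarrow> Sg i \<in> spd"
    and indep: "indep_vars (\<lambda>_. borel) (\<lambda>(i, j). Z i j) ({1..} \<times> {1..n})"
    and gaussian_Z: "i \<ge> 1 \<Longrightarrow> j \<in> {1..n} \<Longrightarrow> gaussian (\<lambda>\<omega>. u \<bullet> Z i j \<omega>) (u \<bullet> (Sg i *v u))"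
    and trace_bound: "p \<ge> 1 \<Longrightarrow> (\<Sum>i=1..p. trace (Sg i) ^ 4) \<le> bnd * real p"
    and mean_var_bound: "p \<ge> 1 \<Longrightarrow> (\<Sum>i=1..p. m i \<bullet> (Sg i *v m i)) \<le> bnd * real p"
    and mean_le: "i \<in> {1..p} \<Longrightarrow> norm (m i) \<le> mean_max p"
    and mean_max_lim: "(\<lambda>p. mean_max p / sqrt (real p)) \<longlonglongrightarrow> 0"
begin

lemma sample: assumes i: "i \<ge> 1" shows "gaussian_sample M n (Sg i) (Z i)"
proof
  have "indep_vars (\<lambda>j. PiM {(i, j)} (\<lambda>_. borel)) (\<lambda>j \<omega>. restrict (\<lambda>x. (case x of (i, j) \<Rightarrow> Z i j) \<omega>) {(i, j)}) {1..n}"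
    by (rule indep_vars_restrict[OF indep]) (use i in \<open>auto simp: disjoint_family_on_def\<close>)
  then have "indep_vars (\<lambda>_. borel) (\<lambda>j \<omega>. (restrict (\<lambda>x. (case x of (i, j) \<Rightarrow> Z i j) \<omega>) {(i, j)}) (i, j)) {1..n}"
    by (rule indep_vars_compose2[where Y = "\<lambda>j x. x (i, j)"]) (rule measurable_component_singleton, simp)
  then show "indep_vars (\<lambda>_. borel) (Z i) {1..n}" by simp
qed (use i n3 Sg gaussian_Z in auto)

abbreviation "zb i \<omega> \<equiv> smean n (\<lambda>j. Z i j \<omega>)"
abbreviation "SS i \<omega> \<equiv> scat n (\<lambda>j. Z i j \<omega>)"
abbreviation "TT i \<omega> \<equiv> sumsq n (\<lambda>j. Z i j \<omega>)"

lemma measurable_stats [measurable]: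
  assumes "i \<ge> 1"
  shows "random_variable borel (zb i)" "random_variable borel (SS i)" "random_variable borel (TT i)"
proof -
  interpret gaussian_sample M n "Sg i" "Z i" by (rule sample[OF assms])
  show "random_variable borel (zb i)" "random_variable borel (SS i)" "random_variable borel (TT i)"
    by (rule measurable_stats)+
qed

text \<open>Statistics of different populations are functions of disjoint blocks of independent variables.\<close>
lemma indep_stats:
  assumes g: "\<And>i. i \<ge> 1 \<Longrightarrow> case_prod (g i) \<in> borel_measurable (borel \<Otimes>\<^sub>M borel)"
  shows "indep_vars (\<lambda>_. borel) (\<lambda>i \<omega>. g i (zb i \<omega>) (SS i \<omega>)) {1..}"
proof -
  have "indep_vars (\<lambda>i. PiM ({i} \<times> {1..n}) (\<lambda>_. borel))
      (\<lambda>i \<omega>. restrict (\<lambda>x. (case x of (i, j) \<Rightarrow> Z i j) \<omega>) ({i} \<times> {1..n})) {1..}"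
    by (rule indep_vars_restrict[OF indep]) (auto simp: disjoint_family_on_def)
  then have "indep_vars (\<lambda>_. borel) (\<lambda>i \<omega>. (\<lambda>x. g i (smean n (\<lambda>j. x (i, j))) (scat n (\<lambda>j. x (i, j))))
      (restrict (\<lambda>x. (case x of (i, j) \<Rightarrow> Z i j) \<omega>) ({i} \<times> {1..n}))) {1..}"
  proof (rule indep_vars_compose2)
    fix i :: nat assume i: "i \<in> {1..}"
    have c[measurable]: "(\<lambda>x. x (i, j)) \<in> measurable (PiM ({i} \<times> {1..n}) (\<lambda>_. borel :: (real^'k) measure)) borel" if "j \<in> {1..n}" for j
      by (rule measurable_component_singleton) (use that in auto)
    have zm[measurable]: "(\<lambda>x. smean n (\<lambda>j. x (i, j))) \<in> measurable (PiM ({i} \<times> {1..n}) (\<lambda>_. borel :: (real^'k) measure)) borel"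
      unfolding smean_def by measurable
    have op: "(\<lambda>x :: real^'k. outer_prod x x) \<in> borel_measurable borel"
      unfolding outer_prod_def by (intro borel_measurable_continuous_onI continuous_intros)
    have sm[measurable]: "(\<lambda>x. scat n (\<lambda>j. x (i, j))) \<in> measurable (PiM ({i} \<times> {1..n}) (\<lambda>_. borel :: (real^'k) measure)) borel"
      unfolding scat_def by (intro borel_measurable_sum measurable_compose[OF _ op]) measurable
    have "(\<lambda>x. case_prod (g i) (smean n (\<lambda>j. x (i, j)), scat n (\<lambda>j. x (i, j))))
      \<in> borel_measurable (PiM ({i} \<times> {1..n}) (\<lambda>_. borel :: (real^'k) measure))"
      using g[of i] i by (intro measurable_compose[OF _ g] measurable_Pair zm sm) auto
    then show "(\<lambda>x. g i (smean n (\<lambda>j. x (i, j))) (scat n (\<lambda>j. x (i, j))))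
      \<in> borel_measurable (PiM ({i} \<times> {1..n}) (\<lambda>_. borel :: (real^'k) measure))" by simp
  qed
  moreover have "smean n (\<lambda>j. restrict (\<lambda>x. (case x of (i, j) \<Rightarrow> Z i j) \<omega>) ({i} \<times> {1..n}) (i, j)) = zb i \<omega>" for i \<omega>
    by (simp add: smean_def)
  moreover have "scat n (\<lambda>j. restrict (\<lambda>x. (case x of (i, j) \<Rightarrow> Z i j) \<omega>) ({i} \<times> {1..n}) (i, j)) = SS i \<omega>" for i \<omega>
    unfolding scat_def smean_def by (intro sum.cong refl arg_cong2[where f = outer_prod]) (auto intro!: sum.cong)
  ultimately show ?thesis by simp
qed

text \<open>The centred statistics whose averages, together with that of \<open>zb\<close>, make up the difference
  between loss and risk estimate.  The last one compares \<open>norm (Sg i) ^ 2\<close> with its unbiased estimate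
  by the two quadratic invariants of the scatter matrix.\<close>

abbreviation "dof \<equiv> real n - 1"

definition "excess_norm i \<omega> = (norm (zb i \<omega>))\<^sup>2 - trace (SS i \<omega>) / (real n * dof)"
definition "cross_mean i \<omega> = m i \<bullet> zb i \<omega>"
definition "excess_cov i \<omega> = SS i \<omega> /\<^sub>R dof - Sg i"
definition "cross_cov i \<omega> = excess_cov i \<omega> \<bullet> Sg i"
definition "excess_sq i \<omega> = ((norm (SS i \<omega>))\<^sup>2 - (trace (SS i \<omega>))\<^sup>2 / dof) / ((dof + 2) * (dof - 1)) - (norm (Sg i))\<^sup>2"

lemma borel_measurable_trace [measurable]: "(trace :: 'k sqmat \<Rightarrow> real) \<in> borel_measurable borel"
  unfolding trace_def by (intro borel_measurable_continuous_onI continuous_intros)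

lemma indep_deviations:
  "indep_vars (\<lambda>_. borel) excess_norm {1..}" "indep_vars (\<lambda>_. borel) cross_mean {1..}" "indep_vars (\<lambda>_. borel) zb {1..}"
  "indep_vars (\<lambda>_. borel) excess_cov {1..}" "indep_vars (\<lambda>_. borel) cross_cov {1..}" "indep_vars (\<lambda>_. borel) excess_sq {1..}"
  using indep_stats[of "\<lambda>i z s. (norm z)\<^sup>2 - trace s / (real n * dof)"]
    indep_stats[of "\<lambda>i z s. m i \<bullet> z"] indep_stats[of "\<lambda>i z s. z"]
    indep_stats[of "\<lambda>i z s. s /\<^sub>R dof - Sg i"]
    indep_stats[of "\<lambda>i z s. (s /\<^sub>R dof - Sg i) \<bullet> Sg i"]
    indep_stats[of "\<lambda>i z s. ((norm s)\<^sup>2 - (trace s)\<^sup>2 / dof) / ((dof + 2) * (dof - 1)) - (norm (Sg i))\<^sup>2"]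
  unfolding excess_norm_def[abs_def] cross_mean_def[abs_def] excess_cov_def[abs_def] cross_cov_def[abs_def] excess_sq_def[abs_def] by simp_all

lemma mean_deviations:
  assumes i: "i \<ge> 1"
  shows "expectation (excess_norm i) = 0" "expectation (cross_mean i) = 0" "expectation (\<lambda>\<omega>. zb i \<omega> \<bullet> v) = 0"
    "expectation (\<lambda>\<omega>. excess_cov i \<omega> \<bullet> V) = 0" "expectation (cross_cov i) = 0" "expectation (excess_sq i) = 0"
proof -
  interpret s: gaussian_sample M n "Sg i" "Z i" by (rule sample[OF i])
  have d: "dof > 1" "real n > 0" using n3 by simp_all
  show "expectation (excess_norm i) = 0" unfolding excess_norm_def
    using s.expectation_norm_zbar_sq s.expectation_trace_S d by simp
  show "expectation (cross_mean i) = 0" unfolding cross_mean_def by (rule s.expectation_inner_zbar)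
  show "expectation (\<lambda>\<omega>. zb i \<omega> \<bullet> v) = 0"
    using s.expectation_inner_zbar(2)[of v] by (simp add: inner_commute)
  show excess_cov: "expectation (\<lambda>\<omega>. excess_cov i \<omega> \<bullet> V) = 0" for V
  proof -
    have "excess_cov i \<omega> \<bullet> V = (\<Sum>a\<in>UNIV. \<Sum>b\<in>UNIV. SS i \<omega> $ a $ b * (V $ a $ b / dof)) - Sg i \<bullet> V" for \<omega>
      unfolding excess_cov_def inner_diff_left inner_scaleR_left inner_matrix[of "SS i \<omega>"]
      by (simp add: sum_distrib_left divide_inverse mult_ac)
    moreover have "expectation (\<lambda>\<omega>. (\<Sum>a\<in>UNIV. \<Sum>b\<in>UNIV. SS i \<omega> $ a $ b * (V $ a $ b / dof)) - Sg i \<bullet> V)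
        = (\<Sum>a\<in>UNIV. \<Sum>b\<in>UNIV. dof * Sg i $ a $ b * (V $ a $ b / dof)) - Sg i \<bullet> V"
      using s.expectation_S by (simp add: prob_space)
    moreover have "\<dots> = 0" using d by (simp add: inner_matrix)
    ultimately show ?thesis by simp
  qed
  show "expectation (cross_cov i) = 0" unfolding cross_cov_def by (rule excess_cov)
  show "expectation (excess_sq i) = 0"
  proof -
    have "expectation (excess_sq i) = ((dof\<^sup>2 + dof) * (norm (Sg i))\<^sup>2 + dof * (trace (Sg i))\<^sup>2
        - (dof\<^sup>2 * (trace (Sg i))\<^sup>2 + 2 * dof * (norm (Sg i))\<^sup>2) / dof) / ((dof + 2) * (dof - 1)) - (norm (Sg i))\<^sup>2"
      unfolding excess_sq_def using s.expectation_norm_S_sq s.expectation_trace_S_sq by (simp add: prob_space)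
    also have "\<dots> = 0"
    proof -
      define u where "u = dof"
      have u: "u > 1" using d by (simp add: u_def)
      have "(u\<^sup>2 + u) * x + u * y - (u\<^sup>2 * y + 2 * u * x) / u = (u + 2) * (u - 1) * x" for x y :: real
        using u by (simp add: field_simps power2_eq_square)
      then show ?thesis using u unfolding u_def[symmetric] by simp
    qed
    finally show ?thesis .
  qed
qed

definition T4_const :: real where "T4_const = 105 * real n * (real n * real CARD('k)) ^ 3"

text \<open>A common majorant of the squared deviations whose mean is controlled by \<open>trace (Sg i) ^ 4\<close>.\<close>
definition envelope :: "nat \<Rightarrow> 'a \<Rightarrow> real" where
  "envelope i \<omega> = 8 * (1 + TT i \<omega> ^ 4 + trace (Sg i) ^ 4)"

lemma bnd_nonneg: "bnd \<ge> 0"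
proof -
  have "0 \<le> (\<Sum>i=1..1. trace (Sg i) ^ 4)" by simp
  also have "\<dots> \<le> bnd" using trace_bound[of 1] by simp
  finally show ?thesis .
qed

lemma T4_const_nonneg: "T4_const \<ge> 0"
  by (simp add: T4_const_def)

definition avg_const :: real where "avg_const = 8 * (1 + (T4_const + 1) * bnd) + bnd"


lemma TT_pow4:
  assumes i: "i \<ge> 1"
  shows "integrable M (\<lambda>\<omega>. TT i \<omega> ^ 4)" "expectation (\<lambda>\<omega>. TT i \<omega> ^ 4) \<le> T4_const * trace (Sg i) ^ 4"
proof -
  interpret s: gaussian_sample M n "Sg i" "Z i" by (rule sample[OF i])
  show "integrable M (\<lambda>\<omega>. TT i \<omega> ^ 4)" "expectation (\<lambda>\<omega>. TT i \<omega> ^ 4) \<le> T4_const * trace (Sg i) ^ 4"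
    using s.expectation_T_pow4 by (simp_all add: T4_const_def)
qed

lemma envelope:
  assumes i: "i \<ge> 1"
  shows "integrable M (envelope i)" "expectation (envelope i) \<le> 8 * (1 + (T4_const + 1) * trace (Sg i) ^ 4)"
  unfolding envelope_def using TT_pow4[OF i] by (simp_all add: prob_space algebra_simps)

lemma sum_envelope:
  assumes p: "p \<ge> 1"
  shows "(\<Sum>i=1..p. expectation (envelope i)) \<le> avg_const * real p"
proof -
  have "(\<Sum>i=1..p. expectation (envelope i)) \<le> (\<Sum>i=1..p. 8 * (1 + (T4_const + 1) * trace (Sg i) ^ 4))"
    by (intro sum_mono envelope) simp
  also have "\<dots> = 8 * (real p + (T4_const + 1) * (\<Sum>i=1..p. trace (Sg i) ^ 4))"
    by (simp add: sum.distrib sum_distrib_left algebra_simps)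
  also have "\<dots> \<le> 8 * (real p + (T4_const + 1) * (bnd * real p))"
    using trace_bound[OF p] T4_const_nonneg by (intro mult_left_mono add_left_mono) auto
  also have "\<dots> \<le> avg_const * real p" using bnd_nonneg by (simp add: avg_const_def algebra_simps)
  finally show ?thesis .
qed

lemma envelope_bounds:
  assumes i: "i \<ge> 1"
  shows "(norm (excess_norm i \<omega>))\<^sup>2 \<le> envelope i \<omega>" "(norm (zb i \<omega>))\<^sup>2 \<le> envelope i \<omega>" "(norm (excess_cov i \<omega>))\<^sup>2 \<le> envelope i \<omega>"
    "(norm (cross_cov i \<omega>))\<^sup>2 \<le> envelope i \<omega>" "(norm (excess_sq i \<omega>))\<^sup>2 \<le> envelope i \<omega>"
proof -
  interpret s: gaussian_sample M n "Sg i" "Z i" by (rule sample[OF i])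
  define T where "T = TT i \<omega>"
  define t where "t = trace (Sg i)"
  have d: "dof \<ge> 2" "n \<ge> 1" using n3 by simp_all
  have T0: "T \<ge> 0" by (simp add: T_def sumsq_nonneg)
  have t0: "t \<ge> 0" using s.trace_Sg_pos by (simp add: t_def)
  have sq: "x\<^sup>2 \<le> 1 + x ^ 4" for x :: real
  proof -
    have "0 \<le> (x\<^sup>2 - 1)\<^sup>2" by simp
    then show ?thesis unfolding power2_diff by simp (smt (verit) zero_le_power2)
  qed
  have T1: "T \<le> 1 + T\<^sup>2" using zero_le_power2[of "T - 1"] T0 unfolding power2_diff by simp
  define A where "A = T ^ 4"
  define B where "B = t ^ 4"
  have A0: "A \<ge> 0" and B0: "B \<ge> 0" by (simp_all add: A_def B_def)
  have sqT: "T\<^sup>2 \<le> 1 + A" and sqt: "t\<^sup>2 \<le> 1 + B" using sq by (simp_all add: A_def B_def)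
  have e: "envelope i \<omega> = 8 + 8 * A + 8 * B" by (simp add: envelope_def T_def t_def A_def B_def)
  have zT: "(norm (zb i \<omega>))\<^sup>2 \<le> T" unfolding T_def by (rule norm_smean_le[OF d(2)])
  have trT: "trace (SS i \<omega>) \<le> T" and tr0: "trace (SS i \<omega>) \<ge> 0"
    unfolding T_def by (rule trace_scat_le[OF d(2)], rule trace_scat_nonneg)
  have nT: "norm (SS i \<omega>) \<le> T" unfolding T_def by (rule norm_scat_le[OF d(2)])
  have nt: "norm (Sg i) \<le> t" unfolding t_def by (rule s.norm_Sg_le)
  show "(norm (zb i \<omega>))\<^sup>2 \<le> envelope i \<omega>" unfolding e using order_trans[OF zT T1] sqT A0 B0 by linarith
  define r where "r = trace (SS i \<omega>) / (real n * dof)"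
  have "r \<le> trace (SS i \<omega>) / 1"
    unfolding r_def using d tr0 n3 mult_mono[of 1 "real n" 1 dof] by (intro divide_left_mono) auto
  moreover have "r \<ge> 0" unfolding r_def using d tr0 by (intro divide_nonneg_nonneg mult_nonneg_nonneg) auto
  ultimately have "\<bar>excess_norm i \<omega>\<bar> \<le> T"
    using zT trT zero_le_power2[of "norm (zb i \<omega>)"]
    unfolding excess_norm_def r_def[symmetric] abs_le_iff by linarith
  then have "(excess_norm i \<omega>)\<^sup>2 \<le> T\<^sup>2" using T0 by (metis abs_ge_zero power2_abs power_mono)
  then show "(norm (excess_norm i \<omega>))\<^sup>2 \<le> envelope i \<omega>" unfolding e using sqT A0 B0 by simp
  have "norm (SS i \<omega> /\<^sub>R dof) = norm (SS i \<omega>) / dof" using d by (simp add: divide_inverse mult.commute)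
  also have "\<dots> \<le> norm (SS i \<omega>) / 1" using d by (intro divide_left_mono) auto
  finally have "norm (SS i \<omega> /\<^sub>R dof) \<le> norm (SS i \<omega>) / 1" .
  then have n4: "norm (excess_cov i \<omega>) \<le> T + t"
    using norm_triangle_ineq4[of "SS i \<omega> /\<^sub>R dof" "Sg i"] nT nt unfolding excess_cov_def by simp
  have Tt: "(T + t)\<^sup>2 \<le> 2 * T\<^sup>2 + 2 * t\<^sup>2" using zero_le_power2[of "T - t"] unfolding power2_diff power2_sum by simp
  have "(norm (excess_cov i \<omega>))\<^sup>2 \<le> (T + t)\<^sup>2" using n4 by (intro power_mono) auto
  then show "(norm (excess_cov i \<omega>))\<^sup>2 \<le> envelope i \<omega>" unfolding e using Tt sqT sqt A0 B0 by linarith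
  have Tt4: "(T + t) ^ 4 \<le> 8 * (A + B)" unfolding A_def B_def
    using sum_pow4_le[of "\<lambda>b. if b then T else t" UNIV] by (simp add: UNIV_bool add.commute)
  have "norm (cross_cov i \<omega>) \<le> norm (excess_cov i \<omega>) * norm (Sg i)" unfolding cross_cov_def real_norm_def by (rule Cauchy_Schwarz_ineq2)
  also have "\<dots> \<le> (T + t) * (T + t)" using n4 nt T0 t0 by (intro mult_mono) auto
  finally have "(norm (cross_cov i \<omega>))\<^sup>2 \<le> ((T + t) * (T + t))\<^sup>2" by (intro power_mono) auto
  also have "\<dots> = (T + t) ^ 4" by (simp add: power4_eq_xxxx power2_eq_square)
  also have "\<dots> \<le> 8 * (A + B)" by (rule Tt4)
  also have "\<dots> \<le> envelope i \<omega>" by (simp add: e)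
  finally show "(norm (cross_cov i \<omega>))\<^sup>2 \<le> envelope i \<omega>" .
  define x where "x = ((norm (SS i \<omega>))\<^sup>2 - (trace (SS i \<omega>))\<^sup>2 / dof) / ((dof + 2) * (dof - 1))"
  have b1: "(norm (SS i \<omega>))\<^sup>2 \<le> T\<^sup>2" using nT by (intro power_mono) auto
  have b2: "(trace (SS i \<omega>))\<^sup>2 \<le> T\<^sup>2" using trT tr0 by (intro power_mono) auto
  have b3: "(trace (SS i \<omega>))\<^sup>2 / dof \<le> (trace (SS i \<omega>))\<^sup>2 / 1" using d by (intro divide_left_mono) auto
  have b4: "(trace (SS i \<omega>))\<^sup>2 / dof \<ge> 0" using d by simp
  have ab: "\<bar>(norm (SS i \<omega>))\<^sup>2 - (trace (SS i \<omega>))\<^sup>2 / dof\<bar> \<le> T\<^sup>2"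
    using b1 b2 b3 b4 zero_le_power2[of "norm (SS i \<omega>)"] unfolding abs_le_iff by linarith
  have "(dof + 2) * (dof - 1) \<ge> 1 * 1" using d by (intro mult_mono) auto
  then have "\<bar>x\<bar> \<le> \<bar>(norm (SS i \<omega>))\<^sup>2 - (trace (SS i \<omega>))\<^sup>2 / dof\<bar> / 1"
    unfolding x_def abs_divide by (intro divide_left_mono) auto
  with ab have "\<bar>x\<bar> \<le> T\<^sup>2" by simp
  moreover have "(norm (Sg i))\<^sup>2 \<le> t\<^sup>2" using nt by (intro power_mono) auto
  ultimately have "\<bar>excess_sq i \<omega>\<bar> \<le> T\<^sup>2 + t\<^sup>2" unfolding excess_sq_def x_def[symmetric]
    using abs_triangle_ineq4[of x "(norm (Sg i))\<^sup>2"] by simp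
  then have "(excess_sq i \<omega>)\<^sup>2 \<le> (T\<^sup>2 + t\<^sup>2)\<^sup>2" by (metis abs_ge_zero power2_abs power_mono)
  also have "\<dots> \<le> 2 * (A + B)" unfolding A_def B_def
    using zero_le_power2[of "T\<^sup>2 - t\<^sup>2"] unfolding power2_diff power2_sum by simp
  finally show "(norm (excess_sq i \<omega>))\<^sup>2 \<le> envelope i \<omega>" unfolding e using A0 B0 by simp
qed

lemma average_small:
  fixes D :: "nat \<Rightarrow> 'a \<Rightarrow> 'b::euclidean_space"
  assumes ind: "indep_vars (\<lambda>_. borel) D {1..}"
    and bound: "\<And>i \<omega>. i \<ge> 1 \<Longrightarrow> (norm (D i \<omega>))\<^sup>2 \<le> envelope i \<omega>"
    and mean: "\<And>i v. i \<ge> 1 \<Longrightarrow> expectation (\<lambda>\<omega>. D i \<omega> \<bullet> v) = 0"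
    and p: "p \<ge> 1"
  shows "integrable M (\<lambda>\<omega>. (norm (smean p (\<lambda>i. D i \<omega>)))\<^sup>2)"
    "expectation (\<lambda>\<omega>. (norm (smean p (\<lambda>i. D i \<omega>)))\<^sup>2) \<le> avg_const / real p"
proof -
  have meas: "i \<ge> 1 \<Longrightarrow> random_variable borel (D i)" for i
    using ind by (auto simp: indep_vars_def)
  have int: "integrable M (\<lambda>\<omega>. (norm (D i \<omega>))\<^sup>2)" if i: "i \<ge> 1" for i
  proof (rule Bochner_Integration.integrable_bound[OF envelope(1)[OF i]])
    show "AE \<omega> in M. norm ((norm (D i \<omega>))\<^sup>2) \<le> norm (envelope i \<omega>)"
      using bound[OF i] by (auto intro!: AE_I2 order_trans[OF _ abs_ge_self])
  qed (use meas[OF i] in measurable)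
  note a = expectation_norm_smean_sq[OF ind int mean]
  show "integrable M (\<lambda>\<omega>. (norm (smean p (\<lambda>i. D i \<omega>)))\<^sup>2)" by (rule a(1))
  have "(\<Sum>i=1..p. expectation (\<lambda>\<omega>. (norm (D i \<omega>))\<^sup>2)) \<le> (\<Sum>i=1..p. expectation (envelope i))"
    by (intro sum_mono integral_mono int envelope bound) auto
  also have "\<dots> \<le> avg_const * real p" by (rule sum_envelope[OF p])
  finally have "(\<Sum>i=1..p. expectation (\<lambda>\<omega>. (norm (D i \<omega>))\<^sup>2)) / (real p)\<^sup>2 \<le> avg_const * real p / (real p)\<^sup>2"
    by (intro divide_right_mono) auto
  then show "expectation (\<lambda>\<omega>. (norm (smean p (\<lambda>i. D i \<omega>)))\<^sup>2) \<le> avg_const / real p"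
    using a(2)[of p] p by (simp add: power2_eq_square)
qed

lemma average_deviations:
  assumes p: "p \<ge> 1"
  shows
    "integrable M (\<lambda>\<omega>. (norm (smean p (\<lambda>i. excess_norm i \<omega>)))\<^sup>2)" "expectation (\<lambda>\<omega>. (norm (smean p (\<lambda>i. excess_norm i \<omega>)))\<^sup>2) \<le> avg_const / real p"
    "integrable M (\<lambda>\<omega>. (norm (smean p (\<lambda>i. zb i \<omega>)))\<^sup>2)" "expectation (\<lambda>\<omega>. (norm (smean p (\<lambda>i. zb i \<omega>)))\<^sup>2) \<le> avg_const / real p"
    "integrable M (\<lambda>\<omega>. (norm (smean p (\<lambda>i. excess_cov i \<omega>)))\<^sup>2)" "expectation (\<lambda>\<omega>. (norm (smean p (\<lambda>i. excess_cov i \<omega>)))\<^sup>2) \<le> avg_const / real p"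
    "integrable M (\<lambda>\<omega>. (norm (smean p (\<lambda>i. cross_cov i \<omega>)))\<^sup>2)" "expectation (\<lambda>\<omega>. (norm (smean p (\<lambda>i. cross_cov i \<omega>)))\<^sup>2) \<le> avg_const / real p"
    "integrable M (\<lambda>\<omega>. (norm (smean p (\<lambda>i. excess_sq i \<omega>)))\<^sup>2)" "expectation (\<lambda>\<omega>. (norm (smean p (\<lambda>i. excess_sq i \<omega>)))\<^sup>2) \<le> avg_const / real p"
  using average_small[OF indep_deviations(1) envelope_bounds(1) _ p] average_small[OF indep_deviations(3) envelope_bounds(2) mean_deviations(3) p]
    average_small[OF indep_deviations(4) envelope_bounds(3) mean_deviations(4) p] average_small[OF indep_deviations(5) envelope_bounds(4) _ p]
    average_small[OF indep_deviations(6) envelope_bounds(5) _ p]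
  by (simp_all add: mean_deviations)

lemma average_cross_mean:
  assumes p: "p \<ge> 1"
  shows "integrable M (\<lambda>\<omega>. (norm (smean p (\<lambda>i. cross_mean i \<omega>)))\<^sup>2)"
    "expectation (\<lambda>\<omega>. (norm (smean p (\<lambda>i. cross_mean i \<omega>)))\<^sup>2) \<le> avg_const / real p"
proof -
  have int: "integrable M (\<lambda>\<omega>. (norm (cross_mean i \<omega>))\<^sup>2)"
    and e: "expectation (\<lambda>\<omega>. (norm (cross_mean i \<omega>))\<^sup>2) = m i \<bullet> (Sg i *v m i) / real n" if i: "i \<ge> 1" for i
  proof -
    interpret s: gaussian_sample M n "Sg i" "Z i" by (rule sample[OF i])
    show "integrable M (\<lambda>\<omega>. (norm (cross_mean i \<omega>))\<^sup>2)" "expectation (\<lambda>\<omega>. (norm (cross_mean i \<omega>))\<^sup>2) = m i \<bullet> (Sg i *v m i) / real n"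
      unfolding cross_mean_def using s.expectation_inner_zbar(3,4)[of "m i"] by simp_all
  qed
  have mean: "expectation (\<lambda>\<omega>. cross_mean i \<omega> \<bullet> v) = 0" if "i \<ge> 1" for i v using mean_deviations(2)[OF that] by simp
  note a = expectation_norm_smean_sq[OF indep_deviations(2) int mean]
  show "integrable M (\<lambda>\<omega>. (norm (smean p (\<lambda>i. cross_mean i \<omega>)))\<^sup>2)" by (rule a(1))
  have pos: "m i \<bullet> (Sg i *v m i) \<ge> 0" if "i \<ge> 1" for i
    using Sg[OF that] by (cases "m i = 0") (auto simp: spd_def less_imp_le)
  have "(\<Sum>i=1..p. expectation (\<lambda>\<omega>. (norm (cross_mean i \<omega>))\<^sup>2)) = (\<Sum>i=1..p. m i \<bullet> (Sg i *v m i) / real n)"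
    by (intro sum.cong refl e) simp
  also have "\<dots> \<le> (\<Sum>i=1..p. m i \<bullet> (Sg i *v m i) / 1)"
    using n3 pos by (intro sum_mono divide_left_mono) auto
  also have "\<dots> \<le> bnd * real p" using mean_var_bound[OF p] by simp
  also have "\<dots> \<le> avg_const * real p" using bnd_nonneg T4_const_nonneg by (intro mult_right_mono) (auto simp: avg_const_def)
  finally have "(\<Sum>i=1..p. expectation (\<lambda>\<omega>. (norm (cross_mean i \<omega>))\<^sup>2)) / (real p)\<^sup>2 \<le> avg_const * real p / (real p)\<^sup>2"
    by (intro divide_right_mono) auto
  then show "expectation (\<lambda>\<omega>. (norm (smean p (\<lambda>i. cross_mean i \<omega>)))\<^sup>2) \<le> avg_const / real p"
    using a(2)[of p] p by (simp add: power2_eq_square)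
qed

end

section \<open>The uniform approximation error\<close>

lemma norm_smean_le_average: "norm (smean p f) \<le> (\<Sum>i=1..p. norm (f i)) / real p"
  for f :: "nat \<Rightarrow> 'v::real_normed_vector"
proof -
  have "norm (smean p f) = norm (\<Sum>i=1..p. f i) / real p" by (simp add: smean_def divide_inverse mult.commute)
  also have "\<dots> \<le> (\<Sum>i=1..p. norm (f i)) / real p" by (intro divide_right_mono norm_sum) simp
  finally show ?thesis .
qed

context gaussian_populations
begin

lemma mean_max_nonneg: "p \<ge> 1 \<Longrightarrow> mean_max p \<ge> 0"
  using order_trans[OF norm_ge_zero mean_le[of 1 p]] by simp

lemma expectation_abs_le:
  assumes X[measurable]: "random_variable borel X" and i: "integrable M (\<lambda>\<omega>. (X \<omega>)\<^sup>2)"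
    and e: "expectation (\<lambda>\<omega>. (X \<omega>)\<^sup>2) \<le> avg_const / real p" and p: "p \<ge> 1"
  shows "integrable M (\<lambda>\<omega>. \<bar>X \<omega>\<bar>)" "expectation (\<lambda>\<omega>. \<bar>X \<omega>\<bar>) \<le> (1 + avg_const) / sqrt (real p)"
proof -
  show iX: "integrable M (\<lambda>\<omega>. \<bar>X \<omega>\<bar>)" using square_integrable_imp_integrable[OF X i] by simp
  define r where "r = sqrt (real p)"
  have r: "r > 0" "r * r = real p" using p by (simp_all add: r_def)
  have "\<bar>x\<bar> \<le> 1 / r + r * x\<^sup>2" for x
  proof -
    have "0 \<le> (r * \<bar>x\<bar> - 1)\<^sup>2" by simp
    then have "2 * r * \<bar>x\<bar> \<le> 1 + r * r * x\<^sup>2" unfolding power2_diff by (simp add: power2_eq_square algebra_simps)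
    then have "r * \<bar>x\<bar> \<le> 1 + r * r * x\<^sup>2" using r(1) mult_nonneg_nonneg[of r "\<bar>x\<bar>"] by linarith
    then show ?thesis using r(1) by (simp add: field_simps)
  qed
  then have "expectation (\<lambda>\<omega>. \<bar>X \<omega>\<bar>) \<le> expectation (\<lambda>\<omega>. 1 / r + r * (X \<omega>)\<^sup>2)"
    using i by (intro integral_mono iX) auto
  also have "\<dots> = 1 / r + r * expectation (\<lambda>\<omega>. (X \<omega>)\<^sup>2)" using i by (simp add: prob_space)
  also have "\<dots> \<le> 1 / r + r * (avg_const / real p)" using e r by (intro add_left_mono mult_left_mono) auto
  also have "r * (avg_const / real p) = avg_const / r" using r by (simp add: field_simps r(2)[symmetric])
  finally show "expectation (\<lambda>\<omega>. \<bar>X \<omega>\<bar>) \<le> (1 + avg_const) / sqrt (real p)"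
    by (simp add: r_def add_divide_distrib)
qed

definition sum_T4 :: "nat \<Rightarrow> 'a \<Rightarrow> real" where "sum_T4 p \<omega> = (\<Sum>i=1..p. TT i \<omega> ^ 4)"

text \<open>A substitute for the maximum of the sums of squares over the first \<open>p\<close> populations that is
  easier to integrate: the fourth root of the sum of fourth powers, of order \<open>p\<close> to the power
  \<open>1/4\<close>.\<close>
definition majorant :: "nat \<Rightarrow> 'a \<Rightarrow> real" where "majorant p \<omega> = sqrt (sqrt (sum_T4 p \<omega>))"

lemma sum_T4_nonneg: "sum_T4 p \<omega> \<ge> 0" by (simp add: sum_T4_def sum_nonneg)

lemma majorant_nonneg: "majorant p \<omega> \<ge> 0" by (simp add: majorant_def sum_T4_nonneg)

lemma TT_le_majorant: assumes "i \<in> {1..p}" shows "TT i \<omega> \<le> majorant p \<omega>"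
proof -
  have "TT i \<omega> ^ 4 \<le> sum_T4 p \<omega>" unfolding sum_T4_def using assms by (intro member_le_sum) auto
  then have "sqrt (sqrt (TT i \<omega> ^ 4)) \<le> majorant p \<omega>" unfolding majorant_def by simp
  moreover have "sqrt (sqrt (TT i \<omega> ^ 4)) = TT i \<omega>"
  proof -
    have "TT i \<omega> ^ 4 = ((TT i \<omega>)\<^sup>2)\<^sup>2" by simp
    then show ?thesis by (simp only: real_sqrt_abs) (simp add: sumsq_nonneg)
  qed
  ultimately show ?thesis by simp
qed

lemma norm_SS_le_majorant: "i \<in> {1..p} \<Longrightarrow> norm (SS i \<omega>) \<le> majorant p \<omega>"
  using norm_scat_le[of n "\<lambda>j. Z i j \<omega>"] TT_le_majorant[of i p \<omega>] n3 by simp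

lemma norm_mean_le_majorant: assumes i: "i \<in> {1..p}" shows "norm (m i + zb i \<omega>) \<le> mean_max p + 1 + majorant p \<omega>"
proof -
  have "norm (zb i \<omega>) \<le> 1 + (norm (zb i \<omega>))\<^sup>2"
    using zero_le_power2[of "norm (zb i \<omega>) - 1"] norm_ge_zero[of "zb i \<omega>"] unfolding power2_diff by (simp; linarith)
  also have "\<dots> \<le> 1 + majorant p \<omega>" using norm_smean_le[of n "\<lambda>j. Z i j \<omega>"] TT_le_majorant[OF i, of \<omega>] n3 by simp
  finally show ?thesis using norm_triangle_ineq[of "m i" "zb i \<omega>"] mean_le[OF i] by linarith
qed

lemma measurable_majorant [measurable]: "random_variable borel (sum_T4 p)" "random_variable borel (majorant p)"
proof -
  show q: "random_variable borel (sum_T4 p)" unfolding sum_T4_def by measurable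
  then show "random_variable borel (majorant p)" unfolding majorant_def by measurable
qed

lemma sum_T4_moment:
  assumes p: "p \<ge> 1"
  shows "integrable M (sum_T4 p)" "expectation (sum_T4 p) \<le> avg_const * real p"
proof -
  show "integrable M (sum_T4 p)" unfolding sum_T4_def by (intro Bochner_Integration.integrable_sum TT_pow4) auto
  have "expectation (sum_T4 p) = (\<Sum>i=1..p. expectation (\<lambda>\<omega>. TT i \<omega> ^ 4))"
    unfolding sum_T4_def by (intro Bochner_Integration.integral_sum TT_pow4) auto
  also have "\<dots> \<le> (\<Sum>i=1..p. T4_const * trace (Sg i) ^ 4)" by (intro sum_mono TT_pow4) auto
  also have "\<dots> \<le> T4_const * (bnd * real p)"
    unfolding sum_distrib_left[symmetric] using trace_bound[OF p] T4_const_nonneg by (intro mult_left_mono) auto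
  also have "\<dots> \<le> avg_const * real p"
  proof -
    have "T4_const * bnd \<le> avg_const" using T4_const_nonneg bnd_nonneg mult_nonneg_nonneg[of T4_const bnd] by (simp add: avg_const_def algebra_simps)
    then have "T4_const * bnd * real p \<le> avg_const * real p" by (rule mult_right_mono) simp
    then show ?thesis by (simp add: mult_ac)
  qed
  finally show "expectation (sum_T4 p) \<le> avg_const * real p" .
qed

text \<open>The majorant is of order \<open>s = p powr (1/4)\<close> and \<open>X\<close> of order \<open>s powr (-2)\<close>; two weighted
  inequalities between arithmetic and geometric mean give the order \<open>1 / s\<close> for the product.\<close>
lemma expectation_majorant_mult_le:
  assumes X[measurable]: "random_variable borel X" and i: "integrable M (\<lambda>\<omega>. (X \<omega>)\<^sup>2)"
    and e: "expectation (\<lambda>\<omega>. (X \<omega>)\<^sup>2) \<le> avg_const / real p" and p: "p \<ge> 1" and X0: "\<And>\<omega>. X \<omega> \<ge> 0"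
  shows "integrable M (\<lambda>\<omega>. majorant p \<omega> * X \<omega>)"
    "expectation (\<lambda>\<omega>. majorant p \<omega> * X \<omega>) \<le> (1 + 2 * avg_const) / sqrt (sqrt (real p))"
proof -
  define s where "s = sqrt (sqrt (real p))"
  have s: "s > 0" using p by (simp add: s_def)
  have s2: "s\<^sup>2 = sqrt (real p)" by (simp add: s_def)
  have s4: "s ^ 4 = real p"
  proof -
    have "s ^ 4 = (s\<^sup>2)\<^sup>2" by simp
    then show ?thesis by (simp only: s2) simp
  qed
  have le: "majorant p \<omega> * X \<omega> \<le> (s\<^sup>2 + sum_T4 p \<omega> / s\<^sup>2) / s ^ 3 + s ^ 3 * (X \<omega>)\<^sup>2" for \<omega>
  proof -
    define y where "y = majorant p \<omega>"
    define x where "x = X \<omega>"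
    have "0 \<le> (y - s ^ 3 * x)\<^sup>2" by simp
    then have "2 * (y * (s ^ 3 * x)) \<le> y\<^sup>2 + (s ^ 3 * x)\<^sup>2" unfolding power2_diff by simp
    moreover have "0 \<le> y * (s ^ 3 * x)" using s majorant_nonneg X0 by (simp add: y_def x_def)
    ultimately have "y * (s ^ 3 * x) \<le> y\<^sup>2 + (s ^ 3 * x)\<^sup>2" by linarith
    then have "y * x * s ^ 3 \<le> y\<^sup>2 + s ^ 3 * x\<^sup>2 * s ^ 3" by (simp add: power_mult_distrib power2_eq_square mult_ac)
    then have 1: "y * x \<le> y\<^sup>2 / s ^ 3 + s ^ 3 * x\<^sup>2" using s by (simp add: field_simps)
    have "y\<^sup>2 = sqrt (sum_T4 p \<omega>)" by (simp add: y_def majorant_def sum_T4_nonneg)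
    then have "y\<^sup>2 * y\<^sup>2 = sum_T4 p \<omega>" by (simp add: sum_T4_nonneg)
    moreover have "0 \<le> (y\<^sup>2 - s\<^sup>2)\<^sup>2" by simp
    ultimately have "2 * (y\<^sup>2 * s\<^sup>2) \<le> sum_T4 p \<omega> + s\<^sup>2 * s\<^sup>2" unfolding power2_diff by (simp add: power2_eq_square)
    moreover have "0 \<le> y\<^sup>2 * s\<^sup>2" by simp
    ultimately have "y\<^sup>2 * s\<^sup>2 \<le> sum_T4 p \<omega> + s\<^sup>2 * s\<^sup>2" by linarith
    then have "y\<^sup>2 \<le> s\<^sup>2 + sum_T4 p \<omega> / s\<^sup>2" using s by (simp add: field_simps)
    then have "y\<^sup>2 / s ^ 3 \<le> (s\<^sup>2 + sum_T4 p \<omega> / s\<^sup>2) / s ^ 3" using s by (intro divide_right_mono) auto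
    with 1 show ?thesis by (simp add: y_def x_def)
  qed
  have int: "integrable M (\<lambda>\<omega>. (s\<^sup>2 + sum_T4 p \<omega> / s\<^sup>2) / s ^ 3 + s ^ 3 * (X \<omega>)\<^sup>2)"
    using sum_T4_moment[OF p] i by simp
  show iYX: "integrable M (\<lambda>\<omega>. majorant p \<omega> * X \<omega>)"
  proof (rule Bochner_Integration.integrable_bound[OF int])
    show "AE \<omega> in M. norm (majorant p \<omega> * X \<omega>) \<le> norm ((s\<^sup>2 + sum_T4 p \<omega> / s\<^sup>2) / s ^ 3 + s ^ 3 * (X \<omega>)\<^sup>2)"
    proof (rule AE_I2)
      fix \<omega>
      have "norm (majorant p \<omega> * X \<omega>) = majorant p \<omega> * X \<omega>" using majorant_nonneg X0 by simp
      then show "norm (majorant p \<omega> * X \<omega>) \<le> norm ((s\<^sup>2 + sum_T4 p \<omega> / s\<^sup>2) / s ^ 3 + s ^ 3 * (X \<omega>)\<^sup>2)"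
        using le[of \<omega>] by (metis abs_ge_self order_trans real_norm_def)
    qed
  qed measurable
  have "expectation (\<lambda>\<omega>. majorant p \<omega> * X \<omega>) \<le> expectation (\<lambda>\<omega>. (s\<^sup>2 + sum_T4 p \<omega> / s\<^sup>2) / s ^ 3 + s ^ 3 * (X \<omega>)\<^sup>2)"
    by (intro integral_mono iYX int le)
  also have "\<dots> = (s\<^sup>2 + expectation (sum_T4 p) / s\<^sup>2) / s ^ 3 + s ^ 3 * expectation (\<lambda>\<omega>. (X \<omega>)\<^sup>2)"
    using sum_T4_moment[OF p] i by (simp add: prob_space)
  also have "\<dots> \<le> (s\<^sup>2 + (avg_const * s ^ 4) / s\<^sup>2) / s ^ 3 + s ^ 3 * (avg_const / s ^ 4)"
    using sum_T4_moment[OF p] e s unfolding s4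
    by (intro add_mono divide_right_mono mult_left_mono add_left_mono) auto
  also have "\<dots> = (1 + 2 * avg_const) / s" using s by (simp add: field_simps power_numeral_reduce)
  finally show "expectation (\<lambda>\<omega>. majorant p \<omega> * X \<omega>) \<le> (1 + 2 * avg_const) / sqrt (sqrt (real p))"
    by (simp add: s_def)
qed

text \<open>Bounds the distance between loss and risk estimate for all parameters in a ball that contains
  the data-dependent constraint set and, through \<open>c\<close>, a fixed competitor.\<close>
definition approx_error :: "real \<Rightarrow> nat \<Rightarrow> 'a \<Rightarrow> real" where
  "approx_error c p \<omega> = \<bar>smean p (\<lambda>i. excess_norm i \<omega>)\<bar> + 2 * \<bar>smean p (\<lambda>i. cross_mean i \<omega>)\<bar> + \<bar>smean p (\<lambda>i. excess_sq i \<omega>)\<bar>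
     + 2 * \<bar>smean p (\<lambda>i. cross_cov i \<omega>)\<bar>
     + 2 * ((mean_max p + 1 + c + majorant p \<omega>) * (norm (smean p (\<lambda>i. zb i \<omega>)) + norm (smean p (\<lambda>i. excess_cov i \<omega>))))"

lemma measurable_average:
  fixes D :: "nat \<Rightarrow> 'a \<Rightarrow> 'b::euclidean_space"
  assumes "indep_vars (\<lambda>_. borel) D {1..}"
  shows "random_variable borel (\<lambda>\<omega>. smean p (\<lambda>i. D i \<omega>))"
proof -
  have "i \<ge> 1 \<Longrightarrow> random_variable borel (D i)" for i using assms by (auto simp: indep_vars_def)
  then show ?thesis unfolding smean_def
    by (intro borel_measurable_scaleR borel_measurable_const borel_measurable_sum) auto
qed

text \<open>Each average contributes its mean absolute value, of order \<open>1 / sqrt p\<close>, times a deterministic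
  coefficient, and the majorant is handled by its own product estimate.\<close>
lemma approx_error_moment:
  assumes p: "p \<ge> 1" and c: "c \<ge> 0"
  shows "integrable M (approx_error c p)"
    "expectation (approx_error c p) \<le> 6 * ((1 + avg_const) / sqrt (real p)) + 4 * (mean_max p + 1 + c) * ((1 + avg_const) / sqrt (real p))
      + 4 * ((1 + 2 * avg_const) / sqrt (sqrt (real p)))"
proof -
  define h where "h = (1 + avg_const) / sqrt (real p)"
  define g where "g = (1 + 2 * avg_const) / sqrt (sqrt (real p))"
  define a where "a = mean_max p + 1 + c"
  have a0: "a \<ge> 0" using mean_max_nonneg[OF p] c unfolding a_def by simp
  note me = indep_deviations[THEN measurable_average, of p]
  note [measurable] = me
  have b: "integrable M (\<lambda>\<omega>. \<bar>smean p (\<lambda>i. excess_norm i \<omega>)\<bar>)" "expectation (\<lambda>\<omega>. \<bar>smean p (\<lambda>i. excess_norm i \<omega>)\<bar>) \<le> h"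
    "integrable M (\<lambda>\<omega>. \<bar>smean p (\<lambda>i. cross_mean i \<omega>)\<bar>)" "expectation (\<lambda>\<omega>. \<bar>smean p (\<lambda>i. cross_mean i \<omega>)\<bar>) \<le> h"
    "integrable M (\<lambda>\<omega>. \<bar>smean p (\<lambda>i. cross_cov i \<omega>)\<bar>)" "expectation (\<lambda>\<omega>. \<bar>smean p (\<lambda>i. cross_cov i \<omega>)\<bar>) \<le> h"
    "integrable M (\<lambda>\<omega>. \<bar>smean p (\<lambda>i. excess_sq i \<omega>)\<bar>)" "expectation (\<lambda>\<omega>. \<bar>smean p (\<lambda>i. excess_sq i \<omega>)\<bar>) \<le> h"
    unfolding h_def
    using expectation_abs_le[OF me(1) _ _ p] expectation_abs_le[OF me(2) _ _ p]
      expectation_abs_le[OF me(5) _ _ p] expectation_abs_le[OF me(6) _ _ p]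
      average_deviations[OF p] average_cross_mean[OF p] by simp_all
  have nm: "random_variable borel (\<lambda>\<omega>. norm (smean p (\<lambda>i. zb i \<omega>)))" "random_variable borel (\<lambda>\<omega>. norm (smean p (\<lambda>i. excess_cov i \<omega>)))"
    by measurable
  have n: "integrable M (\<lambda>\<omega>. norm (smean p (\<lambda>i. zb i \<omega>)))" "expectation (\<lambda>\<omega>. norm (smean p (\<lambda>i. zb i \<omega>))) \<le> h"
    "integrable M (\<lambda>\<omega>. norm (smean p (\<lambda>i. excess_cov i \<omega>)))" "expectation (\<lambda>\<omega>. norm (smean p (\<lambda>i. excess_cov i \<omega>))) \<le> h"
    unfolding h_def
    using expectation_abs_le[OF nm(1) _ _ p] expectation_abs_le[OF nm(2) _ _ p] average_deviations[OF p] by simp_all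
  have yn: "integrable M (\<lambda>\<omega>. majorant p \<omega> * norm (smean p (\<lambda>i. zb i \<omega>)))" "expectation (\<lambda>\<omega>. majorant p \<omega> * norm (smean p (\<lambda>i. zb i \<omega>))) \<le> g"
    "integrable M (\<lambda>\<omega>. majorant p \<omega> * norm (smean p (\<lambda>i. excess_cov i \<omega>)))" "expectation (\<lambda>\<omega>. majorant p \<omega> * norm (smean p (\<lambda>i. excess_cov i \<omega>))) \<le> g"
    unfolding g_def
    using expectation_majorant_mult_le[OF nm(1) _ _ p] expectation_majorant_mult_le[OF nm(2) _ _ p] average_deviations[OF p] by simp_all
  have e: "approx_error c p = (\<lambda>\<omega>. \<bar>smean p (\<lambda>i. excess_norm i \<omega>)\<bar> + 2 * \<bar>smean p (\<lambda>i. cross_mean i \<omega>)\<bar> + \<bar>smean p (\<lambda>i. excess_sq i \<omega>)\<bar>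
     + 2 * \<bar>smean p (\<lambda>i. cross_cov i \<omega>)\<bar>
     + (2 * a * norm (smean p (\<lambda>i. zb i \<omega>)) + 2 * a * norm (smean p (\<lambda>i. excess_cov i \<omega>))
       + 2 * (majorant p \<omega> * norm (smean p (\<lambda>i. zb i \<omega>))) + 2 * (majorant p \<omega> * norm (smean p (\<lambda>i. excess_cov i \<omega>)))))"
    by (rule ext) (simp add: approx_error_def a_def algebra_simps)
  show "integrable M (approx_error c p)" unfolding e
    by (intro Bochner_Integration.integrable_add integrable_mult_right b n yn)
  have "expectation (approx_error c p) = expectation (\<lambda>\<omega>. \<bar>smean p (\<lambda>i. excess_norm i \<omega>)\<bar>) + 2 * expectation (\<lambda>\<omega>. \<bar>smean p (\<lambda>i. cross_mean i \<omega>)\<bar>)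
     + expectation (\<lambda>\<omega>. \<bar>smean p (\<lambda>i. excess_sq i \<omega>)\<bar>) + 2 * expectation (\<lambda>\<omega>. \<bar>smean p (\<lambda>i. cross_cov i \<omega>)\<bar>)
     + (2 * a * expectation (\<lambda>\<omega>. norm (smean p (\<lambda>i. zb i \<omega>))) + 2 * a * expectation (\<lambda>\<omega>. norm (smean p (\<lambda>i. excess_cov i \<omega>)))
       + 2 * expectation (\<lambda>\<omega>. majorant p \<omega> * norm (smean p (\<lambda>i. zb i \<omega>))) + 2 * expectation (\<lambda>\<omega>. majorant p \<omega> * norm (smean p (\<lambda>i. excess_cov i \<omega>))))"
    unfolding e using b(1,3,5,7) n(1,3) yn(1,3) by simp
  also have "\<dots> \<le> h + 2 * h + h + 2 * h + (2 * a * h + 2 * a * h + 2 * g + 2 * g)"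
    using b(2,4,6,8) n(2,4) yn(2,4) a0 by (intro add_mono mult_left_mono) auto
  also have "\<dots> = 6 * h + 4 * a * h + 4 * g" by simp
  finally show "expectation (approx_error c p) \<le> 6 * ((1 + avg_const) / sqrt (real p)) + 4 * (mean_max p + 1 + c) * ((1 + avg_const) / sqrt (real p))
      + 4 * ((1 + 2 * avg_const) / sqrt (sqrt (real p)))" by (simp add: h_def g_def a_def)
qed

lemma approx_error_nonneg: assumes "p \<ge> 1" "c \<ge> 0" shows "approx_error c p \<omega> \<ge> 0"
proof -
  have "mean_max p \<ge> 0" using mean_max_nonneg assms(1) by simp
  then show ?thesis unfolding approx_error_def using majorant_nonneg assms(2)
    by (intro add_nonneg_nonneg mult_nonneg_nonneg) auto
qed

lemma approx_error_tendsto_zero: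
  assumes c: "c \<ge> 0"
  shows "(\<lambda>p. expectation (approx_error c p)) \<longlonglongrightarrow> 0"
proof (rule tendsto_sandwich)
  let ?B = "\<lambda>p. 6 * ((1 + avg_const) / sqrt (real p)) + 4 * (mean_max p + 1 + c) * ((1 + avg_const) / sqrt (real p))
      + 4 * ((1 + 2 * avg_const) / sqrt (sqrt (real p)))"
  show "eventually (\<lambda>p. 0 \<le> expectation (approx_error c p)) sequentially"
    using eventually_ge_at_top[of 1]
    by eventually_elim (intro Bochner_Integration.integral_nonneg approx_error_nonneg c)
  show "eventually (\<lambda>p. expectation (approx_error c p) \<le> ?B p) sequentially"
    using eventually_ge_at_top[of 1]
    by eventually_elim (intro approx_error_moment c)
  have "(\<lambda>p. (6 * (1 + avg_const) + 4 * (1 + c) * (1 + avg_const)) / sqrt (real p) + 4 * (1 + avg_const) * (mean_max p / sqrt (real p))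
      + 4 * (1 + 2 * avg_const) / sqrt (sqrt (real p))) \<longlonglongrightarrow> 0 + 4 * (1 + avg_const) * 0 + 0"
    by (intro tendsto_add tendsto_mult tendsto_const mean_max_lim; real_asymp)
  then show "?B \<longlonglongrightarrow> 0"
    by (simp add: add_divide_distrib algebra_simps)
qed simp

section \<open>Escape of the constraint radius\<close>

lemma small_scatter_event: "{\<omega> \<in> space M. \<forall>i\<in>{1..p}. norm (SS i \<omega>) < R} \<in> events"
proof -
  have "{\<omega> \<in> space M. norm (SS i \<omega>) < R} \<in> events" if "i \<ge> 1" for i using that by measurable
  then show ?thesis by (intro sets.sets_Collect_finite_All) auto
qed

text \<open>Independence turns the uniform upper bound \<open>1 - eta\<close> for one population into a geometrically
  decreasing bound for many.\<close>
lemma prob_small_scatter_tendsto_zero: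
  assumes R: "R \<ge> 0" and e: "e > 0" and inf: "infinite {i. i \<ge> 1 \<and> e \<le> trace (Sg i)}"
  shows "(\<lambda>p. prob {\<omega> \<in> space M. \<forall>i\<in>{1..p}. norm (SS i \<omega>) < R}) \<longlonglongrightarrow> 0"
proof (rule LIMSEQ_I)
  fix d :: real assume d: "0 < d"
  define y where "y = 2 + 2 * (sqrt (2 * R) / sqrt (e / real CARD('k)))"
  define eta where "eta = exp (- y\<^sup>2) / 4"
  have "exp (- y\<^sup>2) \<le> 1" by simp
  then have "eta \<le> 1" unfolding eta_def by linarith
  then have eta: "0 < eta" "eta \<le> 1" by (auto simp: eta_def)
  obtain k where k: "(1 - eta) ^ k < d" using real_arch_pow_inv[OF d, of "1 - eta"] eta by auto
  obtain J where J: "J \<subseteq> {i. i \<ge> 1 \<and> e \<le> trace (Sg i)}" "card J = Suc k" "finite J"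
    using infinite_arbitrarily_large[OF inf] by metis
  have "prob {\<omega> \<in> space M. \<forall>i\<in>{1..p}. norm (SS i \<omega>) < R} < d" if p: "p \<ge> Max J" for p
  proof -
    have iv: "indep_vars (\<lambda>_. borel) (\<lambda>i \<omega>. SS i \<omega>) {1..}"
      by (rule indep_stats[of "\<lambda>i z s. s"]) simp
    have Jne: "J \<noteq> {}" using J by auto
    have Jp: "J \<subseteq> {1..p}"
    proof
      fix i assume "i \<in> J"
      then show "i \<in> {1..p}" using Max_ge[OF J(3), of i] J(1) p by auto
    qed
    have "prob {\<omega> \<in> space M. \<forall>i\<in>{1..p}. norm (SS i \<omega>) < R}
      \<le> prob (\<Inter>i\<in>J. SS i -` {x. norm x < R} \<inter> space M)"
    proof (rule finite_measure_mono)
      show "(\<Inter>i\<in>J. SS i -` {x. norm x < R} \<inter> space M) \<in> events"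
        using Jne J(3) Jp by (intro sets.finite_INT measurable_sets[OF measurable_stats(2)]) auto
    qed (use Jp Jne in auto)
    also have "\<dots> = (\<Prod>i\<in>J. prob (SS i -` {x. norm x < R} \<inter> space M))"
      using Jp by (intro indep_varsD[OF iv Jne J(3)]) auto
    also have "\<dots> \<le> (\<Prod>i\<in>J. 1 - eta)"
    proof (intro prod_mono conjI measure_nonneg)
      fix i assume "i \<in> J"
      then have i: "i \<ge> 1" "e \<le> trace (Sg i)" using J by auto
      interpret s: gaussian_sample M n "Sg i" "Z i" by (rule sample[OF i(1)])
      have "SS i -` {x. norm x < R} \<inter> space M = {\<omega> \<in> space M. norm (SS i \<omega>) < R}" by auto
      then show "prob (SS i -` {x. norm x < R} \<inter> space M) \<le> 1 - eta"
        using s.prob_norm_S_less[OF e i(2) R] by (simp add: eta_def y_def)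
    qed
    also have "\<dots> = (1 - eta) ^ Suc k" using J by simp
    also have "\<dots> \<le> (1 - eta) ^ k" using eta by (intro power_decreasing) auto
    finally show ?thesis using k by linarith
  qed
  then show "\<exists>no. \<forall>p\<ge>no. norm (prob {\<omega> \<in> space M. \<forall>i\<in>{1..p}. norm (SS i \<omega>) < R} - 0) < d"
    by (intro exI[of _ "Max J"]) simp
qed

text \<open>What radial projection of a matrix of norm \<open>R\<close> onto the constraint set can cost: the mean
  scatter on the event that the radius of the constraint set is below \<open>R\<close>.\<close>
definition escape_term :: "real \<Rightarrow> nat \<Rightarrow> 'a \<Rightarrow> real" where
  "escape_term R p \<omega> = indicat_real {\<omega> \<in> space M. \<forall>i\<in>{1..p}. norm (SS i \<omega>) < R} \<omega> * norm (smean p (\<lambda>i. SS i \<omega>))"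

lemma norm_smean_SS_le: "norm (smean p (\<lambda>i. SS i \<omega>)) \<le> (\<Sum>i=1..p. trace (SS i \<omega>)) / real p"
proof -
  have "norm (smean p (\<lambda>i. SS i \<omega>)) \<le> (\<Sum>i=1..p. norm (SS i \<omega>)) / real p"
    by (rule norm_smean_le_average)
  also have "\<dots> \<le> (\<Sum>i=1..p. trace (SS i \<omega>)) / real p"
    by (intro divide_right_mono sum_mono norm_scat_le_trace) simp
  finally show ?thesis .
qed

lemma escape_term_nonneg: "escape_term R p \<omega> \<ge> 0" by (simp add: escape_term_def)

lemma escape_term_integrable:
  assumes p: "p \<ge> 1" shows "integrable M (escape_term R p)"
    "integrable M (\<lambda>\<omega>. (\<Sum>i=1..p. trace (SS i \<omega>)) / real p)"
    "expectation (\<lambda>\<omega>. (\<Sum>i=1..p. trace (SS i \<omega>)) / real p) = dof * ((\<Sum>i=1..p. trace (Sg i)) / real p)"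
proof -
  have t: "integrable M (\<lambda>\<omega>. trace (SS i \<omega>))" "expectation (\<lambda>\<omega>. trace (SS i \<omega>)) = dof * trace (Sg i)" if "i \<ge> 1" for i
  proof -
    interpret s: gaussian_sample M n "Sg i" "Z i" by (rule sample[OF that])
    show "integrable M (\<lambda>\<omega>. trace (SS i \<omega>))" "expectation (\<lambda>\<omega>. trace (SS i \<omega>)) = dof * trace (Sg i)"
      by (rule s.expectation_trace_S)+
  qed
  show i: "integrable M (\<lambda>\<omega>. (\<Sum>i=1..p. trace (SS i \<omega>)) / real p)"
    by (intro integrable_divide Bochner_Integration.integrable_sum t) auto
  have "expectation (\<lambda>\<omega>. \<Sum>i=1..p. trace (SS i \<omega>)) = (\<Sum>i=1..p. dof * trace (Sg i))"
    using t by (subst Bochner_Integration.integral_sum) auto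
  then show "expectation (\<lambda>\<omega>. (\<Sum>i=1..p. trace (SS i \<omega>)) / real p) = dof * ((\<Sum>i=1..p. trace (Sg i)) / real p)"
    by (simp add: sum_distrib_left)
  show "integrable M (escape_term R p)"
  proof (rule Bochner_Integration.integrable_bound[OF i])
    have "indep_vars (\<lambda>_. borel) (\<lambda>i \<omega>. SS i \<omega>) {1..}"
      by (rule indep_stats[of "\<lambda>i z s. s"]) simp
    from measurable_average[OF this, of p] show "random_variable borel (escape_term R p)"
      unfolding escape_term_def using small_scatter_event by measurable
    show "AE \<omega> in M. norm (escape_term R p \<omega>) \<le> norm ((\<Sum>i=1..p. trace (SS i \<omega>)) / real p)"
    proof (rule AE_I2)
      fix \<omega>
      have "norm (escape_term R p \<omega>) \<le> norm (smean p (\<lambda>i. SS i \<omega>))" by (simp add: escape_term_def indicator_def)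
      also have "\<dots> \<le> (\<Sum>i=1..p. trace (SS i \<omega>)) / real p" by (rule norm_smean_SS_le)
      also have "\<dots> \<le> norm ((\<Sum>i=1..p. trace (SS i \<omega>)) / real p)" unfolding real_norm_def by (rule abs_ge_self)
      finally show "norm (escape_term R p \<omega>) \<le> norm ((\<Sum>i=1..p. trace (SS i \<omega>)) / real p)" .
    qed
  qed
qed

text \<open>Either the variances tend to zero, and then so does the mean scatter, or infinitely many
  populations have variances bounded below, and then the scatter matrices are unbounded.\<close>

lemma escape_term_tendsto_zero:
  assumes R: "R \<ge> 0"
  shows "(\<lambda>p. expectation (escape_term R p)) \<longlonglongrightarrow> 0"
proof (cases "\<exists>e>0. infinite {i. i \<ge> 1 \<and> e \<le> trace (Sg i)}")
  case True
  then obtain e where e: "e > 0" "infinite {i. i \<ge> 1 \<and> e \<le> trace (Sg i)}" by blast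
  have le: "escape_term R p \<omega> \<le> R * indicat_real {\<omega> \<in> space M. \<forall>i\<in>{1..p}. norm (SS i \<omega>) < R} \<omega>" if p: "p \<ge> 1" for p \<omega>
  proof (cases "\<omega> \<in> {\<omega> \<in> space M. \<forall>i\<in>{1..p}. norm (SS i \<omega>) < R}")
    case True
    have "norm (smean p (\<lambda>i. SS i \<omega>)) \<le> (\<Sum>i=1..p. norm (SS i \<omega>)) / real p"
      by (rule norm_smean_le_average)
    also have "\<dots> \<le> (\<Sum>i=1..p. R) / real p"
      using True by (intro divide_right_mono sum_mono) (auto simp: less_imp_le)
    also have "\<dots> = R" using p by simp
    finally show ?thesis using True by (simp add: escape_term_def)
  next
    case False
    then show ?thesis by (simp add: escape_term_def)
  qed
  show ?thesis
  proof (rule tendsto_sandwich)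
    show "eventually (\<lambda>p. 0 \<le> expectation (escape_term R p)) sequentially"
      by (intro always_eventually allI Bochner_Integration.integral_nonneg escape_term_nonneg)
    show "eventually (\<lambda>p. expectation (escape_term R p) \<le> R * prob {\<omega> \<in> space M. \<forall>i\<in>{1..p}. norm (SS i \<omega>) < R}) sequentially"
      using eventually_ge_at_top[of 1]
    proof eventually_elim
      case (elim p)
      have ii: "integrable M (indicat_real {\<omega> \<in> space M. \<forall>i\<in>{1..p}. norm (SS i \<omega>) < R})"
        by (intro integrable_real_indicator small_scatter_event) (simp add: emeasure_eq_measure)
      have "expectation (escape_term R p) \<le> expectation (\<lambda>\<omega>. R * indicat_real {\<omega> \<in> space M. \<forall>i\<in>{1..p}. norm (SS i \<omega>) < R} \<omega>)"
        by (intro integral_mono escape_term_integrable elim integrable_mult_right ii le)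
      also have "\<dots> = R * prob {\<omega> \<in> space M. \<forall>i\<in>{1..p}. norm (SS i \<omega>) < R}"
        by (simp add: Int_absorb2 Collect_restrict)
      finally show ?case .
    qed
    show "(\<lambda>p. R * prob {\<omega> \<in> space M. \<forall>i\<in>{1..p}. norm (SS i \<omega>) < R}) \<longlonglongrightarrow> 0"
      using tendsto_mult_right_zero[OF prob_small_scatter_tendsto_zero[OF R e], of R] by simp
  qed simp
next
  case False
  have tr: "(\<lambda>i. trace (Sg i)) \<longlonglongrightarrow> 0"
  proof (rule LIMSEQ_I)
    fix r :: real assume r: "0 < r"
    then have "finite {i. i \<ge> 1 \<and> r \<le> trace (Sg i)}" using False by blast
    then obtain N where N: "\<forall>i\<in>{i. i \<ge> 1 \<and> r \<le> trace (Sg i)}. i < N" using finite_nat_set_iff_bounded by blast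
    have "norm (trace (Sg i) - 0) < r" if i: "i \<ge> max N 1" for i
    proof -
      have i1: "i \<ge> 1" using i by simp
      interpret s: gaussian_sample M n "Sg i" "Z i" by (rule sample[OF i1])
      have "\<not> r \<le> trace (Sg i)" using N i by fastforce
      then show ?thesis using s.trace_Sg_pos by simp
    qed
    then show "\<exists>no. \<forall>i\<ge>no. norm (trace (Sg i) - 0) < r" by blast
  qed
  show ?thesis
  proof (rule tendsto_sandwich)
    show "eventually (\<lambda>p. 0 \<le> expectation (escape_term R p)) sequentially"
      by (intro always_eventually allI Bochner_Integration.integral_nonneg escape_term_nonneg)
    show "eventually (\<lambda>p. expectation (escape_term R p) \<le> dof * ((\<Sum>i=1..p. trace (Sg i)) / real p)) sequentially"
      using eventually_ge_at_top[of 1]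
    proof eventually_elim
      case (elim p)
      have "expectation (escape_term R p) \<le> expectation (\<lambda>\<omega>. (\<Sum>i=1..p. trace (SS i \<omega>)) / real p)"
      proof (intro integral_mono escape_term_integrable elim)
        fix \<omega>
        have "escape_term R p \<omega> \<le> norm (smean p (\<lambda>i. SS i \<omega>))" by (simp add: escape_term_def indicator_def)
        then show "escape_term R p \<omega> \<le> (\<Sum>i=1..p. trace (SS i \<omega>)) / real p" using norm_smean_SS_le[of p \<omega>] by linarith
      qed
      then show ?case by (simp only: escape_term_integrable(3)[OF elim])
    qed
    show "(\<lambda>p. dof * ((\<Sum>i=1..p. trace (Sg i)) / real p)) \<longlonglongrightarrow> 0"
      using tendsto_mult_right_zero[OF cesaro_tendsto_zero[OF tr], of dof] by simp
  qed simp
qed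

end

section \<open>Loss and risk estimate in coordinates\<close>

text \<open>Contributions of one population to the loss and to the risk estimate.  The sample enters through
  its mean \<open>y\<close> and scatter \<open>S\<close> in logarithmic coordinates, \<open>u\<close> stands for the coordinates of
  \<open>mu\<close> and \<open>g\<close> for \<open>nu - q - 1\<close>.\<close>
definition pop_loss :: "nat \<Rightarrow> real^'k \<Rightarrow> 'k::finite sqmat \<Rightarrow> real^'k \<Rightarrow> 'k sqmat
    \<Rightarrow> real \<Rightarrow> 'k sqmat \<Rightarrow> real \<Rightarrow> real^'k \<Rightarrow> real" where
  "pop_loss n m Sg y S lam Psi g u =
     (norm ((real n *\<^sub>R y + lam *\<^sub>R u) /\<^sub>R (lam + real n) - m))\<^sup>2
     + (norm ((Psi + S) /\<^sub>R (g + (real n - 1)) - Sg))\<^sup>2"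

definition pop_sure :: "nat \<Rightarrow> real^'k \<Rightarrow> 'k::finite sqmat
    \<Rightarrow> real \<Rightarrow> 'k sqmat \<Rightarrow> real \<Rightarrow> real^'k \<Rightarrow> real" where
  "pop_sure n y S lam Psi g u =
     ((real n - lam\<^sup>2 / real n) / (real n - 1) * trace S + lam\<^sup>2 * (norm (y - u))\<^sup>2) / (lam + real n)\<^sup>2
     + ((real n - 3 + g\<^sup>2) / ((real n + 1) * (real n - 2)) * (norm S)\<^sup>2
        + ((real n - 1)\<^sup>2 - g\<^sup>2) / ((real n - 1) * (real n + 1) * (real n - 2)) * (trace S)\<^sup>2
        - 2 * (g / (real n - 1)) * (Psi \<bullet> S) + (norm Psi)\<^sup>2) / (g + (real n - 1))\<^sup>2"

text \<open>With \<open>a\<close> the shrinkage weight the error of the estimator is \<open>z - a (m + z - u)\<close>, and the term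
  quadratic in \<open>a\<close> is common to the loss and its estimate.\<close>
lemma mean_loss_minus_sure:
  fixes z m u :: "'v::real_inner"
  assumes n: "n > (1 :: real)" and lam: "lam > 0"
  defines "a \<equiv> lam / (lam + n)"
  shows "(norm ((n *\<^sub>R (m + z) + lam *\<^sub>R u) /\<^sub>R (lam + n) - m))\<^sup>2
      - ((n - lam\<^sup>2 / n) / (n - 1) * tr + lam\<^sup>2 * (norm (m + z - u))\<^sup>2) / (lam + n)\<^sup>2
    = (1 - 2 * a) * ((norm z)\<^sup>2 - tr / (n * (n - 1))) - 2 * a * (m \<bullet> z) + 2 * a * (u \<bullet> z)"
proof -
  have ln: "lam + n > 0" using n lam by simp
  have "n / (lam + n) = 1 - a" using ln by (simp add: a_def field_simps)
  then have "(n *\<^sub>R (m + z) + lam *\<^sub>R u) /\<^sub>R (lam + n) = (1 - a) *\<^sub>R (m + z) + a *\<^sub>R u"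
    by (simp only: scaleR_add_right scaleR_scaleR a_def divide_inverse mult.commute)
  then have "(n *\<^sub>R (m + z) + lam *\<^sub>R u) /\<^sub>R (lam + n) - m = z - a *\<^sub>R (m + z - u)"
    by (simp add: algebra_simps)
  moreover have inner_expand: "(z' - a *\<^sub>R w) \<bullet> (z' - a *\<^sub>R w) = z' \<bullet> z' - 2 * a * (z' \<bullet> w) + a\<^sup>2 * (w \<bullet> w)" for z' w :: 'v
    by (simp add: inner_diff_left inner_diff_right inner_commute power2_eq_square)
  ultimately have 1: "(norm ((n *\<^sub>R (m + z) + lam *\<^sub>R u) /\<^sub>R (lam + n) - m))\<^sup>2
      = (norm z)\<^sup>2 - 2 * a * (z \<bullet> (m + z - u)) + a\<^sup>2 * (norm (m + z - u))\<^sup>2"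
    unfolding power2_norm_eq_inner
    by simp
  have "(n - lam\<^sup>2 / n) / (n - 1) / (lam + n)\<^sup>2 = (n - lam) / (n * (n - 1) * (lam + n))"
  proof -
    define l where "l = lam + n"
    have "n - lam\<^sup>2 / n = (n - lam) * l / n" using n by (simp add: l_def field_simps power2_eq_square)
    then show ?thesis using ln unfolding l_def[symmetric] by (simp add: power2_eq_square)
  qed
  also have "\<dots> = (1 - 2 * a) / (n * (n - 1))" using n ln by (simp add: a_def field_simps)
  finally have 2: "(n - lam\<^sup>2 / n) / (n - 1) / (lam + n)\<^sup>2 = (1 - 2 * a) / (n * (n - 1))" .
  have "((n - lam\<^sup>2 / n) / (n - 1) * tr + lam\<^sup>2 * (norm (m + z - u))\<^sup>2) / (lam + n)\<^sup>2
      = (n - lam\<^sup>2 / n) / (n - 1) / (lam + n)\<^sup>2 * tr + a\<^sup>2 * (norm (m + z - u))\<^sup>2"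
    by (simp add: a_def add_divide_distrib power_divide)
  also have "\<dots> = (1 - 2 * a) * (tr / (n * (n - 1))) + a\<^sup>2 * (norm (m + z - u))\<^sup>2" unfolding 2 by simp
  finally have 3: "((n - lam\<^sup>2 / n) / (n - 1) * tr + lam\<^sup>2 * (norm (m + z - u))\<^sup>2) / (lam + n)\<^sup>2
      = (1 - 2 * a) * (tr / (n * (n - 1))) + a\<^sup>2 * (norm (m + z - u))\<^sup>2" .
  have 4: "z \<bullet> (m + z - u) = m \<bullet> z + (norm z)\<^sup>2 - u \<bullet> z"
    by (simp add: inner_diff_right inner_add_right inner_commute power2_norm_eq_inner)
  show ?thesis unfolding 1 3 4 by (simp add: algebra_simps)
qed

text \<open>Both sides are quadratic in \<open>x = 1 / c\<close>, and \<open>g x = 1 - k x\<close>.  The coefficients of the risk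
  estimate are such that only the centred statistics remain.\<close>
lemma cov_loss_minus_sure:
  fixes S Psi Sg :: "'v::real_inner"
  assumes n: "n \<ge> (3 :: real)" and g: "g > 0"
  defines "k \<equiv> n - 1" and "c \<equiv> g + (n - 1)"
  shows "(norm ((Psi + S) /\<^sub>R (g + (n - 1)) - Sg))\<^sup>2
      - ((n - 3 + g\<^sup>2) / ((n + 1) * (n - 2)) * (norm S)\<^sup>2
        + ((n - 1)\<^sup>2 - g\<^sup>2) / ((n - 1) * (n + 1) * (n - 2)) * tr\<^sup>2
        - 2 * (g / (n - 1)) * (Psi \<bullet> S) + (norm Psi)\<^sup>2) / (g + (n - 1))\<^sup>2
    = 2 / c * (Psi \<bullet> (S /\<^sub>R k - Sg)) - 2 * (k / c) * ((S /\<^sub>R k - Sg) \<bullet> Sg)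
      + (1 - 2 * (g / c)) * (((norm S)\<^sup>2 - tr\<^sup>2 / k) / ((k + 2) * (k - 1)) - (norm Sg)\<^sup>2)"
proof -
  have k: "k \<ge> 2" and c: "c > 0" using n g by (simp_all add: k_def c_def)
  define x where "x = 1 / c"
  define D where "D = (k + 2) * (k - 1)"
  have D: "D \<noteq> 0" using k by (simp add: D_def)
  define A where "A = (norm S)\<^sup>2 / D"
  define B where "B = tr\<^sup>2 / (k * D)"
  define P where "P = (Psi \<bullet> S) / k"
  have gx: "g * x = 1 - k * x" using c by (simp add: x_def c_def k_def field_simps)
  have SS: "(norm S)\<^sup>2 = (k\<^sup>2 + k - 2) * A"
  proof -
    have "k\<^sup>2 + k - 2 = D" by (simp add: D_def power2_eq_square algebra_simps)
    then show ?thesis using D by (simp add: A_def)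
  qed
  have PS: "Psi \<bullet> S = k * P" using k by (simp add: P_def)
  have 1: "(norm ((Psi + S) /\<^sub>R c - Sg))\<^sup>2
      = x\<^sup>2 * ((norm Psi)\<^sup>2 + 2 * (k * P) + (k\<^sup>2 + k - 2) * A) - 2 * x * (Psi \<bullet> Sg + S \<bullet> Sg) + (norm Sg)\<^sup>2"
    unfolding SS[symmetric] PS[symmetric] power2_norm_eq_inner x_def
    by (simp add: inner_diff_left inner_diff_right inner_add_left inner_add_right inner_commute power2_eq_square
        divide_inverse algebra_simps)
  have 2: "((n - 3 + g\<^sup>2) / ((n + 1) * (n - 2)) * (norm S)\<^sup>2
        + ((n - 1)\<^sup>2 - g\<^sup>2) / ((n - 1) * (n + 1) * (n - 2)) * tr\<^sup>2
        - 2 * (g / (n - 1)) * (Psi \<bullet> S) + (norm Psi)\<^sup>2) / c\<^sup>2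
      = ((k - 2) * x\<^sup>2 + (g * x)\<^sup>2) * A + ((k * x)\<^sup>2 - (g * x)\<^sup>2) * B - 2 * (g * x) * x * P + (norm Psi)\<^sup>2 * x\<^sup>2"
  proof -
    have n': "n = k + 1" by (simp add: k_def)
    have q: "(n + 1) * (n - 2) = D" "k * (n + 1) * (n - 2) = k * D" "n - 1 = k" "n - 3 = k - 2"
      by (simp_all add: n' D_def algebra_simps)
    show ?thesis unfolding q A_def B_def P_def x_def
      by (simp add: power_divide power_mult_distrib diff_divide_distrib add_divide_distrib algebra_simps)
         (simp add: power2_eq_square)
  qed
  have 3: "((norm S)\<^sup>2 - tr\<^sup>2 / k) / D = A - B"
    using k D by (simp add: A_def B_def diff_divide_distrib)
  have 4: "Psi \<bullet> (S /\<^sub>R k - Sg) = P - Psi \<bullet> Sg"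
    by (simp add: inner_diff_right P_def divide_inverse mult.commute)
  have 5: "k * ((S /\<^sub>R k - Sg) \<bullet> Sg) = S \<bullet> Sg - k * (norm Sg)\<^sup>2"
    using k by (simp add: inner_diff_left power2_norm_eq_inner algebra_simps)
  have 6: "2 / c * (Psi \<bullet> (S /\<^sub>R k - Sg)) - 2 * (k / c) * ((S /\<^sub>R k - Sg) \<bullet> Sg)
      = 2 * x * (P - Psi \<bullet> Sg) - 2 * x * (S \<bullet> Sg - k * (norm Sg)\<^sup>2)"
    unfolding 4 5[symmetric] by (simp add: x_def)
  have 7: "g / c = g * x" by (simp add: x_def)
  show ?thesis unfolding c_def[symmetric] 1 2 D_def[symmetric] 3 6 7 gx by algebra
qed

lemma pop_loss_minus_sure:
  fixes Sg S Psi :: "'k::finite sqmat"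
  assumes n: "n \<ge> 3" and lam: "lam > 0" and g: "g > 0"
  defines "a \<equiv> lam / (lam + real n)" and "k \<equiv> real n - 1" and "c \<equiv> g + (real n - 1)"
  shows "pop_loss n m Sg (m + z) S lam Psi g u - pop_sure n (m + z) S lam Psi g u
    = (1 - 2 * a) * ((norm z)\<^sup>2 - trace S / (real n * k)) - 2 * a * (m \<bullet> z) + 2 * a * (u \<bullet> z)
      + 2 / c * (Psi \<bullet> (S /\<^sub>R k - Sg)) - 2 * (k / c) * ((S /\<^sub>R k - Sg) \<bullet> Sg)
      + (1 - 2 * (g / c)) * (((norm S)\<^sup>2 - (trace S)\<^sup>2 / k) / ((k + 2) * (k - 1)) - (norm Sg)\<^sup>2)"
proof -
  have "real n > 1" "real n \<ge> 3" using n by simp_all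
  note mean_loss_minus_sure[OF this(1) lam, of m z u "trace S"] cov_loss_minus_sure[OF this(2) g, of Psi S Sg "trace S"]
  then show ?thesis unfolding pop_loss_def pop_sure_def a_def k_def c_def by linarith
qed

lemma smean_add: "smean p (\<lambda>i. f i + h i) = smean p f + smean p h"
  and smean_diff: "smean p (\<lambda>i. f i - h i) = smean p f - smean p h"
  and smean_scaleR: "smean p (\<lambda>i. r *\<^sub>R f i) = r *\<^sub>R smean p f"
  by (simp_all add: smean_def sum.distrib sum_subtractf scaleR_add_right scaleR_diff_right scaleR_sum_right mult.commute)

lemma smean_mult: "smean p (\<lambda>i. r * f i) = r * smean p f" for f :: "nat \<Rightarrow> real"
  using smean_scaleR[of p r f] by simp

lemma smean_inner_left: "smean p (\<lambda>i. v \<bullet> f i) = v \<bullet> smean p f"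
  using smean_inner[of p f v] by (simp add: inner_commute)

lemma smean_mono: "(\<And>i. i \<in> {1..p} \<Longrightarrow> f i \<le> h i) \<Longrightarrow> smean p f \<le> smean p h" for f :: "nat \<Rightarrow> real"
  unfolding smean_real by (intro divide_right_mono sum_mono) auto

lemma smean_const: "p \<ge> 1 \<Longrightarrow> smean p (\<lambda>_. v) = v"
  by (simp add: smean_def sum_constant_scaleR)

context gaussian_populations
begin

abbreviation "avg_loss p \<omega> lam Psi g u \<equiv>
  smean p (\<lambda>i. pop_loss n (m i) (Sg i) (m i + zb i \<omega>) (SS i \<omega>) lam Psi g u)"

abbreviation "avg_sure p \<omega> lam Psi g u \<equiv>
  smean p (\<lambda>i. pop_sure n (m i + zb i \<omega>) (SS i \<omega>) lam Psi g u)"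

text \<open>The weights \<open>a\<close>, \<open>dof / cc\<close> and \<open>g / cc\<close> lie between 0 and 1; Cauchy--Schwarz takes care of
  the two inner products with \<open>u\<close> and \<open>Psi\<close>.\<close>
lemma loss_near_sure:
  assumes lam: "lam > 0" and g: "g > 0" and u: "norm u \<le> mean_max p + 1 + c + majorant p \<omega>"
    and Psi: "norm Psi \<le> mean_max p + 1 + c + majorant p \<omega>"
  shows "\<bar>avg_loss p \<omega> lam Psi g u
      - avg_sure p \<omega> lam Psi g u\<bar> \<le> approx_error c p \<omega>"
proof -
  define a where "a = lam / (lam + real n)"
  define cc where "cc = g + dof"
  define B where "B = mean_max p + 1 + c + majorant p \<omega>"
  have a: "0 \<le> a" "a \<le> 1" using lam by (simp_all add: a_def divide_le_eq_1)
  have cc: "cc \<ge> 1" using g n3 by (simp add: cc_def)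
  have kc: "0 \<le> dof / cc" "dof / cc \<le> 1" and gc: "0 \<le> g / cc" "g / cc \<le> 1"
    using g n3 by (simp_all add: cc_def divide_le_eq_1)
  have "avg_loss p \<omega> lam Psi g u
      - avg_sure p \<omega> lam Psi g u
    = smean p (\<lambda>i. (1 - 2 * a) * excess_norm i \<omega> - 2 * a * cross_mean i \<omega> + 2 * a * (u \<bullet> zb i \<omega>)
      + 2 / cc * (Psi \<bullet> excess_cov i \<omega>) - 2 * (dof / cc) * cross_cov i \<omega> + (1 - 2 * (g / cc)) * excess_sq i \<omega>)"
    unfolding smean_diff[symmetric] pop_loss_minus_sure[OF n3 lam g]
    by (simp only: excess_norm_def cross_mean_def excess_cov_def cross_cov_def excess_sq_def a_def cc_def)
  also have "\<dots> = (1 - 2 * a) * smean p (\<lambda>i. excess_norm i \<omega>) - 2 * a * smean p (\<lambda>i. cross_mean i \<omega>) + 2 * a * (u \<bullet> smean p (\<lambda>i. zb i \<omega>))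
      + 2 / cc * (Psi \<bullet> smean p (\<lambda>i. excess_cov i \<omega>)) - 2 * (dof / cc) * smean p (\<lambda>i. cross_cov i \<omega>)
      + (1 - 2 * (g / cc)) * smean p (\<lambda>i. excess_sq i \<omega>)"
    by (simp only: smean_add smean_diff smean_mult smean_inner_left)
  also have "\<bar>\<dots>\<bar> \<le> approx_error c p \<omega>"
  proof -
    have 1: "\<bar>(1 - 2 * a) * x\<bar> \<le> \<bar>x\<bar>" "\<bar>2 * a * x\<bar> \<le> 2 * \<bar>x\<bar>" for x :: real
      using a by (auto simp: abs_mult mult_left_le_one_le mult_left_le)
    have 2: "\<bar>(1 - 2 * (g / cc)) * x\<bar> \<le> \<bar>x\<bar>" "\<bar>2 * (dof / cc) * x\<bar> \<le> 2 * \<bar>x\<bar>" for x :: real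
    proof -
      have "\<bar>1 - 2 * (g / cc)\<bar> \<le> 1" "\<bar>2 * (dof / cc)\<bar> \<le> 2" using gc kc by linarith+
      then show "\<bar>(1 - 2 * (g / cc)) * x\<bar> \<le> \<bar>x\<bar>" "\<bar>2 * (dof / cc) * x\<bar> \<le> 2 * \<bar>x\<bar>"
        unfolding abs_mult using mult_right_mono[of _ _ "\<bar>x\<bar>"] by fastforce+
    qed
    have 3: "\<bar>2 * a * (u \<bullet> v)\<bar> \<le> 2 * (B * norm v)" for v
    proof -
      have "\<bar>2 * a * (u \<bullet> v)\<bar> \<le> 2 * \<bar>u \<bullet> v\<bar>" by (rule 1(2))
      also have "\<bar>u \<bullet> v\<bar> \<le> norm u * norm v" by (rule Cauchy_Schwarz_ineq2)
      also have "\<dots> \<le> B * norm v" using u by (intro mult_right_mono) (auto simp: B_def)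
      finally show ?thesis by simp
    qed
    have 4: "\<bar>2 / cc * (Psi \<bullet> V)\<bar> \<le> 2 * (B * norm V)" for V
    proof -
      have "\<bar>2 / cc\<bar> \<le> 2" using cc by (simp add: field_simps)
      then have "\<bar>2 / cc * (Psi \<bullet> V)\<bar> \<le> 2 * \<bar>Psi \<bullet> V\<bar>" unfolding abs_mult by (rule mult_right_mono) simp
      also have "\<bar>Psi \<bullet> V\<bar> \<le> norm Psi * norm V" by (rule Cauchy_Schwarz_ineq2)
      also have "\<dots> \<le> B * norm V" using Psi by (intro mult_right_mono) (auto simp: B_def)
      finally show ?thesis by simp
    qed
    have "\<bar>x1 - x2 + x3 + x4 - x5 + x6\<bar> \<le> y1 + y2 + y6 + y5 + (y3 + y4)"
      if "\<bar>x1\<bar> \<le> y1" "\<bar>x2\<bar> \<le> y2" "\<bar>x3\<bar> \<le> y3" "\<bar>x4\<bar> \<le> y4" "\<bar>x5\<bar> \<le> y5" "\<bar>x6\<bar> \<le> y6" for x1 x2 x3 x4 x5 x6 y1 y2 y3 y4 y5 y6 :: real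
      using that by linarith
    from this[OF 1(1) 1(2) 3 4 2(2) 2(1)] show ?thesis
      unfolding approx_error_def B_def by (simp only: distrib_left)
  qed
  finally show ?thesis .
qed

end

definition clip :: "real \<Rightarrow> 'v::real_normed_vector \<Rightarrow> 'v" where
  "clip r v = min 1 (r / norm v) *\<^sub>R v"

lemma clip_id: assumes "norm v \<le> r" shows "clip r v = v"
proof (cases "v = 0")
  case False
  then have "1 \<le> r / norm v" using assms by simp
  then show ?thesis by (simp add: clip_def)
qed (simp add: clip_def)

lemma norm_clip_le: "r \<ge> 0 \<Longrightarrow> norm (clip r v) \<le> r"
  by (cases "v = 0") (auto simp: clip_def min_def field_simps)

text \<open>Projection onto a ball that contains \<open>y\<close> does not increase the distance to \<open>y\<close>.\<close>
lemma dist_clip_le: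
  fixes u y :: "'v::real_inner"
  assumes y: "norm y \<le> r"
  shows "(norm (y - clip r u))\<^sup>2 \<le> (norm (y - u))\<^sup>2"
proof (cases "norm u \<le> r")
  case True
  then show ?thesis by (simp add: clip_id)
next
  case False
  define t where "t = r / norm u"
  have r0: "r \<ge> 0" using y norm_ge_zero order_trans by blast
  have u0: "norm u > 0" using False r0 by linarith
  have t: "0 \<le> t" "t < 1" using False r0 u0 by (simp_all add: t_def)
  have c: "clip r u = t *\<^sub>R u" using t by (simp add: clip_def t_def[symmetric])
  have "y \<bullet> u \<le> norm y * norm u" by (rule norm_cauchy_schwarz)
  also have "\<dots> \<le> r * norm u" using y by (intro mult_right_mono) auto
  also have "\<dots> = t * (u \<bullet> u)" using u0 by (simp add: t_def dot_square_norm power2_eq_square)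
  finally have yu: "y \<bullet> u \<le> t * (u \<bullet> u)" .
  have "(norm (y - u))\<^sup>2 - (norm (y - t *\<^sub>R u))\<^sup>2 = (1 - t) * ((1 + t) * (u \<bullet> u) - 2 * (y \<bullet> u))"
    unfolding power2_norm_eq_inner by (simp add: inner_diff_left inner_diff_right inner_commute algebra_simps)
  moreover have "(1 + t) * (u \<bullet> u) - 2 * (y \<bullet> u) \<ge> 0"
  proof -
    have "2 * (t * (u \<bullet> u)) \<le> (1 + t) * (u \<bullet> u)" using t by (simp add: distrib_right mult_left_le_one_le)
    then show ?thesis using yu by linarith
  qed
  ultimately have "0 \<le> (norm (y - u))\<^sup>2 - (norm (y - t *\<^sub>R u))\<^sup>2" using t by (simp add: mult_nonneg_nonneg)
  then show ?thesis by (simp add: c)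
qed

text \<open>Projecting \<open>u\<close> brings it closer to every \<open>y i\<close>.  Projecting \<open>Psi\<close> lowers the square of its norm, so
  only the term linear in \<open>Psi\<close>, its inner product with the mean scatter, can raise the estimate.\<close>
lemma sure_clip:
  fixes S :: "nat \<Rightarrow> 'k::finite sqmat" and y :: "nat \<Rightarrow> real^'k"
  assumes n: "n \<ge> 3" and p: "p \<ge> 1" and g: "g > 0" and r: "r \<ge> 0"
    and y: "\<And>i. i \<in> {1..p} \<Longrightarrow> norm (y i) \<le> ry"
  shows "smean p (\<lambda>i. pop_sure n (y i) (S i) lam (clip r Psi) g (clip ry u))
    \<le> smean p (\<lambda>i. pop_sure n (y i) (S i) lam Psi g u)
      + 2 * g * norm Psi * (if r < norm Psi then norm (smean p S) else 0)"
proof -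
  define k where "k = real n - 1"
  define c where "c = g + k"
  have k: "k \<ge> 2" and c: "c \<ge> 1" using n g by (simp_all add: k_def c_def)
  have "pop_sure n (y i) (S i) lam (clip r Psi) g (clip ry u) - pop_sure n (y i) (S i) lam Psi g u
    \<le> (2 * (g / k) * ((Psi - clip r Psi) \<bullet> S i) + ((norm (clip r Psi))\<^sup>2 - (norm Psi)\<^sup>2)) / c\<^sup>2" if i: "i \<in> {1..p}" for i
  proof -
    have m: "(T + lam\<^sup>2 * (norm (y i - clip ry u))\<^sup>2) / (lam + real n)\<^sup>2 \<le> (T + lam\<^sup>2 * (norm (y i - u))\<^sup>2) / (lam + real n)\<^sup>2" for T
      using dist_clip_le[OF y[OF i], of u] by (intro divide_right_mono add_left_mono mult_left_mono) auto
    have s: "(T1 + T2 - 2 * (g / k) * (clip r Psi \<bullet> S i) + (norm (clip r Psi))\<^sup>2) / c\<^sup>2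
        = (T1 + T2 - 2 * (g / k) * (Psi \<bullet> S i) + (norm Psi)\<^sup>2) / c\<^sup>2
          + (2 * (g / k) * ((Psi - clip r Psi) \<bullet> S i) + ((norm (clip r Psi))\<^sup>2 - (norm Psi)\<^sup>2)) / c\<^sup>2" for T1 T2
      by (simp add: inner_diff_left algebra_simps flip: add_divide_distrib)
    show ?thesis unfolding pop_sure_def k_def[symmetric] c_def[symmetric] using m s by (smt (verit))
  qed
  then have "smean p (\<lambda>i. pop_sure n (y i) (S i) lam (clip r Psi) g (clip ry u) - pop_sure n (y i) (S i) lam Psi g u)
    \<le> smean p (\<lambda>i. (2 * (g / k) * ((Psi - clip r Psi) \<bullet> S i) + ((norm (clip r Psi))\<^sup>2 - (norm Psi)\<^sup>2)) / c\<^sup>2)"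
    by (rule smean_mono)
  also have "\<dots> = (2 * (g / k) * ((Psi - clip r Psi) \<bullet> smean p S) + ((norm (clip r Psi))\<^sup>2 - (norm Psi)\<^sup>2)) / c\<^sup>2"
  proof -
    have e: "(2 * (g / k) * x + d) / c\<^sup>2 = (2 * (g / k) / c\<^sup>2) * x + d / c\<^sup>2" for x d
      by (simp add: add_divide_distrib)
    show ?thesis unfolding e by (simp only: smean_add smean_mult smean_inner_left smean_const[OF p])
  qed
  also have "\<dots> \<le> 2 * g * norm Psi * (if r < norm Psi then norm (smean p S) else 0)"
  proof (cases "r < norm Psi")
    case False
    then show ?thesis by (simp add: clip_id)
  next
    case True
    define t where "t = r / norm Psi"
    have t: "0 \<le> t" "t < 1" using True r by (auto simp: t_def divide_less_eq)
    have cl: "clip r Psi = t *\<^sub>R Psi" using t by (simp add: clip_def t_def[symmetric])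
    have nn: "norm (clip r Psi) \<le> norm Psi" using norm_clip_le[OF r, of Psi] True by simp
    have "(Psi - clip r Psi) \<bullet> smean p S \<le> norm (Psi - clip r Psi) * norm (smean p S)" by (rule norm_cauchy_schwarz)
    also have "norm (Psi - clip r Psi) = (1 - t) * norm Psi"
    proof -
      have "Psi - clip r Psi = (1 - t) *\<^sub>R Psi" by (simp add: cl scaleR_left_diff_distrib)
      then show ?thesis using t by simp
    qed
    also have "(1 - t) * norm Psi * norm (smean p S) \<le> 1 * norm Psi * norm (smean p S)"
      using t by (intro mult_right_mono) auto
    finally have le: "(Psi - clip r Psi) \<bullet> smean p S \<le> norm Psi * norm (smean p S)" by simp
    have "(norm (clip r Psi))\<^sup>2 - (norm Psi)\<^sup>2 \<le> 0" using nn by (simp add: power_mono)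
    then have "(2 * (g / k) * ((Psi - clip r Psi) \<bullet> smean p S) + ((norm (clip r Psi))\<^sup>2 - (norm Psi)\<^sup>2)) / c\<^sup>2
      \<le> (2 * (g / k) * (norm Psi * norm (smean p S)) + 0) / c\<^sup>2"
      using le g k by (intro divide_right_mono add_mono mult_left_mono) auto
    also have "\<dots> \<le> (2 * (g / k) * (norm Psi * norm (smean p S)) + 0) / 1"
      using g k c by (intro divide_left_mono) (auto simp: one_le_power)
    also have "\<dots> \<le> 2 * g * (norm Psi * norm (smean p S))"
    proof -
      have "g / k \<le> g / 1" using g k by (intro divide_left_mono) auto
      then have "2 * (g / k) \<le> 2 * g" by simp
      then show ?thesis by (simp only: add_0_right div_by_1) (intro mult_right_mono; simp)
    qed
    finally show ?thesis using True by (simp add: mult.assoc)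
  qed
  finally show ?thesis unfolding smean_diff by linarith
qed

section \<open>Comparison with a fixed competitor\<close>

context gaussian_populations
begin

lemma pop_loss_integrable:
  assumes i: "i \<ge> 1"
  shows "integrable M (\<lambda>\<omega>. pop_loss n (m i) (Sg i) (m i + zb i \<omega>) (SS i \<omega>) lam Psi g u)"
proof -
  interpret s: gaussian_sample M n "Sg i" "Z i" by (rule sample[OF i])
  have affine: "(norm (r *\<^sub>R x + w))\<^sup>2 = r\<^sup>2 * (norm x)\<^sup>2 + 2 * r * (w \<bullet> x) + (norm w)\<^sup>2" for r and x w :: "'v::real_inner"
    unfolding power2_norm_eq_inner
    by (simp add: inner_add_left inner_add_right inner_commute power2_eq_square algebra_simps)
  have 1: "integrable M (\<lambda>\<omega>. (norm (r *\<^sub>R zb i \<omega> + w))\<^sup>2)" for r w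
    unfolding affine by (intro Bochner_Integration.integrable_add integrable_mult_right s.expectation_norm_zbar_sq
      s.expectation_inner_zbar integrable_const)
  have wS: "integrable M (\<lambda>\<omega>. w \<bullet> SS i \<omega>)" for w
    unfolding inner_matrix by (intro Bochner_Integration.integrable_sum integrable_mult_right s.expectation_S)
  have 2: "integrable M (\<lambda>\<omega>. (norm (r *\<^sub>R SS i \<omega> + w))\<^sup>2)" for r w
    unfolding affine by (intro Bochner_Integration.integrable_add integrable_mult_right s.expectation_norm_S_sq wS integrable_const)
  have e: "(real n *\<^sub>R (m i + zb i \<omega>) + lam *\<^sub>R u) /\<^sub>R (lam + real n) - m i
      = (real n / (lam + real n)) *\<^sub>R zb i \<omega> + ((real n *\<^sub>R m i + lam *\<^sub>R u) /\<^sub>R (lam + real n) - m i)"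
    "(Psi + SS i \<omega>) /\<^sub>R (g + dof) - Sg i = (1 / (g + dof)) *\<^sub>R SS i \<omega> + (Psi /\<^sub>R (g + dof) - Sg i)" for \<omega>
    by (simp_all add: scaleR_add_right divide_inverse mult.commute)
  show ?thesis unfolding pop_loss_def e by (intro Bochner_Integration.integrable_add 1 2)
qed

lemma loss_integrable:
  "integrable M (\<lambda>\<omega>. avg_loss p \<omega> lam Psi g u)"
  unfolding smean_real by (intro integrable_divide Bochner_Integration.integrable_sum pop_loss_integrable) auto

text \<open>Near minimality of the risk estimate is used against the clipped parameters, and the risk
  estimate is replaced by the loss for the selected and for the target parameters.\<close>

lemma selected_loss_le:
  assumes p: "p \<ge> 1" and \<omega>: "\<omega> \<in> space M"
    and hat: "lamh > 0" "gh > 0" "norm Psih \<le> (MAX i\<in>{1..p}. norm (SS i \<omega>))"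
      "norm uh \<le> (MAX i\<in>{1..p}. norm (m i + zb i \<omega>))"
    and par: "lam > 0" "g > 0"
    and sel: "avg_sure p \<omega> lamh Psih gh uh
      \<le> avg_sure p \<omega> lam (clip (MAX i\<in>{1..p}. norm (SS i \<omega>)) Psi) g (clip (MAX i\<in>{1..p}. norm (m i + zb i \<omega>)) u) + eps"
  shows "avg_loss p \<omega> lamh Psih gh uh
    \<le> avg_loss p \<omega> lam Psi g u
      + (eps + 2 * approx_error (norm Psi + norm u) p \<omega> + 2 * g * norm Psi * escape_term (norm Psi) p \<omega>)"
proof -
  define r where "r = (MAX i\<in>{1..p}. norm (SS i \<omega>))"
  define ry where "ry = (MAX i\<in>{1..p}. norm (m i + zb i \<omega>))"
  define c where "c = norm Psi + norm u"
  have fin: "finite {1..p}" "{1..p} \<noteq> {}" using p by auto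
  have rY: "r \<le> majorant p \<omega>" unfolding r_def using fin norm_SS_le_majorant by (subst Max_le_iff) auto
  have ryY: "ry \<le> mean_max p + 1 + majorant p \<omega>" unfolding ry_def using fin norm_mean_le_majorant by (subst Max_le_iff) auto
  have r0: "r \<ge> 0" using hat(3) norm_ge_zero[of Psih] unfolding r_def by linarith
  have Si: "norm (SS i \<omega>) \<le> r" and yi: "norm (m i + zb i \<omega>) \<le> ry" if "i \<in> {1..p}" for i
    unfolding r_def ry_def using that by (auto intro!: Max_ge)
  have mm0: "mean_max p \<ge> 0" by (rule mean_max_nonneg[OF p])
  have c0: "c \<ge> 0" "norm Psi \<le> c" "norm u \<le> c" by (simp_all add: c_def)
  note Y0 = majorant_nonneg[of p \<omega>]
  have "norm uh \<le> mean_max p + 1 + c + majorant p \<omega>" "norm Psih \<le> mean_max p + 1 + c + majorant p \<omega>"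
    "norm u \<le> mean_max p + 1 + c + majorant p \<omega>" "norm Psi \<le> mean_max p + 1 + c + majorant p \<omega>"
    using hat(3,4) rY ryY mm0 c0 Y0 unfolding r_def ry_def by linarith+
  then have near: "avg_loss p \<omega> lamh Psih gh uh
      \<le> avg_sure p \<omega> lamh Psih gh uh + approx_error c p \<omega>"
    "avg_sure p \<omega> lam Psi g u
      \<le> avg_loss p \<omega> lam Psi g u + approx_error c p \<omega>"
    using loss_near_sure[OF hat(1,2), of uh p c \<omega> Psih] loss_near_sure[OF par, of u p c \<omega> Psi] by linarith+
  have esc: "(if r < norm Psi then norm (smean p (\<lambda>i. SS i \<omega>)) else 0) \<le> escape_term (norm Psi) p \<omega>"
  proof (cases "r < norm Psi")
    case True
    then have "\<forall>i\<in>{1..p}. norm (SS i \<omega>) < norm Psi" using Si by fastforce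
    then show ?thesis using \<omega> True by (simp add: escape_term_def)
  qed (simp add: escape_term_nonneg)
  have "avg_sure p \<omega> lam (clip r Psi) g (clip ry u)
    \<le> avg_sure p \<omega> lam Psi g u
      + 2 * g * norm Psi * (if r < norm Psi then norm (smean p (\<lambda>i. SS i \<omega>)) else 0)"
    by (rule sure_clip[OF n3 p par(2) r0 yi])
  also have "\<dots> \<le> avg_sure p \<omega> lam Psi g u + 2 * g * norm Psi * escape_term (norm Psi) p \<omega>"
    using par by (intro add_left_mono mult_left_mono esc) auto
  finally show ?thesis using near sel unfolding r_def[symmetric] ry_def[symmetric] c_def[symmetric] by linarith
qed

end

section \<open>Passage to logarithmic coordinates\<close>

lemma transpose_add: "transpose (A + B) = transpose A + transpose B"
  and transpose_diff: "transpose (A - B) = transpose A - transpose B"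
  and transpose_scaleR: "transpose (r *\<^sub>R A) = r *\<^sub>R transpose A" for A B :: "real^'n^'m"
  by (simp_all add: transpose_def vec_eq_iff)

lemma transpose_sum: "transpose (\<Sum>i\<in>I. f i) = (\<Sum>i\<in>I. transpose (f i))" for f :: "'i \<Rightarrow> real^'n^'m"
  by (simp add: transpose_def vec_eq_iff)

lemma spd_symmetric: "A \<in> spd \<Longrightarrow> transpose A = A"
  by (simp add: spd_def)

lemma zero_not_spd: "0 \<notin> (spd :: 'k::finite sqmat set)"
proof
  assume "0 \<in> (spd :: 'k sqmat set)"
  then have "v \<noteq> 0 \<Longrightarrow> v \<bullet> ((0 :: 'k sqmat) *v v) > 0" for v by (simp add: spd_def)
  from this[of "axis (SOME a. True) 1"] show False by (simp add: axis_eq_0_iff)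
qed

lemma spd_scaleR: "A \<in> spd \<Longrightarrow> r > 0 \<Longrightarrow> r *\<^sub>R A \<in> spd"
  by (simp add: spd_def transpose_scaleR flip: scaleR_matrix_vector_assoc)

lemma le_dist_log_vec:
  assumes "A \<in> spd" "B \<in> spd"
  shows "le_dist A B = norm (log_vec A - log_vec B)"
  unfolding le_dist_def log_vec_def svec_diff[symmetric]
  by (rule norm_svec[symmetric]) (simp add: transpose_diff transpose_mat_log assms)

lemma norm_mat_log: "A \<in> spd \<Longrightarrow> norm (mat_log A) = norm (log_vec A)"
  unfolding log_vec_def by (rule norm_svec[symmetric]) (simp add: transpose_mat_log)

lemma log_vec_mat_exp: "transpose L = L \<Longrightarrow> log_vec (mat_exp L) = svec L"
  by (simp add: log_vec_def mat_log_mat_exp)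

lemma log_mean:
  fixes x :: "nat \<Rightarrow> ('n::{finite,linorder}) sqmat"
  assumes x: "\<And>j. j \<in> {1..n} \<Longrightarrow> x j \<in> spd"
  shows "log_mean n x \<in> spd" "log_vec (log_mean n x) = smean n (\<lambda>j. log_vec (x j))"
proof -
  have s: "transpose ((\<Sum>j=1..n. mat_log (x j)) /\<^sub>R real n) = (\<Sum>j=1..n. mat_log (x j)) /\<^sub>R real n"
    using x by (simp add: transpose_scaleR transpose_sum transpose_mat_log)
  show "log_mean n x \<in> spd" unfolding log_mean_def by (rule mat_exp_spd[OF s])
  show "log_vec (log_mean n x) = smean n (\<lambda>j. log_vec (x j))"
    unfolding log_mean_def log_vec_mat_exp[OF s] by (simp add: smean_def svec_scaleR svec_sum log_vec_def)
qed

lemma scatter_eq_scat: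
  fixes x :: "nat \<Rightarrow> ('n::{finite,linorder}) sqmat"
  assumes "\<And>j. j \<in> {1..n} \<Longrightarrow> x j \<in> spd"
  shows "scatter n x = scat n (\<lambda>j. log_vec (x j))"
  by (simp only: scatter_def scat_def log_mean(2)[OF assms])

lemma smean_shift: "n \<ge> 1 \<Longrightarrow> smean n (\<lambda>j. m + z j) = m + smean n z"
  by (simp add: smean_add smean_const)

lemma scat_shift: "n \<ge> 1 \<Longrightarrow> scat n (\<lambda>j. m + z j) = scat n z"
  by (simp add: scat_def smean_shift)

lemma M_est:
  fixes x :: "nat \<Rightarrow> ('n::{finite,linorder}) sqmat"
  assumes x: "\<And>j. j \<in> {1..n} \<Longrightarrow> x j \<in> spd" and mu: "mu \<in> spd"
  shows "M_est n lam mu x \<in> spd"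
    "log_vec (M_est n lam mu x) = (real n *\<^sub>R smean n (\<lambda>j. log_vec (x j)) + lam *\<^sub>R log_vec mu) /\<^sub>R (lam + real n)"
proof -
  have lm: "log_mean n x \<in> spd" and lv: "log_vec (log_mean n x) = smean n (\<lambda>j. log_vec (x j))"
    using log_mean[of n x] x by auto
  have s: "transpose ((real n *\<^sub>R mat_log (log_mean n x) + lam *\<^sub>R mat_log mu) /\<^sub>R (lam + real n))
      = (real n *\<^sub>R mat_log (log_mean n x) + lam *\<^sub>R mat_log mu) /\<^sub>R (lam + real n)"
    by (simp add: transpose_scaleR transpose_add transpose_mat_log lm mu)
  show "M_est n lam mu x \<in> spd" unfolding M_est_def by (rule mat_exp_spd[OF s])
  show "log_vec (M_est n lam mu x) = (real n *\<^sub>R smean n (\<lambda>j. log_vec (x j)) + lam *\<^sub>R log_vec mu) /\<^sub>R (lam + real n)"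
    unfolding M_est_def log_vec_mat_exp[OF s] lv[symmetric] by (simp only: svec_scaleR svec_add log_vec_def)
qed

lemma SURE_eq:
  fixes x :: "nat \<Rightarrow> nat \<Rightarrow> ('n::{finite,linorder}) sqmat"
  assumes x: "\<And>i j. i \<in> {1..p} \<Longrightarrow> j \<in> {1..n} \<Longrightarrow> x i j \<in> spd" and mu: "mu \<in> spd" and Psi: "Psi \<in> spd"
  shows "SURE n p x (lam, Psi, nu, mu) = smean p (\<lambda>i. pop_sure n (smean n (\<lambda>j. log_vec (x i j)))
    (scat n (\<lambda>j. log_vec (x i j))) lam Psi (nu - real CARD('n uprod) - 1) (log_vec mu))"
proof -
  have c: "nu + real n - real CARD('n uprod) - 2 = nu - real CARD('n uprod) - 1 + (real n - 1)" by simp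
  have t: "trace (Psi ** Psi) = (norm Psi)\<^sup>2" "trace (Psi ** scat n z) = Psi \<bullet> scat n z" for z
    by (simp_all add: trace_mult_symmetric transpose_scat spd_symmetric[OF Psi] power2_norm_eq_inner)
  show ?thesis
    unfolding SURE_def prod.case Let_def smean_real pop_sure_def c
    by (intro arg_cong2[where f = "(/)"] sum.cong refl)
       (simp only: scatter_eq_scat[OF x] le_dist_log_vec[OF log_mean(1)[OF x] mu] log_mean(2)[OF x] t trace_scat_sq)
qed

lemma loss_eq:
  fixes x :: "nat \<Rightarrow> nat \<Rightarrow> ('n::{finite,linorder}) sqmat"
  assumes x: "\<And>i j. i \<in> {1..p} \<Longrightarrow> j \<in> {1..n} \<Longrightarrow> x i j \<in> spd" and mu: "mu \<in> spd"
    and M: "\<And>i. i \<in> {1..p} \<Longrightarrow> M i \<in> spd"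
  shows "loss p (\<lambda>i. M_est n lam mu (x i)) (\<lambda>i. Sigma_est n Psi nu (x i)) M Sg
    = smean p (\<lambda>i. pop_loss n (log_vec (M i)) (Sg i) (smean n (\<lambda>j. log_vec (x i j)))
        (scat n (\<lambda>j. log_vec (x i j))) lam Psi (nu - real CARD('n uprod) - 1) (log_vec mu))"
proof -
  have c: "nu + real n - real CARD('n uprod) - 2 = nu - real CARD('n uprod) - 1 + (real n - 1)" by simp
  show ?thesis
    unfolding loss_def smean_real pop_loss_def Sigma_est_def c add_divide_distrib[symmetric] sum.distrib[symmetric]
    by (intro arg_cong2[where f = "(/)"] sum.cong refl)
       (simp only: scatter_eq_scat[OF x] le_dist_log_vec[OF M_est(1)[OF x mu] M] M_est(2)[OF x mu])
qed

lemma clip_feasible: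
  fixes x :: "nat \<Rightarrow> nat \<Rightarrow> ('n::{finite,linorder}) sqmat"
  assumes x: "\<And>i j. i \<in> {1..p} \<Longrightarrow> j \<in> {1..n} \<Longrightarrow> x i j \<in> spd"
    and par: "lam > 0" "nu > real CARD('n uprod) + 1" "Psi \<in> spd" "mu \<in> spd"
    and r: "r = (MAX i\<in>{1..p}. norm (scatter n (x i)))" "r > 0"
    and ry: "ry = (MAX i\<in>{1..p}. norm (mat_log (log_mean n (x i))))" "ry \<ge> 0"
  shows "feasible n p x (lam, clip r Psi, nu, mat_exp (clip ry (mat_log mu)))"
    "mat_exp (clip ry (mat_log mu)) \<in> spd" "clip r Psi \<in> spd"
    "log_vec (mat_exp (clip ry (mat_log mu))) = clip ry (log_vec mu)"
proof -
  have s: "transpose (clip ry (mat_log mu)) = clip ry (mat_log mu)"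
    by (simp add: clip_def transpose_scaleR transpose_mat_log par)
  show m: "mat_exp (clip ry (mat_log mu)) \<in> spd" by (rule mat_exp_spd[OF s])
  have "Psi \<noteq> 0" using par zero_not_spd by auto
  then have "min 1 (r / norm Psi) > 0" using r by simp
  then show P: "clip r Psi \<in> spd" unfolding clip_def by (intro spd_scaleR par)
  show "log_vec (mat_exp (clip ry (mat_log mu))) = clip ry (log_vec mu)"
    unfolding log_vec_mat_exp[OF s] by (simp add: clip_def svec_scaleR norm_mat_log[OF par(4)] log_vec_def[symmetric])
  show "feasible n p x (lam, clip r Psi, nu, mat_exp (clip ry (mat_log mu)))"
    unfolding feasible_def prod.case mat_log_mat_exp[OF s] r(1)[symmetric] ry(1)[symmetric]
    using par m P norm_clip_le[of r Psi] norm_clip_le[of ry "mat_log mu"] r(2) ry(2) by simp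
qed

lemma SURE_choiceD:
  assumes "SURE_choice e n p x \<theta>" "e > 0"
  shows "feasible n p x \<theta>" "feasible n p x \<theta>' \<Longrightarrow> SURE n p x \<theta> \<le> SURE n p x \<theta>' + e"
proof (atomize(full), cases "\<exists>\<theta>'. is_arg_min (SURE n p x) (feasible n p x) \<theta>'")
  case True
  then have "is_arg_min (SURE n p x) (feasible n p x) \<theta>" using assms(1) by (simp add: SURE_choice_def)
  then have f: "feasible n p x \<theta>" and le: "feasible n p x \<theta>' \<Longrightarrow> \<not> SURE n p x \<theta>' < SURE n p x \<theta>"
    unfolding is_arg_min_def by blast+
  show "feasible n p x \<theta> \<and> (feasible n p x \<theta>' \<longrightarrow> SURE n p x \<theta> \<le> SURE n p x \<theta>' + e)"
    using f le assms(2) by linarith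
next
  case False
  then show "feasible n p x \<theta> \<and> (feasible n p x \<theta>' \<longrightarrow> SURE n p x \<theta> \<le> SURE n p x \<theta>' + e)"
    using assms(1) unfolding SURE_choice_def by (simp only: if_False) blast
qed

lemma limsup_finite_bound:
  fixes f :: "nat \<Rightarrow> real"
  assumes "limsup (\<lambda>p. ereal (f p)) < \<infinity>"
  obtains C where "C \<ge> 0" "\<And>p. f p \<le> C"
proof -
  obtain B where B: "limsup (\<lambda>p. ereal (f p)) < ereal B" using assms ereal_dense2[of _ \<infinity>] by blast
  from Limsup_lessD[OF B] obtain N where N: "\<And>p. p \<ge> N \<Longrightarrow> f p < B"
    by (auto simp: eventually_sequentially)
  define C where "C = \<bar>B\<bar> + (\<Sum>p<N. \<bar>f p\<bar>)"
  have "f p \<le> C" for p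
  proof (cases "p < N")
    case True
    then have "\<bar>f p\<bar> \<le> (\<Sum>p<N. \<bar>f p\<bar>)" by (intro member_le_sum) auto
    then show ?thesis by (simp add: C_def)
  next
    case False
    then have "f p < B" using N by simp
    moreover have "(\<Sum>p<N. \<bar>f p\<bar>) \<ge> 0" by (simp add: sum_nonneg)
    ultimately show ?thesis unfolding C_def by linarith
  qed
  moreover have "C \<ge> 0" by (simp add: C_def sum_nonneg)
  ultimately show thesis using that by blast
qed

text \<open>A bounded moment of order larger than two makes the largest of \<open>p\<close> terms \<open>o (sqrt p)\<close>.\<close>

lemma max_of_moment_bound:
  fixes f :: "nat \<Rightarrow> real"
  assumes d: "d > 0" and f: "\<And>i. f i \<ge> 0" and C: "C \<ge> 0"
    and b: "\<And>p. p \<ge> 1 \<Longrightarrow> (\<Sum>i=1..p. f i powr (2 + d)) \<le> C * real p"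
  defines "mx p \<equiv> (C * real p) powr (1 / (2 + d))"
  shows "i \<in> {1..p} \<Longrightarrow> f i \<le> mx p" "(\<lambda>p. mx p / sqrt (real p)) \<longlonglongrightarrow> 0"
proof -
  show "f i \<le> mx p" if i: "i \<in> {1..p}"
  proof -
    have "f i powr (2 + d) \<le> (\<Sum>i=1..p. f i powr (2 + d))" using i by (intro member_le_sum) auto
    also have "\<dots> \<le> C * real p" using i by (intro b) auto
    finally have "(f i powr (2 + d)) powr (1 / (2 + d)) \<le> mx p"
      unfolding mx_def using d by (intro powr_mono2) auto
    moreover have "(f i powr (2 + d)) powr (1 / (2 + d)) = f i" using d f by (simp add: powr_powr)
    ultimately show ?thesis by simp
  qed
  have e: "1 / (2 + d) - 1 / 2 < 0" using d by (simp add: field_simps)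
  have "(\<lambda>p. C powr (1 / (2 + d)) * real p powr (1 / (2 + d) - 1 / 2)) \<longlonglongrightarrow> C powr (1 / (2 + d)) * 0"
    by (intro tendsto_mult tendsto_const tendsto_neg_powr[OF e] filterlim_real_sequentially)
  moreover have "eventually (\<lambda>p. C powr (1 / (2 + d)) * real p powr (1 / (2 + d) - 1 / 2) = mx p / sqrt (real p)) sequentially"
    using eventually_gt_at_top[of 0]
    by eventually_elim (use C in \<open>simp add: mx_def powr_mult powr_diff powr_half_sqrt\<close>)
  ultimately show "(\<lambda>p. mx p / sqrt (real p)) \<longlonglongrightarrow> 0"
    by (simp add: filterlim_cong[OF refl refl, rotated] tendsto_cong)
qed

section \<open>Asymptotic optimality of the selected estimators\<close>

theorem theorem4:
  fixes P :: "'w measure"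
    and n :: nat
    and M :: "nat \<Rightarrow> ('n::{finite,linorder}) sqmat"
    and Sigma :: "nat \<Rightarrow> 'n uprod sqmat"
    and X :: "nat \<Rightarrow> nat \<Rightarrow> 'w \<Rightarrow> 'n sqmat"
    and lamh nuh :: "nat \<Rightarrow> 'w \<Rightarrow> real"
    and Psih :: "nat \<Rightarrow> 'w \<Rightarrow> 'n uprod sqmat"
    and muh :: "nat \<Rightarrow> 'w \<Rightarrow> 'n sqmat"
    and eps :: "nat \<Rightarrow> real"
  assumes "prob_space P"
    and "n \<ge> 3"
    and "\<And>i. i \<ge> 1 \<Longrightarrow> M i \<in> spd"
    and "\<And>i. i \<ge> 1 \<Longrightarrow> Sigma i \<in> spd"
    and "limsup (\<lambda>p. ereal ((\<Sum>i=1..p. (trace (Sigma i)) ^ 4) / real p)) < \<infinity>"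
    and "limsup (\<lambda>p. ereal ((\<Sum>i=1..p. log_vec (M i) \<bullet> (Sigma i *v log_vec (M i))) / real p)) < \<infinity>"
    and "\<exists>\<delta>>0. limsup (\<lambda>p. ereal ((\<Sum>i=1..p. norm (mat_log (M i)) powr (2 + \<delta>)) / real p)) < \<infinity>"
    and "\<And>i j. i \<ge> 1 \<Longrightarrow> j \<in> {1..n} \<Longrightarrow> log_normal P (X i j) (M i) (Sigma i)"
    and "prob_space.indep_vars P (\<lambda>_. borel) (\<lambda>(i, j). X i j) ({1..} \<times> {1..n})"
    and "\<And>p. p \<ge> 1 \<Longrightarrow> lamh p \<in> borel_measurable P"
    and "\<And>p. p \<ge> 1 \<Longrightarrow> Psih p \<in> borel_measurable P"
    and "\<And>p. p \<ge> 1 \<Longrightarrow> nuh p \<in> borel_measurable P"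
    and "\<And>p. p \<ge> 1 \<Longrightarrow> muh p \<in> borel_measurable P"
    and "\<And>p. eps p > 0"
    and "eps \<longlonglongrightarrow> 0"
    and "\<And>p. p \<ge> 1 \<Longrightarrow>
      AE \<omega> in P. SURE_choice (eps p) n p (\<lambda>i j. X i j \<omega>) (lamh p \<omega>, Psih p \<omega>, nuh p \<omega>, muh p \<omega>)"
  shows "\<forall>lam>0. \<forall>mu\<in>spd. \<forall>nu>real CARD('n uprod) + 1. \<forall>Psi\<in>spd.
    limsup (\<lambda>p.
      risk P p (\<lambda>i \<omega>. M_est n (lamh p \<omega>) (muh p \<omega>) (\<lambda>j. X i j \<omega>))
               (\<lambda>i \<omega>. Sigma_est n (Psih p \<omega>) (nuh p \<omega>) (\<lambda>j. X i j \<omega>)) M Sigma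
      - risk P p (\<lambda>i \<omega>. M_est n lam mu (\<lambda>j. X i j \<omega>))
                 (\<lambda>i \<omega>. Sigma_est n Psi nu (\<lambda>j. X i j \<omega>)) M Sigma) \<le> 0"
proof (intro allI ballI impI)
  fix lam nu :: real and mu :: "'n sqmat" and Psi :: "'n uprod sqmat"
  assume par: "0 < lam" "mu \<in> spd" "real CARD('n uprod) + 1 < nu" "Psi \<in> spd"
  define m where "m i = log_vec (M i)" for i
  define Z where "Z i j \<omega> = log_vec (X i j \<omega>) - m i" for i j \<omega>
  obtain C1 where C1: "C1 \<ge> 0" "\<And>p. (\<Sum>i=1..p. trace (Sigma i) ^ 4) / real p \<le> C1"
    using limsup_finite_bound[OF assms(5)] by blast
  obtain C2 where C2: "C2 \<ge> 0" "\<And>p. (\<Sum>i=1..p. log_vec (M i) \<bullet> (Sigma i *v log_vec (M i))) / real p \<le> C2"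
    using limsup_finite_bound[OF assms(6)] by blast
  obtain d where d: "d > 0" "limsup (\<lambda>p. ereal ((\<Sum>i=1..p. norm (mat_log (M i)) powr (2 + d)) / real p)) < \<infinity>"
    using assms(7) by blast
  obtain C3 where C3: "C3 \<ge> 0" "\<And>p. (\<Sum>i=1..p. norm (mat_log (M i)) powr (2 + d)) / real p \<le> C3"
    using limsup_finite_bound[OF d(2)] by blast
  define bnd where "bnd = C1 + C2"
  define mx where "mx p = (C3 * real p) powr (1 / (2 + d))" for p :: nat
  have mb: "(\<Sum>i=1..p. norm (m i) powr (2 + d)) \<le> C3 * real p" if p: "p \<ge> 1" for p
  proof -
    have "(\<Sum>i=1..p. norm (m i) powr (2 + d)) = (\<Sum>i=1..p. norm (mat_log (M i)) powr (2 + d))"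
      using assms(3) by (intro sum.cong refl) (simp add: m_def norm_mat_log)
    then show ?thesis using C3(2)[of p] p by (simp add: field_simps)
  qed
  have mxb: "i \<in> {1..p} \<Longrightarrow> norm (m i) \<le> mx p" "(\<lambda>p. mx p / sqrt (real p)) \<longlonglongrightarrow> 0" for i p
    unfolding mx_def using d(1) C3(1) mb
    by (auto intro!: max_of_moment_bound[of d "\<lambda>i. norm (m i)" C3])
  have Xspd: "X i j \<omega> \<in> spd" if "i \<ge> 1" "j \<in> {1..n}" "\<omega> \<in> space P" for i j \<omega>
    using assms(8)[OF that(1,2)] that(3) by (simp add: log_normal_def)
  interpret prob_space P by (rule assms(1))
  interpret g: gaussian_populations P n m Sigma Z bnd mx
  proof
    show "n \<ge> 3" by (rule assms(2))
    show "Sigma i \<in> spd" if "i \<ge> 1" for i using assms(4) that by blast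
    have "indep_vars (\<lambda>_. borel) (\<lambda>x \<omega>. (\<lambda>y. log_vec y - m (fst x)) ((case x of (i, j) \<Rightarrow> X i j) \<omega>)) ({1..} \<times> {1..n})"
      by (rule indep_vars_compose2[OF assms(9)]) measurable
    also have "(\<lambda>x \<omega>. (\<lambda>y. log_vec y - m (fst x)) ((case x of (i, j) \<Rightarrow> X i j) \<omega>)) = (\<lambda>(i, j). Z i j)"
      by (auto simp: fun_eq_iff Z_def)
    finally show "indep_vars (\<lambda>_. borel) (\<lambda>(i, j). Z i j) ({1..} \<times> {1..n})" .
    show "gaussian (\<lambda>\<omega>. u \<bullet> Z i j \<omega>) (u \<bullet> (Sigma i *v u))" if "i \<ge> 1" "j \<in> {1..n}" for i j u
      unfolding Z_def m_def using assms(8)[OF that] assms(4)[OF that(1)]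
      by (intro gaussian_linear_functional) (auto simp: log_normal_def)
    show "(\<Sum>i=1..p. trace (Sigma i) ^ 4) \<le> bnd * real p" if "p \<ge> 1" for p
    proof -
      have "(\<Sum>i=1..p. trace (Sigma i) ^ 4) \<le> C1 * real p" using C1(2)[of p] that by (simp add: field_simps)
      also have "\<dots> \<le> bnd * real p" using C2 by (simp add: bnd_def mult_right_mono)
      finally show ?thesis .
    qed
    show "(\<Sum>i=1..p. m i \<bullet> (Sigma i *v m i)) \<le> bnd * real p" if "p \<ge> 1" for p
    proof -
      have "(\<Sum>i=1..p. m i \<bullet> (Sigma i *v m i)) \<le> C2 * real p" using C2(2)[of p] that by (simp add: field_simps m_def)
      also have "\<dots> \<le> bnd * real p" using C1 by (simp add: bnd_def mult_right_mono)
      finally show ?thesis .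
    qed
    show "norm (m i) \<le> mx p" if "i \<in> {1..p}" for i p by (rule mxb(1)[OF that])
    show "(\<lambda>p. mx p / sqrt (real p)) \<longlonglongrightarrow> 0" by (rule mxb(2))
  qed
  define q where "q = real CARD('n uprod)"
  define L where "L p \<omega> l Ps v u = g.avg_loss p \<omega> l Ps (v - q - 1) u"
    for p \<omega> l Ps v u
  define R where "R p \<omega> l Ps v u = g.avg_sure p \<omega> l Ps (v - q - 1) u"
    for p \<omega> l Ps v u
  have n1: "n \<ge> 1" using assms(2) by simp
  have lx: "(\<lambda>j. log_vec (X i j \<omega>)) = (\<lambda>j. m i + Z i j \<omega>)" for i \<omega> by (simp add: Z_def)
  have lossL: "loss p (\<lambda>i. M_est n l u (\<lambda>j. X i j \<omega>)) (\<lambda>i. Sigma_est n Ps v (\<lambda>j. X i j \<omega>)) M Sigma = L p \<omega> l Ps v (log_vec u)"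
    if "\<omega> \<in> space P" "u \<in> spd" for p \<omega> l Ps v u
    using loss_eq[of p n "\<lambda>i j. X i j \<omega>" u M l Ps v Sigma] Xspd that assms(3)
    by (simp add: L_def q_def lx smean_shift[OF n1] scat_shift[OF n1] m_def[symmetric])
  have sureR: "SURE n p (\<lambda>i j. X i j \<omega>) (l, Ps, v, u) = R p \<omega> l Ps v (log_vec u)"
    if "\<omega> \<in> space P" "u \<in> spd" "Ps \<in> spd" for p \<omega> l Ps v u
    using SURE_eq[of p n "\<lambda>i j. X i j \<omega>" u Ps l v] Xspd that
    by (simp add: R_def q_def lx smean_shift[OF n1] scat_shift[OF n1])
  define c where "c = norm Psi + norm (log_vec mu)"
  define k where "k = 2 * (nu - q - 1) * norm Psi"
  define Gap where "Gap p \<omega> = eps p + 2 * g.approx_error c p \<omega> + k * g.escape_term (norm Psi) p \<omega>" for p \<omega>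
  have gpar: "nu - q - 1 > 0" using par by (simp add: q_def)
  have k0: "k \<ge> 0" using gpar by (simp add: k_def)
  have c0: "c \<ge> 0" by (simp add: c_def)
  have selected: "AE \<omega> in P. loss p (\<lambda>i. M_est n (lamh p \<omega>) (muh p \<omega>) (\<lambda>j. X i j \<omega>))
      (\<lambda>i. Sigma_est n (Psih p \<omega>) (nuh p \<omega>) (\<lambda>j. X i j \<omega>)) M Sigma \<le> L p \<omega> lam Psi nu (log_vec mu) + Gap p \<omega>"
    if p: "p \<ge> 1" for p
    using assms(16)[OF p] AE_space
  proof eventually_elim
    case (elim \<omega>)
    define x where "x = (\<lambda>i j. X i j \<omega>)"
    have x: "x i j \<in> spd" if "i \<in> {1..p}" "j \<in> {1..n}" for i j using Xspd that elim(2) by (simp add: x_def)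
    have sc: "scatter n (x i) = g.SS i \<omega>" and lm: "norm (mat_log (log_mean n (x i))) = norm (m i + g.zb i \<omega>)" if "i \<in> {1..p}" for i
      using scatter_eq_scat[of n "x i"] log_mean[of n "x i"] x[OF that]
      by (simp_all add: norm_mat_log x_def lx smean_shift[OF n1] scat_shift[OF n1])
    define r where "r = (MAX i\<in>{1..p}. norm (scatter n (x i)))"
    define ry where "ry = (MAX i\<in>{1..p}. norm (mat_log (log_mean n (x i))))"
    have r: "r = (MAX i\<in>{1..p}. norm (g.SS i \<omega>))" and ry: "ry = (MAX i\<in>{1..p}. norm (m i + g.zb i \<omega>))"
      unfolding r_def ry_def using sc lm by (auto intro!: arg_cong[where f = Max] image_cong)
    have ch: "SURE_choice (eps p) n p x (lamh p \<omega>, Psih p \<omega>, nuh p \<omega>, muh p \<omega>)" using elim(1) by (simp add: x_def)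
    have "feasible n p x (lamh p \<omega>, Psih p \<omega>, nuh p \<omega>, muh p \<omega>)" by (rule SURE_choiceD(1)[OF ch assms(14)])
    then have f: "lamh p \<omega> > 0" "nuh p \<omega> - q - 1 > 0" "Psih p \<omega> \<in> spd" "muh p \<omega> \<in> spd"
      "norm (Psih p \<omega>) \<le> r" "norm (log_vec (muh p \<omega>)) \<le> ry"
      unfolding feasible_def prod.case r_def[symmetric] ry_def[symmetric] by (auto simp: q_def norm_mat_log)
    have "norm (Psih p \<omega>) > 0" using f(3) zero_not_spd by auto
    then have r0: "r > 0" using f(5) by linarith
    have ry0: "ry \<ge> 0" using f(6) norm_ge_zero order_trans by blast
    note cf = clip_feasible[OF x par(1,3,4,2) r_def r0 ry_def ry0]
    have "SURE n p x (lamh p \<omega>, Psih p \<omega>, nuh p \<omega>, muh p \<omega>)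
        \<le> SURE n p x (lam, clip r Psi, nu, mat_exp (clip ry (mat_log mu))) + eps p"
      by (rule SURE_choiceD(2)[OF ch assms(14) cf(1)])
    then have sel: "R p \<omega> (lamh p \<omega>) (Psih p \<omega>) (nuh p \<omega>) (log_vec (muh p \<omega>))
        \<le> R p \<omega> lam (clip r Psi) nu (clip ry (log_vec mu)) + eps p"
      unfolding x_def by (simp only: sureR[OF elim(2)] f cf)
    have "L p \<omega> (lamh p \<omega>) (Psih p \<omega>) (nuh p \<omega>) (log_vec (muh p \<omega>)) \<le> L p \<omega> lam Psi nu (log_vec mu) + Gap p \<omega>"
      unfolding L_def Gap_def c_def k_def
      by (rule g.selected_loss_le[OF p elim(2) f(1,2) f(5)[unfolded r] f(6)[unfolded ry] par(1) gpar
          sel[unfolded R_def r ry]])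
    then show ?case using lossL[OF elim(2) f(4)] by simp
  qed
  have Lint: "integrable P (\<lambda>\<omega>. L p \<omega> lam Psi nu (log_vec mu))" for p
    unfolding L_def by (rule g.loss_integrable)
  have L0: "L p \<omega> l Ps v u \<ge> 0" for p \<omega> l Ps v u
    unfolding L_def smean_real pop_loss_def by (intro divide_nonneg_nonneg sum_nonneg add_nonneg_nonneg) auto
  have Gint: "integrable P (Gap p)" and Gexp: "expectation (Gap p) = eps p + 2 * expectation (g.approx_error c p) + k * expectation (g.escape_term (norm Psi) p)"
    if p: "p \<ge> 1" for p
    unfolding Gap_def using g.approx_error_moment(1)[OF p c0] g.escape_term_integrable(1)[OF p, of "norm Psi"]
    by (simp_all add: prob_space)
  have G0: "Gap p \<omega> \<ge> 0" if p: "p \<ge> 1" for p \<omega>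
    unfolding Gap_def using less_imp_le[OF assms(14)] g.approx_error_nonneg[OF p c0] g.escape_term_nonneg k0
    by (intro add_nonneg_nonneg mult_nonneg_nonneg) auto
  have diff: "risk P p (\<lambda>i \<omega>. M_est n (lamh p \<omega>) (muh p \<omega>) (\<lambda>j. X i j \<omega>))
               (\<lambda>i \<omega>. Sigma_est n (Psih p \<omega>) (nuh p \<omega>) (\<lambda>j. X i j \<omega>)) M Sigma
      - risk P p (\<lambda>i \<omega>. M_est n lam mu (\<lambda>j. X i j \<omega>))
                 (\<lambda>i \<omega>. Sigma_est n Psi nu (\<lambda>j. X i j \<omega>)) M Sigma \<le> ereal (expectation (Gap p))"
    (is "?A - ?B \<le> _") if p: "p \<ge> 1" for p
  proof -
    define b where "b = expectation (\<lambda>\<omega>. L p \<omega> lam Psi nu (log_vec mu))"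
    have b0: "b \<ge> 0" unfolding b_def by (intro Bochner_Integration.integral_nonneg L0)
    have "(\<integral>\<^sup>+\<omega>. ennreal (loss p (\<lambda>i. M_est n lam mu (\<lambda>j. X i j \<omega>)) (\<lambda>i. Sigma_est n Psi nu (\<lambda>j. X i j \<omega>)) M Sigma) \<partial>P)
        = (\<integral>\<^sup>+\<omega>. ennreal (L p \<omega> lam Psi nu (log_vec mu)) \<partial>P)"
      using lossL par by (intro nn_integral_cong) simp
    also have "\<dots> = ennreal b" unfolding b_def by (intro nn_integral_eq_integral Lint) (simp add: L0)
    finally have B: "?B = ereal b" unfolding risk_def using b0 by (simp add: enn2ereal_ennreal)
    have "(\<integral>\<^sup>+\<omega>. ennreal (loss p (\<lambda>i. M_est n (lamh p \<omega>) (muh p \<omega>) (\<lambda>j. X i j \<omega>))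
        (\<lambda>i. Sigma_est n (Psih p \<omega>) (nuh p \<omega>) (\<lambda>j. X i j \<omega>)) M Sigma) \<partial>P)
      \<le> (\<integral>\<^sup>+\<omega>. ennreal (L p \<omega> lam Psi nu (log_vec mu) + Gap p \<omega>) \<partial>P)"
      using selected[OF p] by (intro nn_integral_mono_AE) (auto intro: ennreal_leI)
    also have "\<dots> = ennreal (b + expectation (Gap p))"
      unfolding b_def using Lint Gint[OF p] L0 G0[OF p] by (subst nn_integral_eq_integral) auto
    finally have "?A \<le> enn2ereal (ennreal (b + expectation (Gap p)))"
      unfolding risk_def less_eq_ennreal.rep_eq .
    also have "\<dots> = ereal (b + expectation (Gap p))"
      using b0 Bochner_Integration.integral_nonneg[of P "Gap p"] G0[OF p] by (intro enn2ereal_ennreal) simp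
    finally have "?A \<le> ereal (b + expectation (Gap p))" .
    then show ?thesis unfolding B by (cases ?A) auto
  qed
  have "(\<lambda>p. eps p + 2 * expectation (g.approx_error c p) + k * expectation (g.escape_term (norm Psi) p)) \<longlonglongrightarrow> 0 + 2 * 0 + k * 0"
    by (intro tendsto_add tendsto_mult tendsto_const assms(15) g.approx_error_tendsto_zero[OF c0] g.escape_term_tendsto_zero) simp
  moreover have "eventually (\<lambda>p. eps p + 2 * expectation (g.approx_error c p) + k * expectation (g.escape_term (norm Psi) p) = expectation (Gap p)) sequentially"
    using eventually_ge_at_top[of 1] by eventually_elim (simp add: Gexp)
  ultimately have "(\<lambda>p. expectation (Gap p)) \<longlonglongrightarrow> 0" by (simp add: tendsto_cong)
  then have lim: "limsup (\<lambda>p. ereal (expectation (Gap p))) = 0"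
    by (intro lim_imp_Limsup) (simp_all add: zero_ereal_def)
  show "limsup (\<lambda>p. risk P p (\<lambda>i \<omega>. M_est n (lamh p \<omega>) (muh p \<omega>) (\<lambda>j. X i j \<omega>))
               (\<lambda>i \<omega>. Sigma_est n (Psih p \<omega>) (nuh p \<omega>) (\<lambda>j. X i j \<omega>)) M Sigma
      - risk P p (\<lambda>i \<omega>. M_est n lam mu (\<lambda>j. X i j \<omega>))
                 (\<lambda>i \<omega>. Sigma_est n Psi nu (\<lambda>j. X i j \<omega>)) M Sigma) \<le> 0"
    unfolding lim[symmetric]
    by (rule Limsup_mono, rule eventually_mono[OF eventually_ge_at_top[of 1]], rule diff)
qed

end
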